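(* For any $p \ge 1$ there exists a constant $C>0$, independent of the non-negative integer $\ell$, such that the solution $\{X_t\}_{t\in[0,T]}$ of the SDE and the weak second order scheme $\{\bar X_{t_k}\}_{0\le k\le 2^\ell}$ with step-size $\Delta_\ell = T/2^\ell$ satisfy $$\mathbb{E}\Bigl[\max_{0\le k\le 2^\ell}\|X_{t_k}-\bar X_{t_k}\|^{2p}\Bigr]\le C\,\Delta_\ell^{p}.$$
   Context: **SDE.** Let $T>0$, $d\ge1$, $N_S\ge 0$, $N_R\ge 1$ be integers (except $T$, which is real), $N=N_S+N_R$, $x\in\mathbb{R}^N$. $B=(B^1,\dots,B^d)$ is a standard $d$-dimensional Brownian motion on a filtered probability space $(\Omega,\mathcal F,\{\mathcal F_t\}_{t\ge0},\mathbb P)$, and $\widetilde B=(\widetilde B^2,\dots,\widetilde B^d)$ is a standard $(d-1)$-dimensional Brownian motion independent of $B$; both are adapted to $\{\mathcal F_t\}$ with increments after time $t$ independent of $\mathcal F_t$. The process $X$ solves the Itô SDE $$dX_t=\sigma_0(X_t)\,dt+\sum_{1\le j\le d}\sigma_j(X_t)\,dB_t^j,\quad X_0=x,$$ where $\sigma_0=[\sigma_{S,0}^\top,\sigma_{R,0}^\top]^\top$, $\sigma_j=[\mathbf 0_{N_S}^\top,\sigma_{R,j}^\top]^\top$ for $1\le j\le d$, with $\sigma_{S,0}:\mathbb R^N\to\mathbb R^{N_S}$ and $\sigma_{R,j}:\mathbb R^N\to\mathbb R^{N_R}$, $0\le j\le d$. $\|\cdot\|$ is the Euclidean norm. **Operators.**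 For smooth $\varphi$, $\mathcal L_0\varphi=\sum_k\sigma_0^k\partial_{x_k}\varphi+\frac12\sum_{1\le j\le d}\sum_{k_1,k_2}\sigma_j^{k_1}\sigma_j^{k_2}\partial_{x_{k_1}}\partial_{x_{k_2}}\varphi$ and $\mathcal L_i\varphi=\sum_k\sigma_i^k\partial_{x_k}\varphi$ for $1\le i\le d$; they act componentwise on vector-valued functions. For $1\le i_1,i_2\le d$, $[\sigma_{i_1},\sigma_{i_2}]=\mathcal L_{i_1}\sigma_{i_2}-\mathcal L_{i_2}\sigma_{i_1}$. For $1\le j\le d$, $[\sigma_0,\sigma_j]=\sum_k\{\widetilde\sigma_0^k\partial_{x_k}\sigma_j-\sigma_j^k\partial_{x_k}\widetilde\sigma_0\}$ where $\widetilde\sigma_0=\sigma_0-\frac12\sum_{1\le i\le N}\sum_{1\le j\le d}\sigma_j^i\partial_i\sigma_j$. **Standing assumptions.** (1) $\sigma_j\in C_b^\infty(\mathbb R^N;\mathbb R^N)$, $0\le j\le d$, where $C_b^K(\mathbb R^n;\mathbb R^m)$ is the space of $K$-times differentiable functions whose partial derivatives up to order $K$ are bounded. (2) If $N_S=0$: $\mathrm{Span}\{\sigma_1(z),\dots,\sigma_d(z)\}=\mathbb R^N$ for all $z\in\mathbb R^N$. If $N_S\ge1$: for all $z\in\mathbb R^N$, $\mathrm{Span}\{\sigma_{R,1}(z),\dots,\sigma_{R,d}(z)\}=\mathbb R^{N_R}$ and $\mathrm{Span}\{\sigma_1(z),\dots,\sigma_d(z),[\sigma_0,\sigma_1](z),\dots,[\sigma_0,\sigma_d](z)\}=\mathbb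 R^N$. **Random variables.** For $0\le s\le t$: $\Delta B^j_{t,s}=B^j_t-B^j_s$ for $1\le j\le d$, $\Delta B^0_{t,s}=t-s$, $\Delta\widetilde B^j_{t,s}=\widetilde B^j_t-\widetilde B^j_s$, $\Delta\widetilde A^{j_1j_2}_{t,s}=\Delta B^{j_1}_{t,s}\Delta\widetilde B^{j_2}_{t,s}$ for $1\le j_1<j_2\le d$. If $N_S=0$, $\Delta\eta^{j_1j_2}_{t,s}=\frac12(\Delta B^{j_1}_{t,s}\Delta B^{j_2}_{t,s}-(t-s)\mathbf 1_{j_1=j_2\ne0})$ for all $0\le j_1,j_2\le d$. If $N_S\ge1$, the same formula is used when $1\le j_1,j_2\le d$ or $j_1=j_2=0$, while $\Delta\eta^{0j_2}_{t,s}=\int_s^t\int_s^{v}du\,dB^{j_2}_v$ for $1\le j_2\le d$ and $\Delta\eta^{j_10}_{t,s}=\int_s^t\int_s^v dB^{j_1}_u\,dv$ for $1\le j_1\le d$. **Weak second order scheme.** With $\Delta_\ell=T/2^\ell$, $t_k=k\Delta_\ell$, set $\bar X_0=x$ and for $0\le k\le 2^\ell-1$ $$\bar X_{t_{k+1}}=\bar X_{t_k}+\sum_{0\le j\le d}\sigma_j(\bar X_{t_k})\Delta B^j_{t_{k+1},t_k}+\sum_{0\le j_1,j_2\le d}\mathcal L_{j_1}\sigma_{j_2}(\bar X_{t_k})\Delta\eta^{j_1j_2}_{t_{k+1},t_k}+\tfrac12\sum_{1\le j_1<j_2\le d}[\sigma_{j_1},\sigma_{j_2}](\bar X_{t_k})\Delta\widetilde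 A^{j_1j_2}_{t_{k+1},t_k}.$$ *)

theory Defs
  imports "HOL-Probability.Probability"
begin

section \<open>Smooth bounded coefficients and differential operators\<close>

definition partial_deriv :: "'n \<Rightarrow> (real^'n \<Rightarrow> 'b::real_normed_vector) \<Rightarrow> real^'n \<Rightarrow> 'b"
  where "partial_deriv k f z = vector_derivative (\<lambda>h. f (z + h *\<^sub>R axis k 1)) (at 0)"

definition iter_partial :: "'n list \<Rightarrow> (real^'n \<Rightarrow> 'b::real_normed_vector) \<Rightarrow> real^'n \<Rightarrow> 'b"
  where "iter_partial ks f = foldr partial_deriv ks f"

text \<open>The partial derivatives of order at most \<open>K\<close> include the function itself (order 0).
  A function is \<open>K\<close> times differentiable iff all its partial derivatives of order less
  than \<open>K\<close> are (totally) differentiable.\<close>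

definition Cb :: "nat \<Rightarrow> (real^'n \<Rightarrow> 'b::real_normed_vector) set"
  where "Cb K = {f.
    (\<forall>ks z. length ks < K \<longrightarrow> iter_partial ks f differentiable (at z)) \<and>
    (\<forall>ks. length ks \<le> K \<longrightarrow> bounded (range (iter_partial ks f)))}"

definition Cb_infinity :: "(real^'n \<Rightarrow> 'b::real_normed_vector) set"
  where "Cb_infinity = (\<Inter>K. Cb K)"

text \<open>The coefficients are \<open>\<sigma> 0, \<dots>, \<sigma> d\<close>, with \<open>\<sigma> 0\<close> the drift.
  The operator \<open>Lop d \<sigma> i\<close> acts on vector-valued functions, componentwise.\<close>

definition Lop :: "nat \<Rightarrow> (nat \<Rightarrow> real^'n \<Rightarrow> real^'n) \<Rightarrow> nat \<Rightarrow>
    (real^'n \<Rightarrow> 'b::real_normed_vector) \<Rightarrow> real^'n \<Rightarrow> 'b"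
  where "Lop d \<sigma> i \<phi> z =
    (if i = 0 then
       (\<Sum>k\<in>UNIV. (\<sigma> 0 z $ k) *\<^sub>R partial_deriv k \<phi> z)
       + (1/2) *\<^sub>R (\<Sum>j=1..d. \<Sum>k1\<in>UNIV. \<Sum>k2\<in>UNIV.
            (\<sigma> j z $ k1 * \<sigma> j z $ k2) *\<^sub>R partial_deriv k1 (partial_deriv k2 \<phi>) z)
     else (\<Sum>k\<in>UNIV. (\<sigma> i z $ k) *\<^sub>R partial_deriv k \<phi> z))"

definition strat_drift :: "nat \<Rightarrow> (nat \<Rightarrow> real^'n \<Rightarrow> real^'n) \<Rightarrow> real^'n \<Rightarrow> real^'n"
  where "strat_drift d \<sigma> z =
    \<sigma> 0 z - (1/2) *\<^sub>R (\<Sum>i\<in>UNIV. \<Sum>j=1..d. (\<sigma> j z $ i) *\<^sub>R partial_deriv i (\<sigma> j) z)"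

text \<open>\<open>bracket d \<sigma> i j\<close> is meant for \<open>1 \<le> i, j \<le> d\<close>; brackets with the drift are
  taken with the Stratonovich-corrected drift and are given by \<open>bracket0\<close>.\<close>

definition bracket :: "nat \<Rightarrow> (nat \<Rightarrow> real^'n \<Rightarrow> real^'n) \<Rightarrow> nat \<Rightarrow> nat \<Rightarrow> real^'n \<Rightarrow> real^'n"
  where "bracket d \<sigma> i j z = Lop d \<sigma> i (\<sigma> j) z - Lop d \<sigma> j (\<sigma> i) z"

definition bracket0 :: "nat \<Rightarrow> (nat \<Rightarrow> real^'n \<Rightarrow> real^'n) \<Rightarrow> nat \<Rightarrow> real^'n \<Rightarrow> real^'n"
  where "bracket0 d \<sigma> j z =
    (\<Sum>k\<in>UNIV. (strat_drift d \<sigma> z $ k) *\<^sub>R partial_deriv k (\<sigma> j) z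
              - (\<sigma> j z $ k) *\<^sub>R partial_deriv k (strat_drift d \<sigma>) z)"

text \<open>The state space is \<open>real^'n\<close>; \<open>S\<close> is the (possibly empty) set of smooth coordinates,
  so that \<open>N\<^sub>S = card S\<close> and \<open>N\<^sub>R = card (- S)\<close>. The space of rough components is embedded
  as \<open>{v. \<forall>k\<in>S. v $ k = 0}\<close>, which for \<open>j \<ge> 1\<close> contains the values of \<open>\<sigma> j\<close>.\<close>

definition degenerate_noise :: "nat \<Rightarrow> 'n set \<Rightarrow> (nat \<Rightarrow> real^'n \<Rightarrow> real^'n) \<Rightarrow> bool"
  where "degenerate_noise d S \<sigma> \<longleftrightarrow> (\<forall>j\<in>{1..d}. \<forall>z. \<forall>k\<in>S. \<sigma> j z $ k = 0)"

definition span_condition :: "nat \<Rightarrow> 'n set \<Rightarrow> (nat \<Rightarrow> real^'n \<Rightarrow> real^'n) \<Rightarrow> bool"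
  where "span_condition d S \<sigma> \<longleftrightarrow>
    (if S = {} then \<forall>z. span ((\<lambda>j. \<sigma> j z) ` {1..d}) = UNIV
     else \<forall>z. span ((\<lambda>j. \<sigma> j z) ` {1..d}) = {v. \<forall>k\<in>S. v $ k = 0} \<and>
              span ((\<lambda>j. \<sigma> j z) ` {1..d} \<union> (\<lambda>j. bracket0 d \<sigma> j z) ` {1..d}) = UNIV)"

section \<open>Brownian motions and filtrations\<close>

text \<open>Time runs through the nonnegative reals; values at negative times are irrelevant.\<close>

definition filtered :: "'w measure \<Rightarrow> (real \<Rightarrow> 'w measure) \<Rightarrow> bool"
  where "filtered M F \<longleftrightarrow> (\<forall>t\<ge>0. subalgebra M (F t)) \<and>
    (\<forall>s t. 0 \<le> s \<longrightarrow> s \<le> t \<longrightarrow> sets (F s) \<subseteq> sets (F t))"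

definition brownian :: "'w measure \<Rightarrow> (real \<Rightarrow> 'w \<Rightarrow> real) \<Rightarrow> bool"
  where "brownian M W \<longleftrightarrow>
    (\<forall>t\<ge>0. W t \<in> borel_measurable M) \<and>
    (AE \<omega> in M. W 0 \<omega> = 0) \<and>
    (\<forall>\<omega>\<in>space M. continuous_on {0..} (\<lambda>t. W t \<omega>)) \<and>
    (\<forall>s t. 0 \<le> s \<longrightarrow> s < t \<longrightarrow>
       distributed M lborel (\<lambda>\<omega>. W t \<omega> - W s \<omega>) (normal_density 0 (sqrt (t - s)))) \<and>
    (\<forall>\<tau>::nat \<Rightarrow> real. \<forall>m. 0 \<le> \<tau> 0 \<longrightarrow> mono \<tau> \<longrightarrow>
       prob_space.indep_vars M (\<lambda>_. borel) (\<lambda>i \<omega>. W (\<tau> (Suc i)) \<omega> - W (\<tau> i) \<omega>) {..<m})"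

text \<open>A family of processes indexed by \<open>J\<close>, seen as one random element of a path space.\<close>

definition path_space :: "nat set \<Rightarrow> (nat \<times> real \<Rightarrow> real) measure"
  where "path_space J = (\<Pi>\<^sub>M _\<in>J \<times> {0..}. borel)"

definition path :: "nat set \<Rightarrow> (nat \<Rightarrow> real \<Rightarrow> 'w \<Rightarrow> real) \<Rightarrow> 'w \<Rightarrow> (nat \<times> real \<Rightarrow> real)"
  where "path J W \<omega> = (\<lambda>(j, t)\<in>J \<times> {0..}. W j t \<omega>)"

definition brownian_vec :: "'w measure \<Rightarrow> nat set \<Rightarrow> (nat \<Rightarrow> real \<Rightarrow> 'w \<Rightarrow> real) \<Rightarrow> bool"
  where "brownian_vec M J W \<longleftrightarrow> (\<forall>j\<in>J. brownian M (W j)) \<and>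
    prob_space.indep_vars M (\<lambda>j. path_space {j}) (\<lambda>j. path {j} W) J"

definition adapted_fam :: "(real \<Rightarrow> 'w measure) \<Rightarrow> nat set \<Rightarrow> (nat \<Rightarrow> real \<Rightarrow> 'w \<Rightarrow> real) \<Rightarrow> bool"
  where "adapted_fam F J W \<longleftrightarrow> (\<forall>j\<in>J. \<forall>t\<ge>0. W j t \<in> borel_measurable (F t))"

definition incr_after :: "real \<Rightarrow> (nat \<Rightarrow> real \<Rightarrow> 'w \<Rightarrow> real) \<Rightarrow> nat \<Rightarrow> real \<Rightarrow> 'w \<Rightarrow> real"
  where "incr_after t W j u \<omega> = W j (t + u) \<omega> - W j t \<omega>"

text \<open>\<open>B\<close> has components \<open>1..d\<close> and \<open>B'\<close> has components \<open>2..d\<close> (none if \<open>d = 1\<close>).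
  The last condition makes \<open>F t\<close> independent of the sigma-algebra generated by all increments of
  \<open>B\<close> and \<open>B'\<close> after time \<open>t\<close> jointly.\<close>

definition driving_noise :: "'w measure \<Rightarrow> (real \<Rightarrow> 'w measure) \<Rightarrow> nat \<Rightarrow>
    (nat \<Rightarrow> real \<Rightarrow> 'w \<Rightarrow> real) \<Rightarrow> (nat \<Rightarrow> real \<Rightarrow> 'w \<Rightarrow> real) \<Rightarrow> bool"
  where "driving_noise M F d B B' \<longleftrightarrow>
    brownian_vec M {1..d} B \<and> brownian_vec M {2..d} B' \<and>
    prob_space.indep_var M (path_space {1..d}) (path {1..d} B) (path_space {2..d}) (path {2..d} B') \<and>
    adapted_fam F {1..d} B \<and> adapted_fam F {2..d} B' \<and>
    (\<forall>t\<ge>0. prob_space.indep_set M (sets (F t))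
       (sets (vimage_algebra (space M)
          (\<lambda>\<omega>. (path {1..d} (incr_after t B) \<omega>, path {2..d} (incr_after t B') \<omega>))
          (path_space {1..d} \<Otimes>\<^sub>M path_space {2..d}))))"

section \<open>The Ito integral\<close>

text \<open>A simple integrand on \<open>[a, b]\<close> is \<open>\<Sum>i<m. indicator {\<tau> i<..\<tau> (i+1)} s *\<^sub>R \<xi> i \<omega>\<close> with
  \<open>\<xi> i\<close> bounded and measurable with respect to \<open>F (\<tau> i)\<close>.\<close>

definition simple_integrand :: "'w measure \<Rightarrow> (real \<Rightarrow> 'w measure) \<Rightarrow> real \<Rightarrow> real \<Rightarrow>
    nat \<Rightarrow> (nat \<Rightarrow> real) \<Rightarrow> (nat \<Rightarrow> 'w \<Rightarrow> 'b::euclidean_space) \<Rightarrow> bool"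
  where "simple_integrand M F a b m \<tau> \<xi> \<longleftrightarrow>
    \<tau> 0 = a \<and> \<tau> m = b \<and> (\<forall>i<m. \<tau> i \<le> \<tau> (Suc i)) \<and>
    (\<forall>i<m. \<xi> i \<in> borel_measurable (F (\<tau> i)) \<and> bounded (\<xi> i ` space M))"

definition simple_value :: "nat \<Rightarrow> (nat \<Rightarrow> real) \<Rightarrow> (nat \<Rightarrow> 'w \<Rightarrow> 'b::euclidean_space) \<Rightarrow>
    real \<Rightarrow> 'w \<Rightarrow> 'b"
  where "simple_value m \<tau> \<xi> s \<omega> = (\<Sum>i<m. indicator {\<tau> i<..\<tau> (Suc i)} s *\<^sub>R \<xi> i \<omega>)"

definition simple_integral :: "(real \<Rightarrow> 'w \<Rightarrow> real) \<Rightarrow> nat \<Rightarrow> (nat \<Rightarrow> real) \<Rightarrow>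
    (nat \<Rightarrow> 'w \<Rightarrow> 'b::euclidean_space) \<Rightarrow> 'w \<Rightarrow> 'b"
  where "simple_integral W m \<tau> \<xi> \<omega> = (\<Sum>i<m. (W (\<tau> (Suc i)) \<omega> - W (\<tau> i) \<omega>) *\<^sub>R \<xi> i \<omega>)"

text \<open>\<open>I\<close> is (a version of) \<open>\<integral>\<^sub>a\<^sup>b H\<^sub>s dW\<^sub>s\<close>: the \<open>L\<^sup>2\<close> limit of the integrals of simple
  integrands converging to \<open>H\<close> in \<open>L\<^sup>2(ds \<otimes> P)\<close>. This covers all integrands needed here, since
  the coefficients of the SDE are bounded. The integral is determined up to null sets.\<close>

definition has_ito_integral :: "'w measure \<Rightarrow> (real \<Rightarrow> 'w measure) \<Rightarrow> (real \<Rightarrow> 'w \<Rightarrow> real) \<Rightarrow>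
    real \<Rightarrow> real \<Rightarrow> (real \<Rightarrow> 'w \<Rightarrow> 'b::euclidean_space) \<Rightarrow> ('w \<Rightarrow> 'b) \<Rightarrow> bool"
  where "has_ito_integral M F W a b H I \<longleftrightarrow>
    0 \<le> a \<and> a \<le> b \<and>
    (\<lambda>(s, \<omega>). H s \<omega>) \<in> borel_measurable (restrict_space lborel {a..b} \<Otimes>\<^sub>M M) \<and>
    I \<in> borel_measurable M \<and>
    (\<exists>m \<tau> \<xi>. (\<forall>n. simple_integrand M F a b (m n) (\<tau> n) (\<xi> n)) \<and>
       (\<lambda>n. \<integral>\<^sup>+ \<omega>. (\<integral>\<^sup>+ s. ennreal ((norm (simple_value (m n) (\<tau> n) (\<xi> n) s \<omega> - H s \<omega>))\<^sup>2)
              \<partial>(restrict_space lborel {a..b})) \<partial>M) \<longlonglongrightarrow> 0 \<and>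
       (\<lambda>n. \<integral>\<^sup>+ \<omega>. ennreal ((norm (simple_integral W (m n) (\<tau> n) (\<xi> n) \<omega> - I \<omega>))\<^sup>2) \<partial>M)
          \<longlonglongrightarrow> 0)"

definition ito_integral :: "'w measure \<Rightarrow> (real \<Rightarrow> 'w measure) \<Rightarrow> (real \<Rightarrow> 'w \<Rightarrow> real) \<Rightarrow>
    real \<Rightarrow> real \<Rightarrow> (real \<Rightarrow> 'w \<Rightarrow> 'b::euclidean_space) \<Rightarrow> 'w \<Rightarrow> 'b"
  where "ito_integral M F W a b H = (SOME I. has_ito_integral M F W a b H I)"

definition sde_solution :: "'w measure \<Rightarrow> (real \<Rightarrow> 'w measure) \<Rightarrow> nat \<Rightarrow>
    (nat \<Rightarrow> real^'n \<Rightarrow> real^'n) \<Rightarrow> (nat \<Rightarrow> real \<Rightarrow> 'w \<Rightarrow> real) \<Rightarrow> real \<Rightarrow> real^'n \<Rightarrow>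
    (real \<Rightarrow> 'w \<Rightarrow> real^'n) \<Rightarrow> bool"
  where "sde_solution M F d \<sigma> B T x X \<longleftrightarrow>
    (\<forall>t\<in>{0..T}. X t \<in> borel_measurable (F t)) \<and>
    (\<forall>\<omega>\<in>space M. continuous_on {0..T} (\<lambda>t. X t \<omega>)) \<and>
    (AE \<omega> in M. X 0 \<omega> = x) \<and>
    (\<forall>t\<in>{0..T}. \<exists>I.
       (\<forall>j\<in>{1..d}. has_ito_integral M F (B j) 0 t (\<lambda>s \<omega>. \<sigma> j (X s \<omega>)) (I j)) \<and>
       (AE \<omega> in M. X t \<omega> = x + integral {0..t} (\<lambda>s. \<sigma> 0 (X s \<omega>)) + (\<Sum>j=1..d. I j \<omega>)))"

section \<open>The weak second order scheme\<close>

text \<open>Component \<open>0\<close> of the driving noise is time; increments are over \<open>[s, t]\<close>.\<close>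

definition dB :: "(nat \<Rightarrow> real \<Rightarrow> 'w \<Rightarrow> real) \<Rightarrow> nat \<Rightarrow> real \<Rightarrow> real \<Rightarrow> 'w \<Rightarrow> real"
  where "dB B j s t \<omega> = (if j = 0 then t - s else B j t \<omega> - B j s \<omega>)"

definition dA :: "(nat \<Rightarrow> real \<Rightarrow> 'w \<Rightarrow> real) \<Rightarrow> (nat \<Rightarrow> real \<Rightarrow> 'w \<Rightarrow> real) \<Rightarrow>
    nat \<Rightarrow> nat \<Rightarrow> real \<Rightarrow> real \<Rightarrow> 'w \<Rightarrow> real"
  where "dA B B' j1 j2 s t \<omega> = dB B j1 s t \<omega> * dB B' j2 s t \<omega>"

text \<open>In the last case the inner integral \<open>\<integral>\<^sub>s\<^sup>v dB\<^sub>u\<close> is the increment of \<open>B j1\<close> over \<open>[s, v]\<close>.\<close>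

definition deta :: "'w measure \<Rightarrow> (real \<Rightarrow> 'w measure) \<Rightarrow> 'n set \<Rightarrow>
    (nat \<Rightarrow> real \<Rightarrow> 'w \<Rightarrow> real) \<Rightarrow> nat \<Rightarrow> nat \<Rightarrow> real \<Rightarrow> real \<Rightarrow> 'w \<Rightarrow> real"
  where "deta M F S B j1 j2 s t \<omega> =
    (if S = {} \<or> (1 \<le> j1 \<and> 1 \<le> j2) \<or> (j1 = 0 \<and> j2 = 0) then
       (1/2) * (dB B j1 s t \<omega> * dB B j2 s t \<omega> - (if j1 = j2 \<and> j1 \<noteq> 0 then t - s else 0))
     else if j1 = 0 then
       ito_integral M F (B j2) s t (\<lambda>v _. integral {s..v} (\<lambda>u. 1)) \<omega>
     else integral {s..t} (\<lambda>v. dB B j1 s v \<omega>))"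

definition scheme_step :: "'w measure \<Rightarrow> (real \<Rightarrow> 'w measure) \<Rightarrow> nat \<Rightarrow> 'n set \<Rightarrow>
    (nat \<Rightarrow> real^'n \<Rightarrow> real^'n) \<Rightarrow> (nat \<Rightarrow> real \<Rightarrow> 'w \<Rightarrow> real) \<Rightarrow> (nat \<Rightarrow> real \<Rightarrow> 'w \<Rightarrow> real) \<Rightarrow>
    real \<Rightarrow> real \<Rightarrow> 'w \<Rightarrow> real^'n \<Rightarrow> real^'n"
  where "scheme_step M F d S \<sigma> B B' s t \<omega> z =
    z + (\<Sum>j=0..d. dB B j s t \<omega> *\<^sub>R \<sigma> j z)
      + (\<Sum>j1=0..d. \<Sum>j2=0..d. deta M F S B j1 j2 s t \<omega> *\<^sub>R Lop d \<sigma> j1 (\<sigma> j2) z)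
      + (1/2) *\<^sub>R (\<Sum>j1=1..d. \<Sum>j2=Suc j1..d. dA B B' j1 j2 s t \<omega> *\<^sub>R bracket d \<sigma> j1 j2 z)"

text \<open>\<open>scheme \<dots> h x k\<close> is the value of the scheme with step-size \<open>h\<close> at time \<open>k h\<close>.\<close>

primrec scheme :: "'w measure \<Rightarrow> (real \<Rightarrow> 'w measure) \<Rightarrow> nat \<Rightarrow> 'n set \<Rightarrow>
    (nat \<Rightarrow> real^'n \<Rightarrow> real^'n) \<Rightarrow> (nat \<Rightarrow> real \<Rightarrow> 'w \<Rightarrow> real) \<Rightarrow> (nat \<Rightarrow> real \<Rightarrow> 'w \<Rightarrow> real) \<Rightarrow>
    real \<Rightarrow> real^'n \<Rightarrow> nat \<Rightarrow> 'w \<Rightarrow> real^'n"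
  where
    "scheme M F d S \<sigma> B B' h x 0 \<omega> = x"
  | "scheme M F d S \<sigma> B B' h x (Suc k) \<omega> =
       scheme_step M F d S \<sigma> B B' (real k * h) (real (Suc k) * h) \<omega>
         (scheme M F d S \<sigma> B B' h x k \<omega>)"

end

theory Submission
  imports Defs
begin

text \<open>
  With step size \<open>h\<close>, the error \<open>e\<^sub>k\<close> at time \<open>k h\<close> satisfies \<open>e\<^sub>k\<^sub>+\<^sub>1 = e\<^sub>k + P\<^sub>k + D\<^sub>k\<close>, where \<open>D\<^sub>k\<close> is a
  martingale difference of size \<open>h + h\<^sup>1\<^sup>/\<^sup>2 |e\<^sub>k|\<close> and \<open>P\<^sub>k\<close> is a remainder of size \<open>h\<^sup>3\<^sup>/\<^sup>2 + h |e\<^sub>k|\<close>.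
  Adding up \<open>T / h\<close> martingale differences costs only the square root of their number, so both sums
  contribute \<open>h\<^sup>1\<^sup>/\<^sup>2\<close> plus a feedback term that Gronwall's inequality absorbs (\<open>error_recursion\<close>).

  The sizes come from two sources. For the solution, freezing the coefficients over a step costs
  \<open>h\<close> in the stochastic integrals and \<open>h\<^sup>3\<^sup>/\<^sup>2\<close> in the drift (\<open>mart_rest_moments\<close>,
  \<open>drift_rest_moments\<close>). For the scheme, the Euler terms match the frozen coefficients up to the
  Lipschitz feedback, and the other terms are bounded functions of the present state times either centred
  products of two Brownian increments, which are martingale differences of size \<open>h\<close>, or factors
  \<open>\<Delta>\<eta>\<close> with a time index, which are remainders of size \<open>h\<^sup>3\<^sup>/\<^sup>2\<close> (\<open>one_step_error\<close>).

  All moments have exponent \<open>2 q\<close> with an integer \<open>q\<close>; real exponents follow by interpolation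
  (\<open>powr_interpolation\<close>). The moments of a discrete martingale are bounded by expanding
  \<open>(S + D)\<^sup>2\<^sup>q\<close> (\<open>moment_bound\<close>), and its maximum by a pathwise form of Doob's inequality (\<open>Doob\<close>).

  An Ito integral is given as a mean square limit along an unspecified sequence of simple integrands.
  The isometry for elementary integrands over different partitions shows that the limit depends on the
  integrand alone, so left-point sums converge to it as well (\<open>ito_integral_Riemann\<close>). These are
  discrete martingales, and their moment bounds pass to the integral by Fatou's lemma. The same argument
  identifies the stochastic integral of time in the scheme, up to null sets, with an
  explicit adapted expression (\<open>ito_integral_time\<close>).
\<close>

section \<open>Random variables with moments of all orders\<close>

text \<open>The class is closed under sums, products and maxima, so that integrability need not be tracked
  exponent by exponent.\<close>

definition all_moments :: "'w measure \<Rightarrow> ('w \<Rightarrow> real) \<Rightarrow> bool"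
  where "all_moments M f \<longleftrightarrow> f \<in> borel_measurable M \<and> (\<forall>r::nat. integrable M (\<lambda>\<omega>. \<bar>f \<omega>\<bar> ^ r))"

lemma all_moments_measurable [measurable_dest]: "all_moments M f \<Longrightarrow> f \<in> borel_measurable M"
  by (simp add: all_moments_def)

lemma power_integrable:
  assumes "all_moments M f"
  shows "integrable M (\<lambda>\<omega>. f \<omega> ^ r)"
proof (rule Bochner_Integration.integrable_bound)
  show "integrable M (\<lambda>\<omega>. \<bar>f \<omega>\<bar> ^ r)"
    using assms by (simp add: all_moments_def)
  show "(\<lambda>\<omega>. f \<omega> ^ r) \<in> borel_measurable M"
    using assms by measurable
  show "AE \<omega> in M. norm (f \<omega> ^ r) \<le> norm (\<bar>f \<omega>\<bar> ^ r)"
    by (simp add: power_abs)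
qed

lemma all_moments_integrable: "all_moments M f \<Longrightarrow> integrable M f"
  using power_integrable[of M f 1] by simp

lemma all_moments_bound:
  assumes "all_moments M g" and "f \<in> borel_measurable M" and "AE \<omega> in M. \<bar>f \<omega>\<bar> \<le> \<bar>g \<omega>\<bar>"
  shows "all_moments M f"
  unfolding all_moments_def
proof (intro conjI allI assms(2))
  fix r
  show "integrable M (\<lambda>\<omega>. \<bar>f \<omega>\<bar> ^ r)"
  proof (rule Bochner_Integration.integrable_bound)
    show "integrable M (\<lambda>\<omega>. \<bar>g \<omega>\<bar> ^ r)"
      using assms by (simp add: all_moments_def)
    show "(\<lambda>\<omega>. \<bar>f \<omega>\<bar> ^ r) \<in> borel_measurable M"
      using assms by simp
    show "AE \<omega> in M. norm (\<bar>f \<omega>\<bar> ^ r) \<le> norm (\<bar>g \<omega>\<bar> ^ r)"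
      using assms(3) by eventually_elim (simp add: power_abs power_mono)
  qed
qed

lemma power_add_le:
  fixes a b :: real
  assumes "a \<ge> 0" "b \<ge> 0"
  shows "(a + b) ^ r \<le> 2 ^ r * (a ^ r + b ^ r)"
proof -
  have "(a + b) ^ r \<le> (2 * max a b) ^ r"
    using assms by (intro power_mono) auto
  also have "\<dots> \<le> 2 ^ r * (a ^ r + b ^ r)"
    using assms by (simp add: power_mult_distrib max_def)
  finally show ?thesis .
qed

lemma all_moments_cong_AE:
  assumes "all_moments M g" and "f \<in> borel_measurable M" and "AE \<omega> in M. f \<omega> = g \<omega>"
  shows "all_moments M f"
  by (rule all_moments_bound[OF assms(1,2)]) (use assms(3) in eventually_elim, simp)

lemma (in finite_measure) all_moments_const: "all_moments M (\<lambda>_. c)"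
  by (simp add: all_moments_def)

lemma all_moments_add:
  assumes "all_moments M f" "all_moments M g"
  shows "all_moments M (\<lambda>\<omega>. f \<omega> + g \<omega>)"
  unfolding all_moments_def
proof (intro conjI allI)
  show "(\<lambda>\<omega>. f \<omega> + g \<omega>) \<in> borel_measurable M"
    using assms by measurable
  fix r
  show "integrable M (\<lambda>\<omega>. \<bar>f \<omega> + g \<omega>\<bar> ^ r)"
  proof (rule Bochner_Integration.integrable_bound)
    show "integrable M (\<lambda>\<omega>. 2 ^ r * (\<bar>f \<omega>\<bar> ^ r + \<bar>g \<omega>\<bar> ^ r))"
      using assms by (simp add: all_moments_def)
    show "(\<lambda>\<omega>. \<bar>f \<omega> + g \<omega>\<bar> ^ r) \<in> borel_measurable M"
      using assms by measurable
    have "\<bar>f \<omega> + g \<omega>\<bar> ^ r \<le> (\<bar>f \<omega>\<bar> + \<bar>g \<omega>\<bar>) ^ r" for \<omega>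
      by (intro power_mono) auto
    then show "AE \<omega> in M. norm (\<bar>f \<omega> + g \<omega>\<bar> ^ r) \<le> norm (2 ^ r * (\<bar>f \<omega>\<bar> ^ r + \<bar>g \<omega>\<bar> ^ r))"
      using order_trans[OF _ power_add_le] by auto
  qed
qed

lemma all_moments_mult:
  assumes "all_moments M f" "all_moments M g"
  shows "all_moments M (\<lambda>\<omega>. f \<omega> * g \<omega>)"
  unfolding all_moments_def
proof (intro conjI allI)
  show "(\<lambda>\<omega>. f \<omega> * g \<omega>) \<in> borel_measurable M"
    using assms by measurable
  fix r
  show "integrable M (\<lambda>\<omega>. \<bar>f \<omega> * g \<omega>\<bar> ^ r)"
  proof (rule Bochner_Integration.integrable_bound)
    show "integrable M (\<lambda>\<omega>. \<bar>f \<omega>\<bar> ^ (r + r) + \<bar>g \<omega>\<bar> ^ (r + r))"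
      using assms by (intro Bochner_Integration.integrable_add) (simp_all add: all_moments_def)
    show "(\<lambda>\<omega>. \<bar>f \<omega> * g \<omega>\<bar> ^ r) \<in> borel_measurable M"
      using assms by measurable
    have "a * b \<le> a * a + b * b" if "a \<ge> 0" "b \<ge> 0" for a b :: real
      using sum_squares_bound[of a b] mult_nonneg_nonneg[OF that] by (simp add: power2_eq_square)
    then show "AE \<omega> in M. norm (\<bar>f \<omega> * g \<omega>\<bar> ^ r) \<le> norm (\<bar>f \<omega>\<bar> ^ (r + r) + \<bar>g \<omega>\<bar> ^ (r + r))"
      by (simp add: abs_mult power_mult_distrib power_add)
  qed
qed

lemma (in finite_measure) all_moments_cmult: "all_moments M f \<Longrightarrow> all_moments M (\<lambda>\<omega>. c * f \<omega>)"
  by (rule all_moments_mult[OF all_moments_const])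

lemma all_moments_uminus: "all_moments M f \<Longrightarrow> all_moments M (\<lambda>\<omega>. - f \<omega>)"
  by (simp add: all_moments_def)

lemma all_moments_abs: "all_moments M f \<Longrightarrow> all_moments M (\<lambda>\<omega>. \<bar>f \<omega>\<bar>)"
  by (rule all_moments_bound[of M f], assumption, measurable) auto

lemma all_moments_diff: "all_moments M f \<Longrightarrow> all_moments M g \<Longrightarrow> all_moments M (\<lambda>\<omega>. f \<omega> - g \<omega>)"
  using all_moments_add[OF _ all_moments_uminus, of M f g] by simp

lemma (in finite_measure) all_moments_sum:
  "(\<And>i. i \<in> I \<Longrightarrow> all_moments M (f i)) \<Longrightarrow> all_moments M (\<lambda>\<omega>. \<Sum>i\<in>I. f i \<omega>)"
  by (induction I rule: infinite_finite_induct) (auto simp: all_moments_const intro: all_moments_add)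

lemma (in finite_measure) all_moments_power: "all_moments M f \<Longrightarrow> all_moments M (\<lambda>\<omega>. f \<omega> ^ r)"
  by (induction r) (auto simp: all_moments_const intro: all_moments_mult)

lemma all_moments_max:
  assumes "all_moments M f" "all_moments M g"
  shows "all_moments M (\<lambda>\<omega>. max (f \<omega>) (g \<omega>))"
proof (rule all_moments_bound)
  show "all_moments M (\<lambda>\<omega>. \<bar>f \<omega>\<bar> + \<bar>g \<omega>\<bar>)"
    using assms by (intro all_moments_add all_moments_abs)
qed (use assms in \<open>auto simp: all_moments_def\<close>)

section \<open>Moments of discrete martingales\<close>

text \<open>Jensen's inequality for the convex power, applied to the average of the terms.\<close>

lemma abs_sum_power_le:
  fixes x :: "'i \<Rightarrow> real"
  assumes "finite I" and "m > 0"
  shows "\<bar>\<Sum>i\<in>I. x i\<bar> ^ m \<le> real (card I) ^ (m - 1) * (\<Sum>i\<in>I. \<bar>x i\<bar> ^ m)"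
proof (cases "I = {}")
  case True
  then show ?thesis using assms by (simp add: power_0_left)
next
  case False
  define n where "n = real (card I)"
  have n: "n > 0" using False assms by (simp add: n_def card_gt_0_iff)
  have conv: "convex_on {0::real..} (\<lambda>x. x ^ m)"
    using convex_power_odd[of m] convex_on_subset[OF convex_power_even[of m]] by (cases "even m") auto
  have "\<bar>\<Sum>i\<in>I. x i\<bar> \<le> (\<Sum>i\<in>I. \<bar>x i\<bar>)" by (rule sum_abs)
  also have "\<dots> = n * (\<Sum>i\<in>I. (1 / n) *\<^sub>R \<bar>x i\<bar>)"
    using n by (simp add: sum_divide_distrib[symmetric])
  finally have "\<bar>\<Sum>i\<in>I. x i\<bar> ^ m \<le> n ^ m * (\<Sum>i\<in>I. (1 / n) *\<^sub>R \<bar>x i\<bar>) ^ m"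
    by (metis power_mono abs_ge_zero power_mult_distrib)
  also have "\<dots> \<le> n ^ m * (\<Sum>i\<in>I. (1 / n) * \<bar>x i\<bar> ^ m)"
  proof (intro mult_left_mono)
    show "(\<Sum>i\<in>I. (1 / n) *\<^sub>R \<bar>x i\<bar>) ^ m \<le> (\<Sum>i\<in>I. (1 / n) * \<bar>x i\<bar> ^ m)"
      by (rule convex_on_sum[OF assms(1) False conv]) (use n in \<open>auto simp: n_def\<close>)
  qed (use n in auto)
  also have "\<dots> = n ^ (m - 1) * (\<Sum>i\<in>I. \<bar>x i\<bar> ^ m)"
    using n assms(2) by (cases m) (auto simp: sum_divide_distrib[symmetric])
  finally show ?thesis by (simp add: n_def)
qed

lemma even_power_abs: "\<bar>y::real\<bar> ^ (2 * q) = y ^ (2 * q)"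
  by (rule power_even_abs) simp

lemma even_power_mono: "\<bar>a\<bar> \<le> b \<Longrightarrow> a ^ (2 * q) \<le> (b::real) ^ (2 * q)"
  using power_mono[of "\<bar>a\<bar>" b "2 * q"] by (simp only: even_power_abs abs_ge_zero)

abbreviation (in prob_space) even_moment :: "nat \<Rightarrow> ('a \<Rightarrow> real) \<Rightarrow> real"
  where "even_moment q f \<equiv> expectation (\<lambda>\<omega>. f \<omega> ^ (2 * q))"

lemma (in prob_space) even_moment_mono:
  assumes "all_moments M f" "all_moments M g" "\<And>\<omega>. \<omega> \<in> space M \<Longrightarrow> \<bar>f \<omega>\<bar> \<le> g \<omega>"
  shows "even_moment q f \<le> even_moment q g"
  using assms by (intro integral_mono power_integrable even_power_mono) auto

lemma (in prob_space) sum_even_moment_le: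
  assumes A: "finite A" and f: "\<And>a. a \<in> A \<Longrightarrow> all_moments M (f a)" and q: "q \<ge> 1"
    and b: "\<And>a. a \<in> A \<Longrightarrow> even_moment q (f a) \<le> b"
  shows "even_moment q (\<lambda>\<omega>. \<Sum>a\<in>A. f a \<omega>) \<le> real (card A) ^ (2 * q) * b"
proof -
  have int: "integrable M (\<lambda>\<omega>. f a \<omega> ^ (2 * q))" if "a \<in> A" for a using f[OF that] by (rule power_integrable)
  have "even_moment q (\<lambda>\<omega>. \<Sum>a\<in>A. f a \<omega>) \<le> expectation (\<lambda>\<omega>. real (card A) ^ (2 * q - 1) * (\<Sum>a\<in>A. f a \<omega> ^ (2 * q)))"
  proof (rule integral_mono)
    show "integrable M (\<lambda>\<omega>. (\<Sum>a\<in>A. f a \<omega>) ^ (2 * q))" by (intro power_integrable all_moments_sum f)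
    show "integrable M (\<lambda>\<omega>. real (card A) ^ (2 * q - 1) * (\<Sum>a\<in>A. f a \<omega> ^ (2 * q)))"
      by (intro integrable_mult_right Bochner_Integration.integrable_sum int)
    show "(\<Sum>a\<in>A. f a \<omega>) ^ (2 * q) \<le> real (card A) ^ (2 * q - 1) * (\<Sum>a\<in>A. f a \<omega> ^ (2 * q))" for \<omega>
      using abs_sum_power_le[OF A, of "2 * q" "\<lambda>a. f a \<omega>"] q by (simp add: even_power_abs)
  qed
  also have "\<dots> = real (card A) ^ (2 * q - 1) * (\<Sum>a\<in>A. even_moment q (f a))"
    using int by (simp add: Bochner_Integration.integral_sum)
  also have "\<dots> \<le> real (card A) ^ (2 * q - 1) * (\<Sum>a\<in>A. b)" by (intro mult_left_mono sum_mono b) auto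
  also have "\<dots> = (real (card A) ^ (2 * q - 1) * real (card A)) * b" by simp
  also have "real (card A) ^ (2 * q - 1) * real (card A) = real (card A) ^ (2 * q)"
    using q by (simp flip: power_Suc2)
  finally show ?thesis .
qed

lemma even_power_sum_le: "(a + b :: real) ^ (2 * q) \<le> 4 ^ q * (a ^ (2 * q) + b ^ (2 * q))"
proof -
  have "(a + b) ^ (2 * q) = \<bar>a + b\<bar> ^ (2 * q)" by (simp only: even_power_abs)
  also have "\<dots> \<le> (\<bar>a\<bar> + \<bar>b\<bar>) ^ (2 * q)" by (intro power_mono) auto
  also have "\<dots> \<le> 2 ^ (2 * q) * (\<bar>a\<bar> ^ (2 * q) + \<bar>b\<bar> ^ (2 * q))" by (intro power_add_le) auto
  finally show ?thesis unfolding even_power_abs by (simp add: power_mult)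
qed

text \<open>From the quadratic term on, the binomial expansion is dominated by \<open>a\<^sup>2\<^sup>q\<^sup>-\<^sup>2 b\<^sup>2 + b\<^sup>2\<^sup>q\<close>. Young's inequality
  with weight \<open>1 / N\<close> then leaves the factor \<open>4\<^sup>q / N\<close> in front of \<open>a\<^sup>2\<^sup>q\<close>, which accumulates to a
  constant over \<open>N\<close> steps.\<close>

lemma even_power_add_le:
  fixes a b N :: real
  assumes "q \<ge> 1" "N \<ge> 1"
  shows "(a + b) ^ (2 * q) \<le> a ^ (2 * q) + real (2 * q) * a ^ (2 * q - 1) * b
           + 4 ^ q * (a ^ (2 * q) / N + 2 * N ^ (q - 1) * b ^ (2 * q))"
proof -
  define m where "m = 2 * q"
  have m: "m \<ge> 2" "even m" using assms by (auto simp: m_def)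
  define R where "R = a ^ m / N + 2 * N ^ (q - 1) * b ^ m"
  have N1: "N ^ (q - 1) \<ge> 1" using assms by simp
  have sq: "a ^ (m - 2) * b ^ 2 \<le> a ^ m / N + N ^ (q - 1) * b ^ m"
  proof -
    define x y where "x = a\<^sup>2" and "y = N * b\<^sup>2"
    have xy: "x \<ge> 0" "y \<ge> 0" using assms by (auto simp: x_def y_def)
    have "x ^ (q - 1) * y \<le> x ^ q + y ^ q"
    proof (cases "x \<le> y")
      case True
      then have "x ^ (q - 1) * y \<le> y ^ (q - 1) * y" using xy by (intro mult_right_mono power_mono)
      also have "\<dots> = y ^ q" using assms by (cases q) auto
      finally show ?thesis using xy by (smt (verit) zero_le_power)
    next
      case False
      then have "x ^ (q - 1) * y \<le> x ^ (q - 1) * x" using xy by (intro mult_left_mono) auto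
      also have "\<dots> = x ^ q" using assms by (cases q) auto
      finally show ?thesis using xy by (smt (verit) zero_le_power)
    qed
    then have "x ^ (q - 1) * y / N \<le> (x ^ q + y ^ q) / N"
      using assms by (intro divide_right_mono) auto
    moreover have "x ^ (q - 1) * y / N = a ^ (m - 2) * b ^ 2"
      using assms by (simp add: x_def y_def m_def power_mult[symmetric] right_diff_distrib')
    moreover have "x ^ q = a ^ m" by (simp add: x_def m_def power_mult)
    moreover have "y ^ q / N = N ^ (q - 1) * b ^ m"
    proof -
      have "y ^ q = N ^ q * b ^ m" by (simp add: y_def m_def power_mult power_mult_distrib)
      moreover have "N ^ q = N * N ^ (q - 1)" using assms by (cases q) auto
      ultimately show ?thesis using assms by simp
    qed
    ultimately show ?thesis by (simp add: add_divide_distrib)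
  qed
  have bm: "b ^ m \<le> N ^ (q - 1) * b ^ m"
    using mult_right_mono[OF N1, of "b ^ m"] zero_le_even_power[OF m(2), of b] by simp
  have am: "0 \<le> a ^ m / N" using zero_le_even_power[OF m(2), of a] assms by simp
  have term_le: "b ^ j * a ^ (m - j) \<le> R" if "2 \<le> j" "j \<le> m" for j
  proof (cases "\<bar>a\<bar> \<le> \<bar>b\<bar>")
    case True
    have "b ^ j * a ^ (m - j) \<le> \<bar>b ^ j * a ^ (m - j)\<bar>" by (rule abs_ge_self)
    also have "\<dots> = \<bar>b\<bar> ^ j * \<bar>a\<bar> ^ (m - j)" by (simp add: abs_mult power_abs)
    also have "\<dots> \<le> \<bar>b\<bar> ^ j * \<bar>b\<bar> ^ (m - j)" using True by (intro mult_left_mono power_mono) auto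
    also have "\<dots> = b ^ m" using that m by (simp add: power_add[symmetric] power_even_abs)
    also have "\<dots> \<le> R" using bm am zero_le_even_power[OF m(2), of b] unfolding R_def mult.assoc by linarith
    finally show ?thesis .
  next
    case False
    have "b ^ j * a ^ (m - j) \<le> \<bar>b ^ j * a ^ (m - j)\<bar>" by (rule abs_ge_self)
    also have "\<dots> = \<bar>b\<bar> ^ 2 * \<bar>b\<bar> ^ (j - 2) * \<bar>a\<bar> ^ (m - j)"
    proof -
      have "\<bar>b\<bar> ^ j = \<bar>b\<bar> ^ 2 * \<bar>b\<bar> ^ (j - 2)" using that power_add[of "\<bar>b\<bar>" 2 "j - 2"] by (simp only:
          le_add_diff_inverse)
      then show ?thesis by (simp only: abs_mult power_abs)
    qed
    also have "\<dots> \<le> \<bar>b\<bar> ^ 2 * \<bar>a\<bar> ^ (j - 2) * \<bar>a\<bar> ^ (m - j)"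
      using False by (intro mult_left_mono mult_right_mono power_mono) auto
    also have "\<dots> = a ^ (m - 2) * b\<^sup>2"
      using that m by (simp add: power_add[symmetric] power_even_abs mult.assoc)
    also have "\<dots> \<le> R" using sq bm zero_le_even_power[OF m(2), of b] unfolding R_def mult.assoc by linarith
    finally show ?thesis .
  qed
  have R0: "R \<ge> 0" using am m assms by (auto simp: R_def)
  have split: "{..m} = insert 0 (insert 1 {2..m})" using m by auto
  have "(a + b) ^ m = (\<Sum>j\<le>m. real (m choose j) * b ^ j * a ^ (m - j))"
    by (subst add.commute, subst binomial_ring) simp
  also have "\<dots> = a ^ m + real m * b * a ^ (m - 1) + (\<Sum>j\<in>{2..m}. real (m choose j) * (b ^ j * a ^ (m - j)))"
    unfolding split by (subst sum.insert, simp, simp, subst sum.insert) (auto simp: mult.assoc)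
  also have "(\<Sum>j\<in>{2..m}. real (m choose j) * (b ^ j * a ^ (m - j))) \<le> (\<Sum>j\<in>{2..m}. real (m choose j) * R)"
    by (intro sum_mono mult_left_mono term_le) auto
  also have "\<dots> = real (\<Sum>j\<in>{2..m}. m choose j) * R" by (simp add: sum_distrib_right)
  also have "\<dots> \<le> real (\<Sum>j\<le>m. m choose j) * R"
    using R0 by (intro mult_right_mono of_nat_mono sum_mono2) auto
  also have "\<dots> = 4 ^ q * R" by (simp add: choose_row_sum m_def power_mult)
  finally show ?thesis by (simp add: m_def R_def mult_ac)
qed

lemma growth_bound:
  fixes u v :: "nat \<Rightarrow> real"
  assumes "u 0 = 0" and "\<alpha> \<ge> 1" and "\<And>i. v i \<ge> 0"
    and step: "\<And>k. k < n \<Longrightarrow> u (Suc k) \<le> \<alpha> * u k + v k"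
  shows "k \<le> n \<Longrightarrow> u k \<le> \<alpha> ^ k * (\<Sum>i<k. v i)"
proof (induction k)
  case 0
  then show ?case using assms by simp
next
  case (Suc k)
  have "u (Suc k) \<le> \<alpha> * u k + v k" using Suc step by simp
  also have "\<dots> \<le> \<alpha> * (\<alpha> ^ k * (\<Sum>i<k. v i)) + \<alpha> ^ Suc k * v k"
  proof (intro add_mono mult_left_mono Suc)
    have "1 * v k \<le> \<alpha> ^ Suc k * v k"
      using assms one_le_power[of \<alpha> "Suc k"] by (intro mult_right_mono) auto
    then show "v k \<le> \<alpha> ^ Suc k * v k" by simp
  qed (use Suc assms in auto)
  finally show ?case by (simp add: algebra_simps)
qed

text \<open>The martingale property takes the form of orthogonality to the square integrable functions of the
  past: this form survives mean square limits, and it is what the moment estimates consume.\<close>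

locale martingale_differences = prob_space M for M :: "'w measure" +
  fixes G :: "nat \<Rightarrow> 'w measure" and D :: "nat \<Rightarrow> 'w \<Rightarrow> real" and n :: nat
  assumes subalgebra_G: "i \<le> n \<Longrightarrow> subalgebra M (G i)"
    and mono_G: "i \<le> j \<Longrightarrow> j \<le> n \<Longrightarrow> sets (G i) \<subseteq> sets (G j)"
    and adapted_D: "i < n \<Longrightarrow> D i \<in> borel_measurable (G (Suc i))"
    and moments_D: "i < n \<Longrightarrow> all_moments M (D i)"
    and orthogonal_D: "i < n \<Longrightarrow> Y \<in> borel_measurable (G i) \<Longrightarrow> integrable M (\<lambda>\<omega>. (Y \<omega>)\<^sup>2) \<Longrightarrow>
       expectation (\<lambda>\<omega>. Y \<omega> * D i \<omega>) = 0"
begin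

definition S :: "nat \<Rightarrow> 'w \<Rightarrow> real" where "S k \<omega> = (\<Sum>i<k. D i \<omega>)"

lemma measurable_G_mono:
  assumes "Y \<in> borel_measurable (G i)" "i \<le> j" "j \<le> n"
  shows "Y \<in> borel_measurable (G j)"
proof (rule measurable_from_subalg[OF _ assms(1)])
  show "subalgebra (G j) (G i)"
    using subalgebra_G[of i] subalgebra_G[of j] mono_G[of i j] assms by (auto simp: subalgebra_def)
qed

lemma S_adapted: "k \<le> n \<Longrightarrow> S k \<in> borel_measurable (G k)"
  unfolding S_def
  by (intro borel_measurable_sum) (metis adapted_D lessThan_iff measurable_G_mono Suc_leI order_less_le_trans)

lemma S_moments: "k \<le> n \<Longrightarrow> all_moments M (S k)"
  unfolding S_def[abs_def] by (intro all_moments_sum moments_D) auto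

text \<open>The term linear in the new difference has mean zero; \<open>even_power_add_le\<close> with \<open>N = n\<close> controls
  the others.\<close>

lemma moment_step:
  assumes "k < n" "q \<ge> 1"
  shows "even_moment q (S (Suc k)) \<le>
    (1 + 4 ^ q / n) * even_moment q (S k) + 2 * 4 ^ q * real n ^ (q - 1) * even_moment q (D k)"
proof -
  note [measurable] = all_moments_measurable[OF S_moments[of k]]
  have n: "real n \<ge> 1" using assms by simp
  have mS: "all_moments M (S k)" and mS': "all_moments M (S (Suc k))" and mD: "all_moments M (D k)"
    using assms by (auto intro: S_moments moments_D)
  have int: "integrable M (\<lambda>\<omega>. S k \<omega> ^ (2 * q))" "integrable M (\<lambda>\<omega>. D k \<omega> ^ (2 * q))"
     "integrable M (\<lambda>\<omega>. S (Suc k) \<omega> ^ (2 * q))"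
    using mS mD mS' by (auto intro: power_integrable)
  have int2: "integrable M (\<lambda>\<omega>. real (2 * q) * (S k \<omega> ^ (2 * q - 1) * D k \<omega>))"
    using mS mD by (intro integrable_mult_right all_moments_integrable all_moments_mult all_moments_power)
  have "even_moment q (S (Suc k)) \<le>
     expectation (\<lambda>\<omega>. S k \<omega> ^ (2 * q) + real (2 * q) * (S k \<omega> ^ (2 * q - 1) * D k \<omega>)
           + 4 ^ q * (S k \<omega> ^ (2 * q) / n + 2 * real n ^ (q - 1) * D k \<omega> ^ (2 * q)))"
  proof (rule integral_mono[OF int(3)])
    show "integrable M (\<lambda>\<omega>. S k \<omega> ^ (2 * q) + real (2 * q) * (S k \<omega> ^ (2 * q - 1) * D k \<omega>)
           + 4 ^ q * (S k \<omega> ^ (2 * q) / n + 2 * real n ^ (q - 1) * D k \<omega> ^ (2 * q)))"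
      using int int2 by auto
    fix \<omega>
    show "S (Suc k) \<omega> ^ (2 * q) \<le> S k \<omega> ^ (2 * q) + real (2 * q) * (S k \<omega> ^ (2 * q - 1) * D k \<omega>)
           + 4 ^ q * (S k \<omega> ^ (2 * q) / n + 2 * real n ^ (q - 1) * D k \<omega> ^ (2 * q))"
      using even_power_add_le[OF assms(2) n, of "S k \<omega>" "D k \<omega>"] by (simp add: S_def mult_ac)
  qed
  also have "\<dots> = even_moment q (S k) + real (2 * q) * expectation (\<lambda>\<omega>. S k \<omega> ^ (2 * q - 1) * D k \<omega>)
      + 4 ^ q * (even_moment q (S k) / n + 2 * real n ^ (q - 1) * even_moment q (D k))"
    using int int2 by simp
  also have "expectation (\<lambda>\<omega>. S k \<omega> ^ (2 * q - 1) * D k \<omega>) = 0"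
  proof (rule orthogonal_D[OF assms(1)])
    show "(\<lambda>\<omega>. S k \<omega> ^ (2 * q - 1)) \<in> borel_measurable (G k)"
      using S_adapted[of k] assms by simp
    show "integrable M (\<lambda>\<omega>. (S k \<omega> ^ (2 * q - 1))\<^sup>2)"
      by (intro power_integrable all_moments_power mS)
  qed
  finally show ?thesis by (simp add: algebra_simps)
qed

text \<open>The growth factors multiply to at most \<open>exp (4\<^sup>q)\<close>. If each of the \<open>n\<close> differences has size
  \<open>(t / n)\<^sup>1\<^sup>/\<^sup>2\<close>, the bound has the Brownian order \<open>t\<^sup>q\<close>.\<close>

lemma moment_bound:
  assumes "k \<le> n" "q \<ge> 1"
  shows "even_moment q (S k) \<le>
    exp (4 ^ q) * 2 * 4 ^ q * real n ^ (q - 1) * (\<Sum>i<k. even_moment q (D i))"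
proof (cases "n = 0")
  case True
  then show ?thesis using assms by (simp add: S_def power_0_left)
next
  case False
  define v where "v i = 2 * 4 ^ q * real n ^ (q - 1) * even_moment q (D i)" for i
  have v0: "v i \<ge> 0" for i unfolding v_def by (intro mult_nonneg_nonneg integral_nonneg) auto
  have "even_moment q (S k) \<le> (1 + 4 ^ q / n) ^ k * (\<Sum>i<k. v i)"
    using growth_bound[of "\<lambda>k. even_moment q (S k)" "1 + 4 ^ q / n" v n k] moment_step
      assms v0 by (simp add: S_def[of 0] v_def)
  also have "\<dots> \<le> exp (4 ^ q) * (\<Sum>i<k. v i)"
  proof (intro mult_right_mono sum_nonneg v0)
    have "(1 + 4 ^ q / real n) ^ k \<le> (1 + 4 ^ q / real n) ^ n"
      using assms by (intro power_increasing) auto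
    also have "\<dots> \<le> exp (4 ^ q / real n) ^ n"
      by (intro power_mono exp_ge_add_one_self) auto
    also have "\<dots> = exp (4 ^ q)" using False by (simp flip: exp_of_nat_mult)
    finally show "(1 + 4 ^ q / real n) ^ k \<le> exp (4 ^ q)" .
  qed
  finally show ?thesis by (simp add: v_def sum_distrib_left mult_ac)
qed

definition Smax :: "nat \<Rightarrow> nat \<Rightarrow> 'w \<Rightarrow> real"
  where "Smax q k \<omega> = Max ((\<lambda>i. S i \<omega> ^ q) ` {..k})"

lemma Smax_Suc: "Smax q (Suc k) \<omega> = max (S (Suc k) \<omega> ^ q) (Smax q k \<omega>)"
  by (simp add: Smax_def atMost_Suc)

lemma Smax_ge: "i \<le> k \<Longrightarrow> S i \<omega> ^ q \<le> Smax q k \<omega>"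
  by (simp add: Smax_def)

lemma Smax_adapted: "k \<le> n \<Longrightarrow> Smax q k \<in> borel_measurable (G k)"
proof (induction k)
  case (Suc k)
  then have "Smax q k \<in> borel_measurable (G (Suc k))" "S (Suc k) \<in> borel_measurable (G (Suc k))"
    using measurable_G_mono[of _ k "Suc k"] S_adapted[of "Suc k"] by auto
  then show ?case unfolding Smax_Suc[abs_def] by (intro borel_measurable_max borel_measurable_power)
qed (simp add: Smax_def[abs_def] S_adapted borel_measurable_power)

lemma Smax_moments: "k \<le> n \<Longrightarrow> all_moments M (Smax q k)"
proof (induction k)
  case (Suc k)
  then show ?case unfolding Smax_Suc[abs_def] by (intro all_moments_max all_moments_power S_moments) auto
qed (simp add: Smax_def[abs_def] all_moments_power S_moments)

text \<open>A pathwise version of Doob's maximal inequality: summation by parts, together with the fact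
  that the running maximum only moves when the process itself is at its maximum.\<close>

lemma pathwise_Doob:
  assumes "q \<ge> 1"
  shows "(\<Sum>i<k. Smax q i \<omega> * (S (Suc i) \<omega> ^ q - S i \<omega> ^ q)) \<le> Smax q k \<omega> * S k \<omega> ^ q - (Smax q k \<omega>)\<^sup>2 / 2"
proof (induction k)
  case 0
  then show ?case using assms by (simp add: Smax_def S_def power_0_left)
next
  case (Suc k)
  define x y where "x = Smax q k \<omega>" and "y = S (Suc k) \<omega> ^ q"
  have "x * y - x\<^sup>2 / 2 \<le> max y x * y - (max y x)\<^sup>2 / 2"
    using sum_squares_bound[of x y] by (auto simp: max_def power2_eq_square)
  then show ?case using Suc by (simp add: Smax_Suc x_def y_def algebra_simps)
qed

text \<open>The graph of a convex power lies above its tangent; for \<open>a \<noteq> 0\<close> this is Bernoulli's inequality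
  for \<open>b / a\<close>.\<close>

lemma convex_increment:
  fixes a b :: real
  assumes "even q"
  shows "a ^ q + real q * a ^ (q - 1) * b \<le> (a + b) ^ q"
proof (cases "a = 0")
  case True
  then show ?thesis using assms by (cases "q = 0"; cases "q = 1") (auto simp: power_0_left)
next
  case False
  have "a ^ q * (1 + real q * (b / a)) \<le> a ^ q * (1 + b / a) ^ q"
    using assms by (intro mult_left_mono Bernoulli_inequality_even) auto
  also have "\<dots> = (a + b) ^ q" using False by (simp flip: power_mult_distrib add: field_simps)
  finally have "a ^ q * (1 + real q * (b / a)) \<le> (a + b) ^ q" .
  moreover have "a ^ q * (real q * (b / a)) = real q * a ^ (q - 1) * b"
    using False by (cases q) auto
  ultimately show ?thesis by (simp add: distrib_left)
qed

text \<open>In expectation the sum in \<open>pathwise_Doob\<close> is nonnegative, because the increments of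
  \<open>S\<^sup>q\<close> dominate their tangents, which are orthogonal to the past.\<close>

lemma Doob:
  assumes "even q" "q \<ge> 1"
  shows "expectation (\<lambda>\<omega>. (Smax q n \<omega>)\<^sup>2) \<le> 4 * even_moment q (S n)"
proof -
  define \<Phi> where "\<Phi> \<omega> = (\<Sum>i<n. Smax q i \<omega> * (S (Suc i) \<omega> ^ q - S i \<omega> ^ q))" for \<omega>
  have m: "all_moments M (S n)" "all_moments M (Smax q n)"
    by (auto intro: S_moments Smax_moments)
  have m\<Phi>: "all_moments M \<Phi>" unfolding \<Phi>_def[abs_def]
    by (intro all_moments_sum all_moments_mult all_moments_diff all_moments_power S_moments Smax_moments) auto
  have "expectation (\<lambda>\<omega>. (Smax q n \<omega>)\<^sup>2) \<le> expectation (\<lambda>\<omega>. 4 * S n \<omega> ^ (2 * q) - 4 * \<Phi> \<omega>)"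
  proof (rule integral_mono)
    fix \<omega>
    define x y where "x = Smax q n \<omega>" and "y = S n \<omega> ^ q"
    have "\<Phi> \<omega> \<le> x * y - x\<^sup>2 / 2"
      using pathwise_Doob[OF assms(2), where k = n and \<omega> = \<omega>] by (simp add: \<Phi>_def x_def y_def)
    moreover have "4 * (x * y) \<le> x\<^sup>2 + 4 * y\<^sup>2"
      using sum_squares_bound[of x "2 * y"] by (simp add: power2_eq_square)
    moreover have "y\<^sup>2 = S n \<omega> ^ (2 * q)" by (simp add: y_def power_mult[symmetric] mult.commute)
    ultimately show "(Smax q n \<omega>)\<^sup>2 \<le> 4 * S n \<omega> ^ (2 * q) - 4 * \<Phi> \<omega>" by (simp add: x_def)
  qed (use m m\<Phi> in \<open>auto intro!: Bochner_Integration.integrable_diff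
      Bochner_Integration.integrable_mult_right intro: power_integrable all_moments_integrable\<close>)
  also have "\<dots> = 4 * even_moment q (S n) - 4 * expectation \<Phi>"
    using m m\<Phi> by (simp add: power_integrable all_moments_integrable)
  finally have le: "expectation (\<lambda>\<omega>. (Smax q n \<omega>)\<^sup>2) \<le>
    4 * even_moment q (S n) - 4 * expectation \<Phi>" .
  have "0 \<le> expectation \<Phi>"
  proof -
    have "0 = (\<Sum>i<n. real q * expectation (\<lambda>\<omega>. (Smax q i \<omega> * S i \<omega> ^ (q - 1)) * D i \<omega>))"
    proof (rule sum.neutral[symmetric], safe)
      fix i assume "i < n"
      then have "expectation (\<lambda>\<omega>. (Smax q i \<omega> * S i \<omega> ^ (q - 1)) * D i \<omega>) = 0"
        by (intro orthogonal_D power_integrable all_moments_mult all_moments_power S_moments Smax_moments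
             borel_measurable_times borel_measurable_power Smax_adapted S_adapted) auto
      then show "real q * expectation (\<lambda>\<omega>. (Smax q i \<omega> * S i \<omega> ^ (q - 1)) * D i \<omega>) = 0" by simp
    qed
    also have "\<dots> = expectation (\<lambda>\<omega>. \<Sum>i<n. real q * (Smax q i \<omega> * S i \<omega> ^ (q - 1) * D i \<omega>))"
      by (subst Bochner_Integration.integral_sum)
        (auto intro!: integrable_mult_right all_moments_integrable all_moments_mult all_moments_power
           S_moments Smax_moments moments_D)
    also have "\<dots> \<le> expectation \<Phi>"
    proof (rule integral_mono)
      show "integrable M (\<lambda>\<omega>. \<Sum>i<n. real q * (Smax q i \<omega> * S i \<omega> ^ (q - 1) * D i \<omega>))"
        by (rule all_moments_integrable, intro all_moments_sum all_moments_mult all_moments_const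
             all_moments_power S_moments Smax_moments moments_D) auto
      fix \<omega>
      show "(\<Sum>i<n. real q * (Smax q i \<omega> * S i \<omega> ^ (q - 1) * D i \<omega>)) \<le> \<Phi> \<omega>"
        unfolding \<Phi>_def
      proof (rule sum_mono)
        fix i
        have "0 \<le> Smax q i \<omega>"
          using Smax_ge[of 0 i \<omega> q] assms by (simp add: S_def power_0_left)
        then have "Smax q i \<omega> * (real q * S i \<omega> ^ (q - 1) * D i \<omega>) \<le> Smax q i \<omega> * (S (Suc i) \<omega> ^ q - S i \<omega> ^ q)"
          using convex_increment[OF assms(1), of "S i \<omega>" "D i \<omega>"] by (intro mult_left_mono) (auto simp: S_def)
        then show "real q * (Smax q i \<omega> * S i \<omega> ^ (q - 1) * D i \<omega>) \<le> Smax q i \<omega> * (S (Suc i) \<omega> ^ q - S i \<omega> ^ q)"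
          by (simp add: mult_ac)
      qed
    qed (use m\<Phi> in \<open>auto intro: all_moments_integrable\<close>)
    finally show ?thesis .
  qed
  then show ?thesis using le by simp
qed

end

section \<open>Mean square limits\<close>

text \<open>The distance is a nonnegative integral, so that convergence makes sense before the limit is known
  to be square integrable.\<close>

definition L2_tendsto :: "'w measure \<Rightarrow> (nat \<Rightarrow> 'w \<Rightarrow> real) \<Rightarrow> ('w \<Rightarrow> real) \<Rightarrow> bool"
  where "L2_tendsto M f g \<longleftrightarrow> (\<forall>n. f n \<in> borel_measurable M) \<and> g \<in> borel_measurable M \<and>
    (\<lambda>n. \<integral>\<^sup>+ \<omega>. ennreal ((f n \<omega> - g \<omega>)\<^sup>2) \<partial>M) \<longlonglongrightarrow> 0"

lemma square_add_le: "(a + b)\<^sup>2 \<le> 2 * a\<^sup>2 + 2 * (b::real)\<^sup>2"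
  using sum_squares_bound[of a b] by (simp add: power2_sum)

lemma ennreal_square_add_le: "ennreal ((a + b)\<^sup>2) \<le> 2 * ennreal (a\<^sup>2) + 2 * ennreal (b\<^sup>2)"
proof -
  have "ennreal ((a + b)\<^sup>2) \<le> ennreal (2 * a\<^sup>2 + 2 * b\<^sup>2)"
    by (intro ennreal_leI square_add_le)
  then show ?thesis by (simp add: ennreal_plus ennreal_mult)
qed

lemma nn_integral_square_add_le:
  assumes [measurable]: "f \<in> borel_measurable M" "g \<in> borel_measurable M"
  shows "(\<integral>\<^sup>+ \<omega>. ennreal ((f \<omega> + g \<omega>)\<^sup>2) \<partial>M) \<le> 2 * (\<integral>\<^sup>+ \<omega>. ennreal ((f \<omega>)\<^sup>2) \<partial>M) + 2 * (\<integral>\<^sup>+ \<omega>. ennreal ((g \<omega>)\<^sup>2) \<partial>M)"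
proof -
  have "(\<integral>\<^sup>+ \<omega>. ennreal ((f \<omega> + g \<omega>)\<^sup>2) \<partial>M) \<le> (\<integral>\<^sup>+ \<omega>. 2 * ennreal ((f \<omega>)\<^sup>2) + 2 * ennreal ((g \<omega>)\<^sup>2) \<partial>M)"
    by (intro nn_integral_mono ennreal_square_add_le)
  also have "\<dots> = 2 * (\<integral>\<^sup>+ \<omega>. ennreal ((f \<omega>)\<^sup>2) \<partial>M) + 2 * (\<integral>\<^sup>+ \<omega>. ennreal ((g \<omega>)\<^sup>2) \<partial>M)"
    by (simp add: nn_integral_add nn_integral_cmult)
  finally show ?thesis .
qed

lemma tendsto_0_two_sum:
  fixes u v :: "nat \<Rightarrow> ennreal"
  assumes "u \<longlonglongrightarrow> 0" "v \<longlonglongrightarrow> 0"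
  shows "(\<lambda>n. 2 * u n + 2 * v n) \<longlonglongrightarrow> 0"
proof -
  have "(\<lambda>n. 2 * u n + 2 * v n) \<longlonglongrightarrow> 2 * 0 + 2 * 0"
    by (intro tendsto_add ennreal_tendsto_cmult assms) auto
  then show ?thesis by simp
qed

lemma tendsto_0_le:
  fixes u v :: "nat \<Rightarrow> ennreal"
  assumes "v \<longlonglongrightarrow> 0" "\<And>n. u n \<le> v n"
  shows "u \<longlonglongrightarrow> 0"
  by (rule tendsto_sandwich[OF _ _ tendsto_const assms(1)]) (use assms in auto)

lemma L2_tendsto_add:
  assumes "L2_tendsto M f g" "L2_tendsto M f' g'"
  shows "L2_tendsto M (\<lambda>n \<omega>. f n \<omega> + f' n \<omega>) (\<lambda>\<omega>. g \<omega> + g' \<omega>)"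
proof -
  have [measurable]: "f n \<in> borel_measurable M" "g \<in> borel_measurable M"
    "f' n \<in> borel_measurable M" "g' \<in> borel_measurable M" for n
    using assms by (auto simp: L2_tendsto_def)
  have "(\<lambda>n. \<integral>\<^sup>+ \<omega>. ennreal ((f n \<omega> + f' n \<omega> - (g \<omega> + g' \<omega>))\<^sup>2) \<partial>M) \<longlonglongrightarrow> 0"
  proof (rule tendsto_0_le)
    show "(\<lambda>n. 2 * (\<integral>\<^sup>+ \<omega>. ennreal ((f n \<omega> - g \<omega>)\<^sup>2) \<partial>M) + 2 * (\<integral>\<^sup>+ \<omega>. ennreal ((f' n \<omega> - g' \<omega>)\<^sup>2) \<partial>M)) \<longlonglongrightarrow> 0"
      using assms by (intro tendsto_0_two_sum) (auto simp: L2_tendsto_def)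
    show "(\<integral>\<^sup>+ \<omega>. ennreal ((f n \<omega> + f' n \<omega> - (g \<omega> + g' \<omega>))\<^sup>2) \<partial>M) \<le>
       2 * (\<integral>\<^sup>+ \<omega>. ennreal ((f n \<omega> - g \<omega>)\<^sup>2) \<partial>M) + 2 * (\<integral>\<^sup>+ \<omega>. ennreal ((f' n \<omega> - g' \<omega>)\<^sup>2) \<partial>M)" for n
      using nn_integral_square_add_le[of "\<lambda>\<omega>. f n \<omega> - g \<omega>" M "\<lambda>\<omega>. f' n \<omega> - g' \<omega>"]
      by (simp add: algebra_simps)
  qed
  then show ?thesis by (auto simp: L2_tendsto_def)
qed

lemma L2_tendsto_uminus:
  assumes "L2_tendsto M f g"
  shows "L2_tendsto M (\<lambda>n \<omega>. - f n \<omega>) (\<lambda>\<omega>. - g \<omega>)"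
proof -
  have "(- a - - b)\<^sup>2 = (a - b)\<^sup>2" for a b :: real by (simp add: power2_commute)
  then show ?thesis using assms by (simp add: L2_tendsto_def)
qed

lemma L2_tendsto_diff:
  assumes "L2_tendsto M f g" "L2_tendsto M f' g'"
  shows "L2_tendsto M (\<lambda>n \<omega>. f n \<omega> - f' n \<omega>) (\<lambda>\<omega>. g \<omega> - g' \<omega>)"
  using L2_tendsto_add[OF assms(1) L2_tendsto_uminus[OF assms(2)]] by simp

lemma L2_tendsto_const: "g \<in> borel_measurable M \<Longrightarrow> L2_tendsto M (\<lambda>n. g) g"
  by (simp add: L2_tendsto_def)

lemma L2_tendsto_sum:
  assumes "\<And>j. j \<in> J \<Longrightarrow> L2_tendsto M (f j) (g j)"
  shows "L2_tendsto M (\<lambda>n \<omega>. \<Sum>j\<in>J. f j n \<omega>) (\<lambda>\<omega>. \<Sum>j\<in>J. g j \<omega>)"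
  using assms
  by (induction J rule: infinite_finite_induct) (auto intro: L2_tendsto_add simp: L2_tendsto_const)

lemma L2_tendsto_cong_AE:
  assumes "L2_tendsto M f g" and "g' \<in> borel_measurable M" and "AE \<omega> in M. g \<omega> = g' \<omega>"
  shows "L2_tendsto M f g'"
proof -
  have "(\<integral>\<^sup>+ \<omega>. ennreal ((f n \<omega> - g' \<omega>)\<^sup>2) \<partial>M) = (\<integral>\<^sup>+ \<omega>. ennreal ((f n \<omega> - g \<omega>)\<^sup>2) \<partial>M)" for n
    by (rule nn_integral_cong_AE) (use assms(3) in eventually_elim, simp)
  then show ?thesis using assms by (simp add: L2_tendsto_def)
qed

lemma L2_tendsto_unique:
  assumes "L2_tendsto M f g" "L2_tendsto M f g'"
  shows "AE \<omega> in M. g \<omega> = g' \<omega>"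
proof -
  have "L2_tendsto M (\<lambda>n \<omega>. f n \<omega> - f n \<omega>) (\<lambda>\<omega>. g \<omega> - g' \<omega>)"
    by (rule L2_tendsto_diff[OF assms])
  then have m: "(\<lambda>\<omega>. g \<omega> - g' \<omega>) \<in> borel_measurable M"
    and "(\<integral>\<^sup>+ \<omega>. ennreal ((g \<omega> - g' \<omega>)\<^sup>2) \<partial>M) = 0"
    by (auto simp: L2_tendsto_def power2_commute LIMSEQ_const_iff)
  then have "AE \<omega> in M. ennreal ((g \<omega> - g' \<omega>)\<^sup>2) = 0"
    by (subst (asm) nn_integral_0_iff_AE) auto
  then show ?thesis by eventually_elim simp
qed

text \<open>From some index on the squared distances are integrable, and \<open>L\<^sup>1\<close> convergence yields the
  subsequence.\<close>

lemma L2_tendsto_subseq_AE: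
  assumes "L2_tendsto M f g"
  shows "\<exists>r::nat \<Rightarrow> nat. AE \<omega> in M. (\<lambda>n. f (r n) \<omega>) \<longlonglongrightarrow> g \<omega>"
proof -
  have [measurable]: "f n \<in> borel_measurable M" "g \<in> borel_measurable M" for n
    using assms by (auto simp: L2_tendsto_def)
  have lim: "(\<lambda>n. \<integral>\<^sup>+ \<omega>. ennreal ((f n \<omega> - g \<omega>)\<^sup>2) \<partial>M) \<longlonglongrightarrow> 0"
    using assms by (auto simp: L2_tendsto_def)
  then have "eventually (\<lambda>n. (\<integral>\<^sup>+ \<omega>. ennreal ((f n \<omega> - g \<omega>)\<^sup>2) \<partial>M) < 1) sequentially"
    by (intro order_tendstoD(2)) auto
  then obtain N where N: "\<And>n. n \<ge> N \<Longrightarrow> (\<integral>\<^sup>+ \<omega>. ennreal ((f n \<omega> - g \<omega>)\<^sup>2) \<partial>M) < 1"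
    by (auto simp: eventually_sequentially)
  define u where "u n \<omega> = (f (n + N) \<omega> - g \<omega>)\<^sup>2" for n \<omega>
  have int: "integrable M (u n)" for n
    unfolding u_def using N[of "n + N"] by (intro integrableI_bounded) (auto simp: less_trans)
  have "(\<lambda>n. \<integral>\<^sup>+ \<omega>. ennreal (u n \<omega>) \<partial>M) \<longlonglongrightarrow> 0"
    unfolding u_def by (rule LIMSEQ_ignore_initial_segment[OF lim])
  moreover have "(\<integral>\<^sup>+ \<omega>. ennreal (u n \<omega>) \<partial>M) = ennreal (\<integral>\<omega>. norm (u n \<omega>) \<partial>M)" for n
  proof -
    have "norm (u n \<omega>) = u n \<omega>" "0 \<le> u n \<omega>" for \<omega> by (simp_all add: u_def)
    then show ?thesis using nn_integral_eq_integral[OF int[of n]] by simp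
  qed
  ultimately have "(\<lambda>n. ennreal (\<integral>\<omega>. norm (u n \<omega>) \<partial>M)) \<longlonglongrightarrow> ennreal 0" by simp
  then have "(\<lambda>n. \<integral>\<omega>. norm (u n \<omega>) \<partial>M) \<longlonglongrightarrow> 0"
    by (subst (asm) tendsto_ennreal_iff) (auto intro!: always_eventually)
  from tendsto_L1_AE_subseq[OF int this]
  obtain r :: "nat \<Rightarrow> nat" where r: "AE \<omega> in M. (\<lambda>n. u (r n) \<omega>) \<longlonglongrightarrow> 0" by blast
  have "AE \<omega> in M. (\<lambda>n. f (r n + N) \<omega>) \<longlonglongrightarrow> g \<omega>"
    using r
  proof eventually_elim
    case (elim \<omega>)
    then have "(\<lambda>n. sqrt (u (r n) \<omega>)) \<longlonglongrightarrow> sqrt 0" by (rule tendsto_real_sqrt)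
    then have "(\<lambda>n. \<bar>f (r n + N) \<omega> - g \<omega>\<bar>) \<longlonglongrightarrow> 0" by (simp add: u_def)
    then show ?case by (simp add: tendsto_rabs_zero_iff LIM_zero_iff)
  qed
  then show ?thesis by (intro exI[of _ "\<lambda>n. r n + N"])
qed

lemma (in prob_space) all_momentsI:
  assumes [measurable]: "f \<in> borel_measurable M"
    and "\<And>q::nat. q \<ge> 1 \<Longrightarrow> integrable M (\<lambda>\<omega>. f \<omega> ^ (2 * q))"
  shows "all_moments M f"
  unfolding all_moments_def
proof (intro conjI allI)
  fix r
  show "integrable M (\<lambda>\<omega>. \<bar>f \<omega>\<bar> ^ r)"
  proof (rule Bochner_Integration.integrable_bound)
    show "integrable M (\<lambda>\<omega>. 1 + f \<omega> ^ (2 * Suc r))"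
      using assms(2)[of "Suc r"] by (intro Bochner_Integration.integrable_add) auto
    have "\<bar>y\<bar> ^ r \<le> 1 + y ^ (2 * Suc r)" for y :: real
    proof (cases "\<bar>y\<bar> \<le> 1")
      case True
      then have "\<bar>y\<bar> ^ r \<le> 1" by (simp add: power_le_one)
      moreover have "0 \<le> y ^ (2 * Suc r)" by (rule zero_le_even_power) simp
      ultimately show ?thesis by linarith
    next
      case False
      then have "\<bar>y\<bar> ^ r \<le> \<bar>y\<bar> ^ (2 * Suc r)" by (intro power_increasing) auto
      also have "\<dots> = y ^ (2 * Suc r)" by (rule power_even_abs) simp
      finally show ?thesis by linarith
    qed
    then have "norm (\<bar>y\<bar> ^ r) \<le> norm (1 + y ^ (2 * Suc r))" for y :: real
      using order_trans[OF _ abs_ge_self] by (simp del: power_Suc mult_Suc_right)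
    then show "AE \<omega> in M. norm (\<bar>f \<omega>\<bar> ^ r) \<le> norm (1 + f \<omega> ^ (2 * Suc r))"
      by (intro AE_I2)
  qed measurable
qed fact

text \<open>Fatou's lemma transfers uniform moment bounds to almost sure limits.\<close>

lemma (in prob_space) Fatou_moments:
  assumes f: "\<And>n. all_moments M (f n)" and [measurable]: "g \<in> borel_measurable M"
    and lim: "AE \<omega> in M. (\<lambda>n. f n \<omega>) \<longlonglongrightarrow> g \<omega>"
    and bound: "\<And>n q. q \<ge> 1 \<Longrightarrow> even_moment q (f n) \<le> K q"
  shows "all_moments M g" and "q \<ge> 1 \<Longrightarrow> even_moment q g \<le> K q"
proof -
  have [measurable]: "f n \<in> borel_measurable M" for n using f by (simp add: all_moments_measurable)
  have K0: "K q \<ge> 0" if "q \<ge> 1" for q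
    by (rule order_trans[OF _ bound[OF that, of 0]]) simp
  have nn: "(\<integral>\<^sup>+ \<omega>. ennreal (g \<omega> ^ (2 * q)) \<partial>M) \<le> ennreal (K q)" if q: "q \<ge> 1" for q
  proof -
    have "(\<integral>\<^sup>+ \<omega>. ennreal (g \<omega> ^ (2 * q)) \<partial>M) = (\<integral>\<^sup>+ \<omega>. liminf (\<lambda>n. ennreal (f n \<omega> ^ (2 * q))) \<partial>M)"
    proof (rule nn_integral_cong_AE, use lim in eventually_elim)
      case (elim \<omega>)
      then have "(\<lambda>n. ennreal (f n \<omega> ^ (2 * q))) \<longlonglongrightarrow> ennreal (g \<omega> ^ (2 * q))"
        by (intro tendsto_ennrealI tendsto_power)
      from lim_imp_Liminf[OF trivial_limit_sequentially this] show ?case by simp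
    qed
    also have "\<dots> \<le> liminf (\<lambda>n. \<integral>\<^sup>+ \<omega>. ennreal (f n \<omega> ^ (2 * q)) \<partial>M)"
      by (rule nn_integral_liminf) measurable
    also have "\<dots> \<le> liminf (\<lambda>n::nat. ennreal (K q))"
    proof (intro Liminf_mono always_eventually allI)
      fix n
      have "(\<integral>\<^sup>+ \<omega>. ennreal (f n \<omega> ^ (2 * q)) \<partial>M) = ennreal (even_moment q (f n))"
        by (intro nn_integral_eq_integral power_integrable f) auto
      also have "\<dots> \<le> ennreal (K q)" using bound[OF q] by (intro ennreal_leI)
      finally show "(\<integral>\<^sup>+ \<omega>. ennreal (f n \<omega> ^ (2 * q)) \<partial>M) \<le> ennreal (K q)" .
    qed
    also have "\<dots> = ennreal (K q)" by (simp add: Liminf_const)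
    finally show ?thesis .
  qed
  have int: "integrable M (\<lambda>\<omega>. g \<omega> ^ (2 * q))" if "q \<ge> 1" for q
  proof (rule integrableI_bounded)
    have "(\<integral>\<^sup>+ \<omega>. ennreal (norm (g \<omega> ^ (2 * q))) \<partial>M) = (\<integral>\<^sup>+ \<omega>. ennreal (g \<omega> ^ (2 * q)) \<partial>M)"
      by (intro nn_integral_cong) simp
    also have "\<dots> < \<infinity>" using nn[OF that] by (simp add: le_less_trans)
    finally show "(\<integral>\<^sup>+ \<omega>. ennreal (norm (g \<omega> ^ (2 * q))) \<partial>M) < \<infinity>" .
  qed measurable
  show "all_moments M g" by (rule all_momentsI) (auto intro: int)
  show "even_moment q g \<le> K q" if "q \<ge> 1"
    using nn[OF that] K0[OF that]
    by (subst (asm) nn_integral_eq_integral[OF int[OF that]]) (auto simp: ennreal_le_iff)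
qed

lemma (in prob_space) L2_limit_moments:
  assumes f: "\<And>n. all_moments M (f n)" and lim: "L2_tendsto M f g"
    and bound: "\<And>n q. q \<ge> 1 \<Longrightarrow> even_moment q (f n) \<le> K q"
  shows "all_moments M g" and "q \<ge> 1 \<Longrightarrow> even_moment q g \<le> K q"
proof -
  obtain r :: "nat \<Rightarrow> nat" where r: "AE \<omega> in M. (\<lambda>n. f (r n) \<omega>) \<longlonglongrightarrow> g \<omega>"
    using L2_tendsto_subseq_AE[OF lim] by blast
  have g: "g \<in> borel_measurable M" using lim by (simp add: L2_tendsto_def)
  note Fatou = Fatou_moments[of "\<lambda>n. f (r n)" g K, OF f g r bound]
  show "all_moments M g" by (rule Fatou(1))
  show "q \<ge> 1 \<Longrightarrow> even_moment q g \<le> K q" by (rule Fatou(2))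
qed

lemma (in prob_space) integrable_mult_square:
  fixes Y Z :: "'a \<Rightarrow> real"
  assumes [measurable]: "Y \<in> borel_measurable M" "Z \<in> borel_measurable M"
    and "integrable M (\<lambda>\<omega>. (Y \<omega>)\<^sup>2)" "integrable M (\<lambda>\<omega>. (Z \<omega>)\<^sup>2)"
  shows "integrable M (\<lambda>\<omega>. Y \<omega> * Z \<omega>)"
proof (rule Bochner_Integration.integrable_bound)
  show "integrable M (\<lambda>\<omega>. (Y \<omega>)\<^sup>2 + (Z \<omega>)\<^sup>2)" using assms by simp
  have "\<bar>a * b\<bar> \<le> a\<^sup>2 + b\<^sup>2" for a b :: real
  proof -
    have "2 * \<bar>a * b\<bar> \<le> a\<^sup>2 + b\<^sup>2"
      using sum_squares_bound[of "\<bar>a\<bar>" "\<bar>b\<bar>"] by (simp add: abs_mult)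
    then show ?thesis using abs_ge_zero[of "a * b"] by linarith
  qed
  then show "AE \<omega> in M. norm (Y \<omega> * Z \<omega>) \<le> norm ((Y \<omega>)\<^sup>2 + (Z \<omega>)\<^sup>2)" by simp
qed measurable

text \<open>By \<open>2 |y z| \<le> \<epsilon> y\<^sup>2 + z\<^sup>2 / \<epsilon>\<close>, where \<open>z\<close> is the distance to the limit: first \<open>n\<close> tends to
  infinity, then \<open>\<epsilon>\<close> to zero.\<close>

lemma (in prob_space) L2_limit_orthogonal:
  assumes [measurable]: "Y \<in> borel_measurable M" and Y: "integrable M (\<lambda>\<omega>. (Y \<omega>)\<^sup>2)"
    and f: "\<And>n. all_moments M (f n)" and g: "all_moments M g" and lim: "L2_tendsto M f g"
    and orth: "\<And>n. expectation (\<lambda>\<omega>. Y \<omega> * f n \<omega>) = 0"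
  shows "expectation (\<lambda>\<omega>. Y \<omega> * g \<omega>) = 0"
proof -
  have fg: "all_moments M (\<lambda>\<omega>. g \<omega> - f n \<omega>)" for n by (intro all_moments_diff f g)
  note [measurable] = all_moments_measurable[OF f] all_moments_measurable[OF g]
  have E: "expectation (\<lambda>\<omega>. Y \<omega> * g \<omega>) = expectation (\<lambda>\<omega>. Y \<omega> * (g \<omega> - f n \<omega>))" for n
    using integrable_mult_square[OF _ _ Y power_integrable[OF g]] integrable_mult_square[OF _ _ Y
        power_integrable[OF f], of n]
    by (simp add: right_diff_distrib orth)
  have lim': "(\<lambda>n. expectation (\<lambda>\<omega>. (g \<omega> - f n \<omega>)\<^sup>2)) \<longlonglongrightarrow> 0"
  proof -
    have "(\<lambda>n. ennreal (expectation (\<lambda>\<omega>. (g \<omega> - f n \<omega>)\<^sup>2))) \<longlonglongrightarrow> ennreal 0"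
      using lim power_integrable[OF fg]
      by (subst nn_integral_eq_integral[symmetric]) (auto simp: L2_tendsto_def power2_commute)
    then show ?thesis by (subst (asm) tendsto_ennreal_iff) auto
  qed
  have key: "2 * \<bar>expectation (\<lambda>\<omega>. Y \<omega> * g \<omega>)\<bar> \<le> e * expectation (\<lambda>\<omega>. (Y \<omega>)\<^sup>2)" if e: "e > 0" for e
  proof (rule LIMSEQ_le_const)
    show "(\<lambda>n. e * expectation (\<lambda>\<omega>. (Y \<omega>)\<^sup>2) + expectation (\<lambda>\<omega>. (g \<omega> - f n \<omega>)\<^sup>2) / e) \<longlonglongrightarrow> e * expectation (\<lambda>\<omega>. (Y \<omega>)\<^sup>2)"
      using tendsto_add[OF tendsto_const tendsto_divide[OF lim' tendsto_const[of e]], of "e * expectation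
          (\<lambda>\<omega>. (Y \<omega>)\<^sup>2)"] e
      by simp
    have "2 * \<bar>expectation (\<lambda>\<omega>. Y \<omega> * g \<omega>)\<bar> \<le> e * expectation (\<lambda>\<omega>. (Y \<omega>)\<^sup>2) + expectation (\<lambda>\<omega>. (g \<omega> - f n
        \<omega>)\<^sup>2) / e" for n
    proof -
      have int: "integrable M (\<lambda>\<omega>. Y \<omega> * (g \<omega> - f n \<omega>))"
        by (intro integrable_mult_square Y power_integrable fg) measurable
      have "2 * \<bar>expectation (\<lambda>\<omega>. Y \<omega> * g \<omega>)\<bar> \<le> 2 * expectation (\<lambda>\<omega>. \<bar>Y \<omega> * (g \<omega> - f n \<omega>)\<bar>)"
        unfolding E[of n] by (simp add: integral_abs_bound)
      also have "\<dots> = expectation (\<lambda>\<omega>. 2 * \<bar>Y \<omega> * (g \<omega> - f n \<omega>)\<bar>)" by simp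
      also have "\<dots> \<le> expectation (\<lambda>\<omega>. e * (Y \<omega>)\<^sup>2 + (g \<omega> - f n \<omega>)\<^sup>2 / e)"
      proof (rule integral_mono)
        fix \<omega>
        define a b where "a = \<bar>Y \<omega>\<bar>" and "b = \<bar>g \<omega> - f n \<omega>\<bar>"
        have "2 * (e * a) * b \<le> (e * a)\<^sup>2 + b\<^sup>2" by (rule sum_squares_bound)
        then have "2 * (a * b) \<le> e * a\<^sup>2 + b\<^sup>2 / e"
          using e by (simp add: field_simps power2_eq_square)
        then show "2 * \<bar>Y \<omega> * (g \<omega> - f n \<omega>)\<bar> \<le> e * (Y \<omega>)\<^sup>2 + (g \<omega> - f n \<omega>)\<^sup>2 / e"
          by (simp add: a_def b_def abs_mult)
      qed (use Y int power_integrable[OF fg[of n], of 2] in auto)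
      also have "\<dots> = e * expectation (\<lambda>\<omega>. (Y \<omega>)\<^sup>2) + expectation (\<lambda>\<omega>. (g \<omega> - f n \<omega>)\<^sup>2) / e"
        using Y power_integrable[OF fg[of n], of 2] by simp
      finally show ?thesis .
    qed
    then show "\<exists>N. \<forall>n\<ge>N. 2 * \<bar>expectation (\<lambda>\<omega>. Y \<omega> * g \<omega>)\<bar> \<le>
        e * expectation (\<lambda>\<omega>. (Y \<omega>)\<^sup>2) + expectation (\<lambda>\<omega>. (g \<omega> - f n \<omega>)\<^sup>2) / e"
      by blast
  qed
  have Y0: "expectation (\<lambda>\<omega>. (Y \<omega>)\<^sup>2) \<ge> 0" by simp
  have "2 * \<bar>expectation (\<lambda>\<omega>. Y \<omega> * g \<omega>)\<bar> \<le> 0"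
  proof (rule field_le_epsilon)
    fix \<delta> :: real assume "\<delta> > 0"
    have "2 * \<bar>expectation (\<lambda>\<omega>. Y \<omega> * g \<omega>)\<bar> \<le> \<delta> / (expectation (\<lambda>\<omega>. (Y \<omega>)\<^sup>2) + 1) * expectation (\<lambda>\<omega>. (Y \<omega>)\<^sup>2)"
      using \<open>\<delta> > 0\<close> Y0 by (intro key divide_pos_pos add_nonneg_pos) auto
    also have "\<dots> \<le> \<delta> / (expectation (\<lambda>\<omega>. (Y \<omega>)\<^sup>2) + 1) * (expectation (\<lambda>\<omega>. (Y \<omega>)\<^sup>2) + 1)"
      using \<open>\<delta> > 0\<close> Y0 by (intro mult_left_mono divide_nonneg_nonneg) linarith+
    also have "\<dots> = \<delta>" using add_nonneg_pos[OF Y0, of 1] by simp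
    finally show "2 * \<bar>expectation (\<lambda>\<omega>. Y \<omega> * g \<omega>)\<bar> \<le> 0 + \<delta>" by simp
  qed
  then show ?thesis by simp
qed

section \<open>The Ito isometry\<close>

locale filtered_space = prob_space M for M :: "'w measure" +
  fixes F :: "real \<Rightarrow> 'w measure"
  assumes filtered: "filtered M F"
begin

lemma subalgebra_F: "0 \<le> t \<Longrightarrow> subalgebra M (F t)"
  using filtered by (simp add: filtered_def)

lemma F_measurable: "0 \<le> t \<Longrightarrow> Y \<in> borel_measurable (F t) \<Longrightarrow> Y \<in> borel_measurable M"
  using measurable_from_subalg[OF subalgebra_F] .

lemma F_mono:
  assumes "0 \<le> s" "s \<le> t" "Y \<in> borel_measurable (F s)"
  shows "Y \<in> borel_measurable (F t)"
proof (rule measurable_from_subalg[OF _ assms(3)])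
  show "subalgebra (F t) (F s)"
    using filtered subalgebra_F[of s] subalgebra_F[of t] assms by (auto simp: subalgebra_def filtered_def)
qed

lemma space_F: "0 \<le> t \<Longrightarrow> space (F t) = space M"
  using subalgebra_F by (simp add: subalgebra_def)

end

definition gauss_moment :: "nat \<Rightarrow> real"
  where "gauss_moment q = fact (2 * q) / (2 ^ q * fact q)"

lemma gauss_moment_nonneg: "gauss_moment q \<ge> 0"
  by (simp add: gauss_moment_def)

text \<open>A Brownian motion whose increments are independent of a filtration that may be larger than its own.\<close>

locale wiener = filtered_space M F for M :: "'w measure" and F :: "real \<Rightarrow> 'w measure" +
  fixes W :: "real \<Rightarrow> 'w \<Rightarrow> real"
  assumes adapted: "0 \<le> t \<Longrightarrow> W t \<in> borel_measurable (F t)"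
    and indep_increment: "\<And>Y :: 'w \<Rightarrow> real. 0 \<le> s \<Longrightarrow> s \<le> t \<Longrightarrow> Y \<in> borel_measurable (F s) \<Longrightarrow>
      indep_var borel Y borel (\<lambda>\<omega>. W t \<omega> - W s \<omega>)"
    and normal_increment: "0 \<le> s \<Longrightarrow> s < t \<Longrightarrow>
      distributed M lborel (\<lambda>\<omega>. W t \<omega> - W s \<omega>) (normal_density 0 (sqrt (t - s)))"
    and continuous_path: "\<omega> \<in> space M \<Longrightarrow> continuous_on {0..} (\<lambda>t. W t \<omega>)"
begin

abbreviation inc :: "real \<Rightarrow> real \<Rightarrow> 'w \<Rightarrow> real"
  where "inc s t \<equiv> \<lambda>\<omega>. W t \<omega> - W s \<omega>"

lemma inc_adapted: "0 \<le> s \<Longrightarrow> s \<le> t \<Longrightarrow> t \<le> u \<Longrightarrow> inc s t \<in> borel_measurable (F u)"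
  by (intro borel_measurable_diff) (metis F_mono adapted order_trans)+

lemma inc_moments:
  assumes "0 \<le> s" "s \<le> t"
  shows inc_all_moments: "all_moments M (inc s t)"
    and inc_even_moment: "even_moment q (inc s t) = gauss_moment q * (t - s) ^ q"
    and inc_mean: "expectation (inc s t) = 0"
proof -
  have "all_moments M (inc s t) \<and> (\<forall>q. even_moment q (inc s t) = gauss_moment q * (t - s) ^ q)
    \<and> expectation (inc s t) = 0"
  proof (cases "s = t")
    case True
    then show ?thesis
      by (auto simp: all_moments_const gauss_moment_def prob_space power_0_left)
  next
    case False
    then have st: "s < t" using assms by simp
    then have \<sigma>: "0 < sqrt (t - s)" by simp
    note D = normal_increment[OF assms(1) st]
    have m: "inc s t \<in> borel_measurable M"
      using D by (simp add: distributed_def)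
    have "integrable M (\<lambda>\<omega>. \<bar>inc s t \<omega>\<bar> ^ r)" for r
      using distributed_integrable[OF D, of "\<lambda>x. \<bar>x\<bar> ^ r"] integrable_normal_moment_abs[OF \<sigma>, of 0 r] by simp
    then have a: "all_moments M (inc s t)" using m by (simp add: all_moments_def)
    have e: "even_moment q (inc s t) = gauss_moment q * (t - s) ^ q" for q
    proof -
      have "even_moment q (inc s t) = (\<integral>x. normal_density 0 (sqrt (t - s)) x * x ^ (2 * q) \<partial>lborel)"
        using distributed_integral[OF D, of "\<lambda>x. x ^ (2 * q)"] by simp
      also have "\<dots> = fact (2 * q) / ((2 / (sqrt (t - s))\<^sup>2) ^ q * fact q)"
        using integral_normal_moment_even[OF \<sigma>, of 0 q] by simp
      also have "\<dots> = gauss_moment q * (t - s) ^ q"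
        using st by (simp add: gauss_moment_def power_divide)
      finally show ?thesis .
    qed
    have "expectation (inc s t) = (\<integral>x. normal_density 0 (sqrt (t - s)) x * x \<partial>lborel)"
      using distributed_integral[OF D, of "\<lambda>x. x"] by simp
    also have "\<dots> = 0" using integral_normal_moment_odd[OF \<sigma>, of 0 0] by simp
    finally show ?thesis using a e by blast
  qed
  then show "all_moments M (inc s t)"
    "even_moment q (inc s t) = gauss_moment q * (t - s) ^ q"
    "expectation (inc s t) = 0" by auto
qed

lemma inc_variance: "0 \<le> s \<Longrightarrow> s \<le> t \<Longrightarrow> expectation (\<lambda>\<omega>. (inc s t \<omega>)\<^sup>2) = t - s"
  using inc_even_moment[of s t 1] by (simp add: gauss_moment_def)

lemma expectation_mult_inc:
  assumes "0 \<le> s" "s \<le> t" "Y \<in> borel_measurable (F s)" "integrable M Y"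
  shows "expectation (\<lambda>\<omega>. Y \<omega> * inc s t \<omega> ^ r) = expectation Y * expectation (\<lambda>\<omega>. inc s t \<omega> ^ r)"
proof (rule indep_var_lebesgue_integral[OF _ assms(4)])
  have "indep_var borel (id \<circ> Y) borel ((\<lambda>x. x ^ r) \<circ> inc s t)"
    by (rule indep_var_compose[OF indep_increment[OF assms(1-3)]]) auto
  then show "indep_var borel Y borel (\<lambda>\<omega>. inc s t \<omega> ^ r)" by (simp add: comp_def)
  show "integrable M (\<lambda>\<omega>. inc s t \<omega> ^ r)"
    using inc_all_moments[OF assms(1,2)] by (rule power_integrable)
qed

lemma inc_orthogonal:
  assumes "0 \<le> s" "s \<le> t" "Y \<in> borel_measurable (F s)" "integrable M Y"
  shows "expectation (\<lambda>\<omega>. Y \<omega> * inc s t \<omega>) = 0"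
  using expectation_mult_inc[OF assms, of 1] inc_mean[OF assms(1,2)] by simp

lemma inc_square:
  assumes "0 \<le> s" "s \<le> t" "Y \<in> borel_measurable (F s)" "integrable M Y"
  shows "expectation (\<lambda>\<omega>. Y \<omega> * (inc s t \<omega>)\<^sup>2) = expectation Y * (t - s)"
  using expectation_mult_inc[OF assms, of 2] inc_variance[OF assms(1,2)] by simp

text \<open>The length of the intersection of \<open>(a, b]\<close> and \<open>(c, d]\<close>.\<close>

definition overlap :: "real \<Rightarrow> real \<Rightarrow> real \<Rightarrow> real \<Rightarrow> real"
  where "overlap a b c d = max 0 (min b d - max a c)"

text \<open>Splitting the increments at the end points of the common interval produces the square of the
  increment over it; every other product contains an increment that starts when all its other factors
  are already known, and has mean zero.\<close>

lemma pair_covariance_ordered: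
  assumes ab: "0 \<le> a" "a \<le> b" and cd: "c \<le> d" and ac: "a \<le> c"
    and \<xi>: "\<xi> \<in> borel_measurable (F a)" "all_moments M \<xi>"
    and \<eta>: "\<eta> \<in> borel_measurable (F c)" "all_moments M \<eta>"
  shows "expectation (\<lambda>\<omega>. (\<xi> \<omega> * inc a b \<omega>) * (\<eta> \<omega> * inc c d \<omega>)) = expectation (\<lambda>\<omega>. \<xi> \<omega> * \<eta> \<omega>) * overlap a b c d"
proof (cases "b \<le> c")
  case True
  have "(\<lambda>\<omega>. \<xi> \<omega> * inc a b \<omega> * \<eta> \<omega>) \<in> borel_measurable (F c)"
    using assms True by (intro borel_measurable_times inc_adapted F_mono[OF _ ac \<xi>(1)] \<eta>(1)) auto
  moreover have "all_moments M (\<lambda>\<omega>. \<xi> \<omega> * inc a b \<omega> * \<eta> \<omega>)"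
    using assms by (intro all_moments_mult inc_all_moments) auto
  ultimately have "expectation (\<lambda>\<omega>. (\<xi> \<omega> * inc a b \<omega> * \<eta> \<omega>) * inc c d \<omega>) = 0"
    using assms by (intro inc_orthogonal) (auto intro: all_moments_integrable)
  then show ?thesis using True ac cd by (simp add: overlap_def mult_ac)
next
  case False
  define m where "m = min b d"
  have m: "c \<le> m" "m \<le> b" "m \<le> d" using False cd by (auto simp: m_def)
  have c0: "0 \<le> c" using ab ac by simp
  have \<xi>\<eta>: "all_moments M (\<lambda>\<omega>. \<xi> \<omega> * \<eta> \<omega>)" "(\<lambda>\<omega>. \<xi> \<omega> * \<eta> \<omega>) \<in> borel_measurable (F c)"
    using \<xi> \<eta> F_mono[OF ab(1) ac \<xi>(1)] by (auto intro: all_moments_mult)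
  have \<eta>m: "\<eta> \<in> borel_measurable (F m)" by (rule F_mono[OF c0 m(1) \<eta>(1)])
  have \<xi>m: "\<xi> \<in> borel_measurable (F m)" using ac m by (intro F_mono[OF ab(1) _ \<xi>(1)]) simp
  have mom: "all_moments M (inc a c)" "all_moments M (inc c d)" "all_moments M (inc c m)"
    "all_moments M (inc m d)" "all_moments M (inc m b)"
    using ab cd ac m c0 by (auto intro!: inc_all_moments)
  have 1: "expectation (\<lambda>\<omega>. (\<xi> \<omega> * \<eta> \<omega> * inc a c \<omega>) * inc c d \<omega>) = 0"
    using ab cd ac c0
    by (intro inc_orthogonal borel_measurable_times \<xi>\<eta> inc_adapted all_moments_integrable
        all_moments_mult mom) auto
  have 2: "expectation (\<lambda>\<omega>. (\<xi> \<omega> * \<eta> \<omega>) * (inc c m \<omega>)\<^sup>2) = expectation (\<lambda>\<omega>. \<xi> \<omega> * \<eta> \<omega>) * (m - c)"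
    using c0 m \<xi>\<eta> by (intro inc_square all_moments_integrable) auto
  have 3: "expectation (\<lambda>\<omega>. (\<xi> \<omega> * \<eta> \<omega> * inc c m \<omega>) * inc m d \<omega>) = 0"
    using m c0 by (intro inc_orthogonal borel_measurable_times inc_adapted all_moments_integrable
        all_moments_mult mom
        \<xi>m \<eta>m \<xi> \<eta>) auto
  have 4: "expectation (\<lambda>\<omega>. (\<xi> \<omega> * \<eta> \<omega> * inc c d \<omega>) * inc m b \<omega>) = 0"
  proof (cases "m = b")
    case True
    then show ?thesis by simp
  next
    case False
    then have md: "m = d" by (auto simp: m_def min_def split: if_splits)
    show ?thesis
      using m c0 cd md by (intro inc_orthogonal borel_measurable_times inc_adapted all_moments_integrable
          all_moments_mult mom \<xi>m \<eta>m \<xi> \<eta>) auto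
  qed
  have "(\<xi> \<omega> * inc a b \<omega>) * (\<eta> \<omega> * inc c d \<omega>) =
     (\<xi> \<omega> * \<eta> \<omega> * inc a c \<omega>) * inc c d \<omega> + (\<xi> \<omega> * \<eta> \<omega>) * (inc c m \<omega>)\<^sup>2
     + (\<xi> \<omega> * \<eta> \<omega> * inc c m \<omega>) * inc m d \<omega> + (\<xi> \<omega> * \<eta> \<omega> * inc c d \<omega>) * inc m b \<omega>" for \<omega>
    by (simp add: algebra_simps power2_eq_square)
  then have "expectation (\<lambda>\<omega>. (\<xi> \<omega> * inc a b \<omega>) * (\<eta> \<omega> * inc c d \<omega>)) =
     expectation (\<lambda>\<omega>. (\<xi> \<omega> * \<eta> \<omega> * inc a c \<omega>) * inc c d \<omega> + (\<xi> \<omega> * \<eta> \<omega>) * (inc c m \<omega>)\<^sup>2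
     + (\<xi> \<omega> * \<eta> \<omega> * inc c m \<omega>) * inc m d \<omega> + (\<xi> \<omega> * \<eta> \<omega> * inc c d \<omega>) * inc m b \<omega>)" by simp
  also have "\<dots> = expectation (\<lambda>\<omega>. (\<xi> \<omega> * \<eta> \<omega> * inc a c \<omega>) * inc c d \<omega>) + expectation (\<lambda>\<omega>. (\<xi> \<omega> * \<eta> \<omega>) *
      (inc c m \<omega>)\<^sup>2)
     + expectation (\<lambda>\<omega>. (\<xi> \<omega> * \<eta> \<omega> * inc c m \<omega>) * inc m d \<omega>) + expectation (\<lambda>\<omega>. (\<xi> \<omega> * \<eta> \<omega> * inc c d \<omega>) *
         inc m b \<omega>)"
    by (subst Bochner_Integration.integral_add, (intro all_moments_integrable all_moments_add
        all_moments_mult all_moments_power mom \<xi> \<eta>)+)+ simp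
  also have "\<dots> = expectation (\<lambda>\<omega>. \<xi> \<omega> * \<eta> \<omega>) * overlap a b c d"
    using m ac unfolding 1 2 3 4 by (simp add: overlap_def m_def[symmetric])
  finally show ?thesis .
qed

lemma pair_covariance:
  assumes "0 \<le> a" "a \<le> b" "0 \<le> c" "c \<le> d"
    and "\<xi> \<in> borel_measurable (F a)" "all_moments M \<xi>"
    and "\<eta> \<in> borel_measurable (F c)" "all_moments M \<eta>"
  shows "expectation (\<lambda>\<omega>. (\<xi> \<omega> * inc a b \<omega>) * (\<eta> \<omega> * inc c d \<omega>)) = expectation (\<lambda>\<omega>. \<xi> \<omega> * \<eta> \<omega>) * overlap a b c d"
proof (cases "a \<le> c")
  case True
  then show ?thesis using assms by (intro pair_covariance_ordered) auto
next
  case False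
  then have "expectation (\<lambda>\<omega>. (\<eta> \<omega> * inc c d \<omega>) * (\<xi> \<omega> * inc a b \<omega>)) =
      expectation (\<lambda>\<omega>. \<eta> \<omega> * \<xi> \<omega>) * overlap c d a b"
    using assms by (intro pair_covariance_ordered) auto
  then show ?thesis by (simp add: mult_ac overlap_def min.commute max.commute)
qed

lemma has_bochner_integral_indicator_Ioc_product:
  assumes "{a<..b} \<subseteq> {A..E}"
  shows "has_bochner_integral (restrict_space lborel {A..E})
    (\<lambda>s. indicator {a<..b} s * indicator {c<..d} s) (overlap a b c d)"
proof -
  have eq: "indicator {a<..b} s * indicator {c<..d} s = (indicator {max a c<..min b d} s :: real)" for s
    by (auto simp: indicator_def)
  have sub: "{max a c<..min b d} \<subseteq> {A..E}" using assms by auto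
  have sets: "{max a c<..min b d} \<in> sets (restrict_space lborel {A..E})"
    using sub by (auto simp: sets_restrict_space_iff)
  have em: "emeasure (restrict_space lborel {A..E}) {max a c<..min b d} = ennreal (overlap a b c d)"
  proof -
    have "emeasure lborel {max a c<..min b d} = ennreal (overlap a b c d)"
    proof (cases "max a c \<le> min b d")
      case False
      then have "{max a c<..min b d} = {}" "overlap a b c d = 0" by (auto simp: overlap_def)
      then show ?thesis by (simp only: emeasure_empty ennreal_0)
    qed (simp add: overlap_def)
    then show ?thesis using sub by (subst emeasure_restrict_space) auto
  qed
  have "has_bochner_integral (restrict_space lborel {A..E}) (indicator {max a c<..min b d})
      (measure (restrict_space lborel {A..E}) {max a c<..min b d})"
    using sets em by (intro has_bochner_integral_real_indicator) auto
  moreover have "measure (restrict_space lborel {A..E}) {max a c<..min b d} = overlap a b c d"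
  proof -
    have "0 \<le> overlap a b c d" by (simp add: overlap_def)
    then show ?thesis using em by (simp add: measure_def)
  qed
  ultimately show ?thesis unfolding eq by simp
qed

text \<open>The isometry for finite sums of elementary integrands over arbitrary, possibly overlapping
  intervals; in this form it applies to differences of simple integrands over different partitions.\<close>

lemma elementary_isometry:
  assumes I: "finite I" and ab: "\<And>i. i \<in> I \<Longrightarrow> 0 \<le> a i \<and> a i \<le> b i \<and> {a i<..b i} \<subseteq> {A..E}"
    and \<xi>: "\<And>i. i \<in> I \<Longrightarrow> \<xi> i \<in> borel_measurable (F (a i))" "\<And>i. i \<in> I \<Longrightarrow> all_moments M (\<xi> i)"
  shows "(\<integral>\<^sup>+ \<omega>. ennreal ((\<Sum>i\<in>I. \<xi> i \<omega> * inc (a i) (b i) \<omega>)\<^sup>2) \<partial>M) =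
    (\<integral>\<^sup>+ \<omega>. (\<integral>\<^sup>+ s. ennreal ((\<Sum>i\<in>I. \<xi> i \<omega> * indicator {a i<..b i} s)\<^sup>2) \<partial>(restrict_space lborel {A..E})) \<partial>M)"
proof -
  let ?L = "restrict_space lborel {A..E}"
  define R where "R \<omega> = (\<Sum>i\<in>I. \<Sum>j\<in>I. \<xi> i \<omega> * \<xi> j \<omega> * overlap (a i) (b i) (a j) (b j))" for \<omega>
  have hbi: "has_bochner_integral ?L (\<lambda>s. (\<Sum>i\<in>I. \<xi> i \<omega> * indicator {a i<..b i} s)\<^sup>2) (R \<omega>)" for \<omega>
  proof -
    have sq: "(\<lambda>s. (\<Sum>i\<in>I. \<xi> i \<omega> * indicator {a i<..b i} s)\<^sup>2) =
      (\<lambda>s. \<Sum>i\<in>I. \<Sum>j\<in>I. (\<xi> i \<omega> * \<xi> j \<omega>) * (indicator {a i<..b i} s * indicator {a j<..b j} s))"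
      by (simp add: power2_eq_square sum_product mult_ac)
    show ?thesis unfolding sq R_def
      using ab by (intro has_bochner_integral_sum has_bochner_integral_mult_right
          has_bochner_integral_indicator_Ioc_product) auto
  qed
  have inner: "(\<integral>\<^sup>+ s. ennreal ((\<Sum>i\<in>I. \<xi> i \<omega> * indicator {a i<..b i} s)\<^sup>2) \<partial>?L) = ennreal (R \<omega>)" for \<omega>
    using nn_integral_eq_integral[OF integrable.intros[OF hbi]] has_bochner_integral_integral_eq[OF hbi] by simp
  have mom: "all_moments M (\<lambda>\<omega>. \<xi> i \<omega> * inc (a i) (b i) \<omega>)" if "i \<in> I" for i
    using ab[OF that] \<xi>(2)[OF that] by (intro all_moments_mult inc_all_moments) auto
  have momR: "all_moments M R" unfolding R_def[abs_def]
    by (intro all_moments_sum all_moments_mult all_moments_const \<xi>)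
  have R0: "R \<omega> \<ge> 0" for \<omega>
    unfolding has_bochner_integral_integral_eq[OF hbi, symmetric] by simp
  have "(\<integral>\<^sup>+ \<omega>. ennreal ((\<Sum>i\<in>I. \<xi> i \<omega> * inc (a i) (b i) \<omega>)\<^sup>2) \<partial>M) =
      ennreal (expectation (\<lambda>\<omega>. (\<Sum>i\<in>I. \<xi> i \<omega> * inc (a i) (b i) \<omega>)\<^sup>2))"
    by (intro nn_integral_eq_integral power_integrable all_moments_sum mom) auto
  also have "expectation (\<lambda>\<omega>. (\<Sum>i\<in>I. \<xi> i \<omega> * inc (a i) (b i) \<omega>)\<^sup>2) =
      (\<Sum>i\<in>I. \<Sum>j\<in>I. expectation (\<lambda>\<omega>. (\<xi> i \<omega> * inc (a i) (b i) \<omega>) * (\<xi> j \<omega> * inc (a j) (b j) \<omega>)))"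
    unfolding power2_eq_square sum_product
    by (subst Bochner_Integration.integral_sum, intro all_moments_integrable all_moments_sum
        all_moments_mult[OF mom mom], assumption+,
        intro sum.cong refl Bochner_Integration.integral_sum all_moments_integrable all_moments_mult[OF mom mom])
  also have "\<dots> = (\<Sum>i\<in>I. \<Sum>j\<in>I. expectation (\<lambda>\<omega>. \<xi> i \<omega> * \<xi> j \<omega>) * overlap (a i) (b i) (a j) (b j))"
    using ab \<xi> by (intro sum.cong refl pair_covariance) auto
  also have "\<dots> = expectation R"
    unfolding R_def
    by (subst Bochner_Integration.integral_sum, intro all_moments_integrable all_moments_sum
        all_moments_mult[OF all_moments_mult all_moments_const] \<xi>, assumption+,
        intro sum.cong refl, subst Bochner_Integration.integral_sum, intro all_moments_integrable
            all_moments_sum all_moments_mult[OF all_moments_mult all_moments_const] \<xi>, assumption+)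
      (auto intro!: sum.cong)
  also have "ennreal (expectation R) = (\<integral>\<^sup>+ \<omega>. ennreal (R \<omega>) \<partial>M)"
    using all_moments_integrable[OF momR] R0 by (intro nn_integral_eq_integral[symmetric]) auto
  finally show ?thesis by (simp add: inner)
qed

end

section \<open>Ito integrals as limits of Riemann sums\<close>

lemma partition_mono:
  fixes \<tau> :: "nat \<Rightarrow> real"
  assumes "\<forall>i<m. \<tau> i \<le> \<tau> (Suc i)" and "i \<le> j" "j \<le> m"
  shows "\<tau> i \<le> \<tau> j"
  using assms(2,3)
proof (induction j rule: dec_induct)
  case (step j)
  then show ?case using assms(1) by (meson Suc_le_lessD Suc_leD order_trans)
qed simp

lemma simple_integrand_bounds:
  assumes "simple_integrand M F a b m \<tau> \<xi>" and "i < m"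
  shows "a \<le> \<tau> i" "\<tau> i \<le> \<tau> (Suc i)" "\<tau> (Suc i) \<le> b"
  using assms partition_mono[of m \<tau> 0 i] partition_mono[of m \<tau> "Suc i" m]
  by (auto simp: simple_integrand_def)

lemma simple_value_eq:
  assumes "\<forall>i<m. \<tau> i \<le> \<tau> (Suc i)" and "i < m" and "s \<in> {\<tau> i<..\<tau> (Suc i)}"
  shows "simple_value m \<tau> \<xi> s \<omega> = \<xi> i \<omega>"
proof -
  have "indicator {\<tau> k<..\<tau> (Suc k)} s *\<^sub>R \<xi> k \<omega> = (if k = i then \<xi> i \<omega> else 0)" if "k < m" for k
    using assms partition_mono[OF assms(1), of "Suc k" i] partition_mono[OF assms(1), of "Suc i" k] that
    by (cases k i rule: linorder_cases) (auto simp: indicator_def)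
  then have "simple_value m \<tau> \<xi> s \<omega> = (\<Sum>k<m. if k = i then \<xi> i \<omega> else 0)"
    unfolding simple_value_def by (intro sum.cong) auto
  then show ?thesis using assms(2) by simp
qed

lemma partition_interval_exists:
  fixes \<tau> :: "nat \<Rightarrow> real"
  assumes "\<tau> 0 < s" "s \<le> \<tau> m"
  shows "\<exists>i<m. s \<in> {\<tau> i<..\<tau> (Suc i)}"
  using assms
proof (induction m)
  case (Suc m)
  then show ?case by (cases "s \<le> \<tau> m") (auto intro: less_SucI)
qed simp

context wiener
begin

text \<open>The difference of two simple integrands is an elementary sum over the disjoint union of the two
  index sets.\<close>

lemma simple_isometry:
  fixes \<xi> \<xi>' :: "nat \<Rightarrow> 'w \<Rightarrow> real"
  assumes S1: "simple_integrand M F a b m \<tau> \<xi>" and S2: "simple_integrand M F a b m' \<tau>' \<xi>'" and a: "0 \<le> a"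
  shows "(\<integral>\<^sup>+ \<omega>. ennreal ((simple_integral W m \<tau> \<xi> \<omega> - simple_integral W m' \<tau>' \<xi>' \<omega>)\<^sup>2) \<partial>M) =
    (\<integral>\<^sup>+ \<omega>. (\<integral>\<^sup>+ s. ennreal ((simple_value m \<tau> \<xi> s \<omega> - simple_value m' \<tau>' \<xi>' s \<omega>)\<^sup>2)
       \<partial>(restrict_space lborel {a..b})) \<partial>M)"
proof -
  define I where "I = {..<m} <+> {..<m'}"
  define l where "l = case_sum \<tau> \<tau>'"
  define u where "u = case_sum (\<lambda>i. \<tau> (Suc i)) (\<lambda>i. \<tau>' (Suc i))"
  define \<zeta> where "\<zeta> = case_sum \<xi> (\<lambda>i \<omega>. - \<xi>' i \<omega>)"
  have mom: "all_moments M f" if f: "f \<in> borel_measurable (F t)" "0 \<le>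
      t" "bounded (f ` space M)" for f :: "'w \<Rightarrow> real" and t
  proof -
    obtain K where K: "\<And>\<omega>. \<omega> \<in> space M \<Longrightarrow> \<bar>f \<omega>\<bar> \<le> K"
      using f(3) by (auto simp: bounded_iff)
    show ?thesis
      by (rule all_moments_bound[OF all_moments_const[of K]])
        (use F_measurable[OF f(2,1)] K in \<open>auto intro!: AE_I2 order_trans[OF _ abs_ge_self]\<close>)
  qed
  have "(\<integral>\<^sup>+ \<omega>. ennreal ((\<Sum>i\<in>I. \<zeta> i \<omega> * inc (l i) (u i) \<omega>)\<^sup>2) \<partial>M) =
    (\<integral>\<^sup>+ \<omega>. (\<integral>\<^sup>+ s. ennreal ((\<Sum>i\<in>I. \<zeta> i \<omega> * indicator {l i<..u i} s)\<^sup>2) \<partial>(restrict_space lborel {a..b})) \<partial>M)"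
  proof (rule elementary_isometry)
    show "finite I" by (simp add: I_def)
    fix i assume i: "i \<in> I"
    show "0 \<le> l i \<and> l i \<le> u i \<and> {l i<..u i} \<subseteq> {a..b}"
    proof (cases i)
      case (Inl k)
      with i show ?thesis using simple_integrand_bounds[OF S1, of k] a by (auto simp: I_def l_def u_def)
    next
      case (Inr k)
      with i show ?thesis using simple_integrand_bounds[OF S2, of k] a by (auto simp: I_def l_def u_def)
    qed
    have *: "\<zeta> i \<in> borel_measurable (F (l i)) \<and> bounded (\<zeta> i ` space M) \<and> 0 \<le> l i"
    proof (cases i)
      case (Inl k)
      with i show ?thesis using simple_integrand_bounds[OF S1, of k] S1 a
        by (auto simp: I_def l_def \<zeta>_def simple_integrand_def)
    next
      case (Inr k)
      with i show ?thesis using simple_integrand_bounds[OF S2, of k] S2 a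
        by (auto simp: I_def l_def \<zeta>_def simple_integrand_def bounded_iff)
    qed
    then show "\<zeta> i \<in> borel_measurable (F (l i))" "all_moments M (\<zeta> i)"
      using mom[of "\<zeta> i" "l i"] by auto
  qed
  moreover have "(\<Sum>i\<in>I. \<zeta> i \<omega> * inc (l i) (u i) \<omega>) = simple_integral W m \<tau> \<xi> \<omega> - simple_integral W m' \<tau>'
      \<xi>' \<omega>" for \<omega>
    by (simp add: I_def sum.Plus l_def u_def \<zeta>_def simple_integral_def comp_def sum_negf mult.commute)
  moreover have "(\<Sum>i\<in>I. \<zeta> i \<omega> * indicator {l i<..u i} s) =
      simple_value m \<tau> \<xi> s \<omega> - simple_value m' \<tau>' \<xi>' s \<omega>" for \<omega> s
    by (simp only: I_def sum.Plus finite_lessThan l_def u_def \<zeta>_def simple_value_def comp_def sum.case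
        real_scaleR_def mult_minus_left sum_negf diff_conv_add_uminus mult.commute)
  ultimately show ?thesis by simp
qed

lemma simple_value_measurable:
  fixes \<xi> :: "nat \<Rightarrow> 'w \<Rightarrow> real"
  assumes "simple_integrand M F a b m \<tau> \<xi>" "0 \<le> a"
  shows "(\<lambda>(\<omega>, s). simple_value m \<tau> \<xi> s \<omega>) \<in> borel_measurable (M \<Otimes>\<^sub>M restrict_space lborel {a..b})"
proof -
  have [measurable]: "\<xi> i \<in> borel_measurable M" if "i \<in> {..<m}" for i
    using assms that simple_integrand_bounds[OF assms(1), of i] F_measurable[of "\<tau> i" "\<xi> i"]
    by (auto simp: simple_integrand_def)
  have [measurable]: "(\<lambda>s. indicator {\<tau> i<..\<tau> (Suc i)} s :: real) \<in> borel_measurable (restrict_space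
      lborel {a..b})" for i
    by (intro measurable_restrict_space1) simp
  show ?thesis unfolding simple_value_def split_beta' real_scaleR_def
    by measurable
qed

lemma simple_integral_measurable:
  fixes \<xi> :: "nat \<Rightarrow> 'w \<Rightarrow> real"
  assumes "simple_integrand M F a b m \<tau> \<xi>" "0 \<le> a"
  shows "simple_integral W m \<tau> \<xi> \<in> borel_measurable M"
proof -
  have "\<xi> i \<in> borel_measurable M \<and> inc (\<tau> i) (\<tau> (Suc i)) \<in> borel_measurable M" if "i < m" for i
    using assms that simple_integrand_bounds[OF assms(1), of i] F_measurable[of "\<tau> i" "\<xi> i"]
      all_moments_measurable[OF inc_all_moments[of "\<tau> i" "\<tau> (Suc i)"]]
    by (auto simp: simple_integrand_def)
  then show ?thesis unfolding simple_integral_def[abs_def] real_scaleR_def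
    by (intro borel_measurable_sum borel_measurable_times) auto
qed

text \<open>Two sequences of simple integrands with the same mean square limit have integrals with the same
  mean square limit; the defining sequence of an Ito integral can therefore be replaced by the left-point
  evaluations of a continuous bounded integrand.\<close>

lemma ito_integral_Riemann:
  fixes H :: "real \<Rightarrow> 'w \<Rightarrow> real"
  assumes I: "has_ito_integral M F W a b H I"
    and H: "\<And>s. s \<in> {a..b} \<Longrightarrow> H s \<in> borel_measurable (F s)"
    and K: "\<And>s \<omega>. s \<in> {a..b} \<Longrightarrow> \<omega> \<in> space M \<Longrightarrow> \<bar>H s \<omega>\<bar> \<le> K"
    and cont: "\<And>\<omega>. \<omega> \<in> space M \<Longrightarrow> continuous_on {a..b} (\<lambda>s. H s \<omega>)"
    and \<rho>: "\<And>n. \<rho> n 0 = a" "\<And>n. \<rho> n (k n) = b" "\<And>n i. i < k n \<Longrightarrow> \<rho> n i \<le> \<rho> n (Suc i)"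
    and mesh: "\<And>n i. i < k n \<Longrightarrow> \<rho> n (Suc i) - \<rho> n i \<le> \<delta> n" "\<delta> \<longlonglongrightarrow> 0"
  shows "L2_tendsto M (\<lambda>n. simple_integral W (k n) (\<rho> n) (\<lambda>i. H (\<rho> n i))) I"
proof -
  let ?L = "restrict_space lborel {a..b}"
  have a: "0 \<le> a" "a \<le> b" using I by (auto simp: has_ito_integral_def)
  have range: "\<rho> n i \<in> {a..b}" if "i \<le> k n" for n i
    using partition_mono[of "k n" "\<rho> n" 0 i] partition_mono[of "k n" "\<rho> n" i "k n"] \<rho> that by auto
  have S: "simple_integrand M F a b (k n) (\<rho> n) (\<lambda>i. H (\<rho> n i))" for n
    using \<rho> H K range by (auto simp: simple_integrand_def bounded_iff intro!: exI[of _ K])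
  have [measurable]: "I \<in> borel_measurable M" using I by (simp add: has_ito_integral_def)
  have Hm: "(\<lambda>(s, \<omega>). H s \<omega>) \<in> borel_measurable (?L \<Otimes>\<^sub>M M)" using I by (simp add: has_ito_integral_def)
  have [measurable]: "(\<lambda>(\<omega>, s). H s \<omega>) \<in> borel_measurable (M \<Otimes>\<^sub>M ?L)"
    using measurable_compose[OF measurable_pair_swap' Hm] by (simp add: split_beta')
  obtain m \<tau> \<xi> where S': "\<And>n. simple_integrand M F a b (m n) (\<tau> n) (\<xi> n)"
    and l1: "(\<lambda>n. \<integral>\<^sup>+ \<omega>. (\<integral>\<^sup>+ s. ennreal ((simple_value (m n) (\<tau> n) (\<xi> n) s \<omega> - H s \<omega>)\<^sup>2) \<partial>?L) \<partial>M) \<longlonglongrightarrow> 0"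
    and l2: "(\<lambda>n. \<integral>\<^sup>+ \<omega>. ennreal ((simple_integral W (m n) (\<tau> n) (\<xi> n) \<omega> - I \<omega>)\<^sup>2) \<partial>M) \<longlonglongrightarrow> 0"
    using I by (auto simp: has_ito_integral_def)
  have sf: "sigma_finite_measure ?L" by (rule sigma_finite_measure_restrict_space) (auto simp: sigma_finite_lborel)
  interpret L: sigma_finite_measure ?L by (rule sf)
  define V where "V n s \<omega> = simple_value (k n) (\<rho> n) (\<lambda>i. H (\<rho> n i)) s \<omega>" for n s \<omega>
  define V' where "V' n s \<omega> = simple_value (m n) (\<tau> n) (\<xi> n) s \<omega>" for n s \<omega>
  have [measurable]: "(\<lambda>(\<omega>, s). V n s \<omega>) \<in> borel_measurable (M \<Otimes>\<^sub>M ?L)"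
    "(\<lambda>(\<omega>, s). V' n s \<omega>) \<in> borel_measurable (M \<Otimes>\<^sub>M ?L)" for n
    unfolding V_def V'_def by (rule simple_value_measurable[OF S a(1)] simple_value_measurable[OF S' a(1)])+
  have V_eq: "\<exists>i<k n. s \<in> {\<rho> n i<..\<rho> n (Suc i)} \<and> V n s \<omega> = H (\<rho> n i) \<omega>" if "a < s" "s \<le> b" for n s \<omega>
    using partition_interval_exists[of "\<rho> n" s "k n"] simple_value_eq[of "k n" "\<rho> n"] \<rho> that unfolding
        V_def by metis
  have V_bound: "\<bar>V n s \<omega> - H s \<omega>\<bar> \<le> 2 * K" if s: "a < s" "s \<le> b" "\<omega> \<in> space M" for n s \<omega>
  proof -
    obtain i where i: "i < k n" "V n s \<omega> = H (\<rho> n i) \<omega>" using V_eq[OF s(1,2)] by blast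
    have "\<bar>H (\<rho> n i) \<omega>\<bar> \<le> K" "\<bar>H s \<omega>\<bar> \<le> K" using K[OF range[of i n] s(3)] K[of s \<omega>] i s by auto
    then show ?thesis using i by linarith
  qed
  have V_lim: "(\<lambda>n. V n s \<omega>) \<longlonglongrightarrow> H s \<omega>" if s: "a < s" "s \<le> b" "\<omega> \<in> space M" for s \<omega>
  proof (rule LIMSEQ_I)
    fix e :: real assume "e > 0"
    then obtain d where d: "d > 0" "\<And>r. r \<in> {a..b} \<Longrightarrow> dist r s < d \<Longrightarrow> dist (H r \<omega>) (H s \<omega>) < e"
      using cont[OF s(3)] s unfolding continuous_on_iff by (metis atLeastAtMost_iff less_imp_le)
    obtain N where N: "\<And>n. n \<ge> N \<Longrightarrow> \<delta> n < d"
      using order_tendstoD(2)[OF mesh(2) d(1)] by (auto simp: eventually_sequentially)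
    have "norm (V n s \<omega> - H s \<omega>) < e" if "n \<ge> N" for n
    proof -
      obtain i where i: "i < k n" "s \<in> {\<rho> n i<..\<rho> n (Suc i)}" "V n s \<omega> =
          H (\<rho> n i) \<omega>" using V_eq[OF s(1,2)] by blast
      have "dist (\<rho> n i) s < d" using mesh(1)[OF i(1)] N[OF that] i(2) by (auto simp: dist_real_def)
      then show ?thesis using d(2)[of "\<rho> n i"] range[of i n] i by (simp add: dist_real_def)
    qed
    then show "\<exists>N. \<forall>n\<ge>N. norm (V n s \<omega> - H s \<omega>) < e" by blast
  qed
  have AE_gt: "AE s in ?L. a < s \<and> s \<le> b"
    by (subst AE_restrict_space_iff) (use AE_lborel_singleton[of a] in auto)
  have fin: "(\<integral>\<^sup>+ s. ennreal ((2 * K)\<^sup>2) \<partial>?L) < \<infinity>"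
    using a by (simp add: emeasure_restrict_space space_restrict_space ennreal_mult_less_top)
  have inner: "(\<lambda>n. \<integral>\<^sup>+ s. ennreal ((V n s \<omega> - H s \<omega>)\<^sup>2) \<partial>?L) \<longlonglongrightarrow> 0" if \<omega>: "\<omega> \<in> space M" for \<omega>
  proof -
    have "(\<lambda>n. \<integral>\<^sup>+ s. ennreal ((V n s \<omega> - H s \<omega>)\<^sup>2) \<partial>?L) \<longlonglongrightarrow> (\<integral>\<^sup>+ s. 0 \<partial>?L)"
    proof (rule nn_integral_dominated_convergence[where w = "\<lambda>s. ennreal ((2 * K)\<^sup>2)"])
      show "AE s in ?L. ennreal ((V n s \<omega> - H s \<omega>)\<^sup>2) \<le> ennreal ((2 * K)\<^sup>2)" for n
        using AE_gt
      proof eventually_elim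
        case (elim s)
        then have "\<bar>V n s \<omega> - H s \<omega>\<bar> \<le> \<bar>2 * K\<bar>" using V_bound[of s \<omega> n] \<omega> by auto
        then show ?case by (intro ennreal_leI) (simp add: abs_le_square_iff)
      qed
      show "AE s in ?L. (\<lambda>n. ennreal ((V n s \<omega> - H s \<omega>)\<^sup>2)) \<longlonglongrightarrow> 0"
        using AE_gt
      proof eventually_elim
        case (elim s)
        have "(\<lambda>n. ennreal ((V n s \<omega> - H s \<omega>)\<^sup>2)) \<longlonglongrightarrow> ennreal ((H s \<omega> - H s \<omega>)\<^sup>2)"
          using elim \<omega> by (intro tendsto_ennrealI tendsto_intros V_lim) auto
        then show ?case by simp
      qed
    qed (use \<omega> fin in \<open>auto\<close>)
    then show ?thesis by simp
  qed
  have outer: "(\<lambda>n. \<integral>\<^sup>+ \<omega>. (\<integral>\<^sup>+ s. ennreal ((V n s \<omega> - H s \<omega>)\<^sup>2) \<partial>?L) \<partial>M) \<longlonglongrightarrow> 0"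
  proof -
    have "(\<lambda>n. \<integral>\<^sup>+ \<omega>. (\<integral>\<^sup>+ s. ennreal ((V n s \<omega> - H s \<omega>)\<^sup>2) \<partial>?L) \<partial>M) \<longlonglongrightarrow> (\<integral>\<^sup>+ \<omega>. 0 \<partial>M)"
    proof (rule nn_integral_dominated_convergence[where w = "\<lambda>\<omega>. \<integral>\<^sup>+ s. ennreal ((2 * K)\<^sup>2) \<partial>?L"])
      show "AE \<omega> in M. (\<integral>\<^sup>+ s. ennreal ((V n s \<omega> - H s \<omega>)\<^sup>2) \<partial>?L) \<le> (\<integral>\<^sup>+ s. ennreal ((2 * K)\<^sup>2) \<partial>?L)" for n
      proof (rule AE_I2, rule nn_integral_mono_AE)
        fix \<omega> assume \<omega>: "\<omega> \<in> space M"
        show "AE s in ?L. ennreal ((V n s \<omega> - H s \<omega>)\<^sup>2) \<le> ennreal ((2 * K)\<^sup>2)"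
          using AE_gt
        proof eventually_elim
          case (elim s)
          then have "\<bar>V n s \<omega> - H s \<omega>\<bar> \<le> \<bar>2 * K\<bar>" using V_bound[of s \<omega> n] \<omega> by auto
          then show ?case by (intro ennreal_leI) (simp add: abs_le_square_iff)
        qed
      qed
      show "(\<integral>\<^sup>+ \<omega>. (\<integral>\<^sup>+ s. ennreal ((2 * K)\<^sup>2) \<partial>?L) \<partial>M) < \<infinity>"
        using fin by (simp add: emeasure_space_1)
      show "AE \<omega> in M. (\<lambda>n. \<integral>\<^sup>+ s. ennreal ((V n s \<omega> - H s \<omega>)\<^sup>2) \<partial>?L) \<longlonglongrightarrow> 0"
        using inner by (intro AE_I2)
    qed measurable
    then show ?thesis by simp
  qed
  have "(\<lambda>n. \<integral>\<^sup>+ \<omega>. ennreal ((simple_integral W (k n) (\<rho> n) (\<lambda>i. H (\<rho> n i)) \<omega> - I \<omega>)\<^sup>2) \<partial>M) \<longlonglongrightarrow> 0"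
  proof (rule tendsto_0_le)
    let ?A = "\<lambda>n \<omega>. simple_integral W (k n) (\<rho> n) (\<lambda>i. H (\<rho> n i)) \<omega>"
    let ?A' = "\<lambda>n \<omega>. simple_integral W (m n) (\<tau> n) (\<xi> n) \<omega>"
    let ?e = "\<lambda>n. 2 * (\<integral>\<^sup>+ \<omega>. (\<integral>\<^sup>+ s. ennreal ((V n s \<omega> - H s \<omega>)\<^sup>2) \<partial>?L) \<partial>M)
        + 2 * (\<integral>\<^sup>+ \<omega>. (\<integral>\<^sup>+ s. ennreal ((V' n s \<omega> - H s \<omega>)\<^sup>2) \<partial>?L) \<partial>M)"
    show "(\<lambda>n. 2 * ?e n + 2 * (\<integral>\<^sup>+ \<omega>. ennreal ((?A' n \<omega> - I \<omega>)\<^sup>2) \<partial>M)) \<longlonglongrightarrow> 0"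
      using outer l1 l2 by (intro tendsto_0_two_sum) (auto simp: V'_def)
    show "(\<integral>\<^sup>+ \<omega>. ennreal ((?A n \<omega> - I \<omega>)\<^sup>2) \<partial>M) \<le> 2 * ?e n + 2 * (\<integral>\<^sup>+ \<omega>. ennreal ((?A' n \<omega> - I \<omega>)\<^sup>2) \<partial>M)" for n
    proof -
      note [measurable] = simple_integral_measurable[OF S a(1), of n] simple_integral_measurable[OF S' a(1), of n]
      have "(\<integral>\<^sup>+ \<omega>. ennreal ((?A n \<omega> - I \<omega>)\<^sup>2) \<partial>M) \<le>
        2 * (\<integral>\<^sup>+ \<omega>. ennreal ((?A n \<omega> - ?A' n \<omega>)\<^sup>2) \<partial>M) + 2 * (\<integral>\<^sup>+ \<omega>. ennreal ((?A' n \<omega> - I \<omega>)\<^sup>2) \<partial>M)"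
        using nn_integral_square_add_le[of "\<lambda>\<omega>. ?A n \<omega> - ?A' n \<omega>" M "\<lambda>\<omega>. ?A' n \<omega> - I \<omega>"] by simp
      also have "(\<integral>\<^sup>+ \<omega>. ennreal ((?A n \<omega> - ?A' n \<omega>)\<^sup>2) \<partial>M) = (\<integral>\<^sup>+ \<omega>. (\<integral>\<^sup>+ s. ennreal ((V n s \<omega> - V' n s \<omega>)\<^sup>2) \<partial>?L) \<partial>M)"
        unfolding V_def V'_def by (rule simple_isometry[OF S S' a(1)])
      also have "\<dots> \<le> (\<integral>\<^sup>+ \<omega>. 2 * (\<integral>\<^sup>+ s. ennreal ((V n s \<omega> - H s \<omega>)\<^sup>2) \<partial>?L)
          + 2 * (\<integral>\<^sup>+ s. ennreal ((V' n s \<omega> - H s \<omega>)\<^sup>2) \<partial>?L) \<partial>M)"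
      proof (rule nn_integral_mono)
        fix \<omega> assume [measurable]: "\<omega> \<in> space M"
        show "(\<integral>\<^sup>+ s. ennreal ((V n s \<omega> - V' n s \<omega>)\<^sup>2) \<partial>?L) \<le>
          2 * (\<integral>\<^sup>+ s. ennreal ((V n s \<omega> - H s \<omega>)\<^sup>2) \<partial>?L) + 2 * (\<integral>\<^sup>+ s. ennreal ((V' n s \<omega> - H s \<omega>)\<^sup>2) \<partial>?L)"
          using nn_integral_square_add_le[of "\<lambda>s. V n s \<omega> - H s \<omega>" ?L "\<lambda>s. H s \<omega> - V' n s \<omega>"]
          by (simp add: power2_commute[of "H _ _"])
      qed
      also have "\<dots> = ?e n" by (subst nn_integral_add) (auto simp: nn_integral_cmult)
      finally show ?thesis by (simp add: add_right_mono mult_left_mono)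
    qed
  qed
  then show ?thesis using simple_integral_measurable[OF S a(1)] by (simp add: L2_tendsto_def)
qed

end

section \<open>Time integrals of continuous processes\<close>

definition grid :: "real \<Rightarrow> real \<Rightarrow> nat \<Rightarrow> nat \<Rightarrow> real"
  where "grid a b N i = a + (b - a) * real i / real N"

lemma grid_0 [simp]: "grid a b N 0 = a"
  by (simp add: grid_def)

lemma grid_N [simp]: "N > 0 \<Longrightarrow> grid a b N N = b"
  by (simp add: grid_def)

lemma grid_step: "N > 0 \<Longrightarrow> grid a b N (Suc i) - grid a b N i = (b - a) / real N"
  by (simp add: grid_def field_simps)

lemma grid_range:
  assumes "a \<le> b" "i \<le> N"
  shows "grid a b N i \<in> {a..b}"
proof (cases "N = 0")
  case False
  have "(b - a) * real i \<le> (b - a) * real N" "0 \<le> (b - a) * real i"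
    using assms by (auto intro: mult_left_mono)
  then have "0 \<le> (b - a) * real i / real N" "(b - a) * real i / real N \<le> b - a"
    using False by (simp_all add: field_simps)
  then show ?thesis by (simp add: grid_def)
qed (use assms in \<open>simp add: grid_def\<close>)

lemma grid_mono: "a \<le> b \<Longrightarrow> i \<le> j \<Longrightarrow> grid a b N i \<le> grid a b N j"
  by (auto simp: grid_def intro!: divide_right_mono mult_left_mono)

lemma mesh_tendsto_0: "(\<lambda>n. c / real (Suc n)) \<longlonglongrightarrow> 0"
  using tendsto_mult[OF tendsto_const[of c] LIMSEQ_inverse_real_of_nat] by (simp add: divide_inverse)

lemma Riemann_sum_error:
  fixes f :: "real \<Rightarrow> real"
  assumes ab: "a \<le> b" and N: "N > 0" and cont: "continuous_on {a..b} f"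
    and e: "\<And>u v. u \<in> {a..b} \<Longrightarrow> v \<in> {a..b} \<Longrightarrow> \<bar>u - v\<bar> \<le> (b - a) / real N \<Longrightarrow> \<bar>f u - f v\<bar> \<le> e"
  shows "k \<le> N \<Longrightarrow> \<bar>integral {a..grid a b N k} f - (\<Sum>i<k. (b - a) / real N * f (grid a b N i))\<bar> \<le>
      e * (grid a b N k - a)"
proof (induction k)
  case (Suc k)
  let ?g = "grid a b N"
  have g: "a \<le> ?g k" "?g k \<le> ?g (Suc k)" "?g (Suc k) \<le> b"
    using grid_range[OF ab, of k N] grid_range[OF ab, of "Suc k" N] grid_mono[OF ab, of k "Suc k"] Suc by auto
  have int: "f integrable_on {u..v}" if "a \<le> u" "v \<le> b" for u v
    using cont that by (intro integrable_continuous_real) (auto intro: continuous_on_subset)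
  have split: "integral {a..?g (Suc k)} f = integral {a..?g k} f + integral {?g k..?g (Suc k)} f"
    using g int by (intro Henstock_Kurzweil_Integration.integral_combine[symmetric]) auto
  have "integral {?g k..?g (Suc k)} f - (b - a) / real N * f (?g k) =
      integral {?g k..?g (Suc k)} (\<lambda>v. f v - f (?g k))"
    using g grid_step[OF N, of a b k] int by (subst Henstock_Kurzweil_Integration.integral_diff) auto
  also have "\<bar>\<dots>\<bar> \<le> e * (?g (Suc k) - ?g k)"
  proof -
    have "norm (integral {?g k..?g (Suc k)} (\<lambda>v. f v - f (?g k))) \<le> e * (?g (Suc k) - ?g k)"
    proof (rule integral_bound[OF g(2)])
      show "continuous_on {?g k..?g (Suc k)} (\<lambda>v. f v - f (?g k))"
        using g by (intro continuous_intros continuous_on_subset[OF cont]) auto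
      show "norm (f v - f (?g k)) \<le> e" if "v \<in> {?g k..?g (Suc k)}" for v
        using that g grid_step[OF N, of a b k] e[of v "?g k"] by auto
    qed
    then show ?thesis by simp
  qed
  finally have "\<bar>integral {?g k..?g (Suc k)} f - (b - a) / real N * f (?g k)\<bar> \<le> e * (?g (Suc k) - ?g k)" .
  moreover have "\<bar>integral {a..?g k} f - (\<Sum>i<k. (b - a) / real N * f (?g i))\<bar> \<le> e * (?g k - a)"
    using Suc by simp
  ultimately show ?case unfolding split by (simp add: algebra_simps) 
qed simp

lemma Riemann_sums_tendsto:
  fixes f :: "real \<Rightarrow> real"
  assumes ab: "a \<le> b" and cont: "continuous_on {a..b} f"
  shows "(\<lambda>n. \<Sum>i<Suc n. (b - a) / real (Suc n) * f (grid a b (Suc n) i)) \<longlonglongrightarrow> integral {a..b} f"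
proof (rule LIMSEQ_I)
  fix r :: real assume r: "r > 0"
  define e where "e = r / (b - a + 1)"
  have e: "e > 0" using r ab by (simp add: e_def)
  have "uniformly_continuous_on {a..b} f"
    using cont by (intro compact_uniformly_continuous) auto
  then obtain d where d: "d > 0" "\<And>u v. u \<in> {a..b} \<Longrightarrow> v \<in> {a..b} \<Longrightarrow> dist u v < d \<Longrightarrow> dist (f u) (f v) < e"
    using e unfolding uniformly_continuous_on_def by metis
  obtain n0 where n0: "\<And>n. n \<ge> n0 \<Longrightarrow> (b - a) / real (Suc n) < d"
    using order_tendstoD(2)[OF mesh_tendsto_0 d(1)] by (auto simp: eventually_sequentially)
  have "norm ((\<Sum>i<Suc n. (b - a) / real (Suc n) * f (grid a b (Suc n) i)) - integral {a..b} f) < r" if n: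
      "n \<ge> n0" for n
  proof -
    have bound: "\<bar>f u - f v\<bar> \<le> e" if "u \<in> {a..b}" "v \<in> {a..b}" "\<bar>u - v\<bar> \<le> (b - a) / real (Suc n)" for u v
      using d(2)[OF that(1,2)] that(3) n0[OF n] by (simp add: dist_real_def)
    have "\<bar>integral {a..b} f - (\<Sum>i<Suc n. (b - a) / real (Suc n) * f (grid a b (Suc n) i))\<bar> \<le> e * (b - a)"
      using Riemann_sum_error[OF ab _ cont, of "Suc n" e "Suc n"] bound by simp
    also have "\<dots> < e * (b - a + 1)" using e by simp
    also have "\<dots> = r" using ab by (simp add: e_def)
    finally show ?thesis by (simp add: abs_minus_commute)
  qed
  then show "\<exists>n0. \<forall>n\<ge>n0. norm ((\<Sum>i<Suc n. (b - a) / real (Suc n) * f (grid a b (Suc n) i)) - integral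
      {a..b} f) < r"
    by blast
qed

lemma time_integral_measurable:
  fixes f :: "real \<Rightarrow> 'w \<Rightarrow> real"
  assumes "a \<le> b" and "\<And>v. v \<in> {a..b} \<Longrightarrow> f v \<in> borel_measurable N"
    and "\<And>\<omega>. \<omega> \<in> space N \<Longrightarrow> continuous_on {a..b} (\<lambda>v. f v \<omega>)"
  shows "(\<lambda>\<omega>. integral {a..b} (\<lambda>v. f v \<omega>)) \<in> borel_measurable N"
proof (rule borel_measurable_LIMSEQ_real)
  show "(\<lambda>n. \<Sum>i<Suc n. (b - a) / real (Suc n) * f (grid a b (Suc n) i) \<omega>) \<longlonglongrightarrow> integral {a..b} (\<lambda>v. f v \<omega>)"
    if "\<omega> \<in> space N" for \<omega>
    using assms that by (intro Riemann_sums_tendsto)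
  show "(\<lambda>\<omega>. \<Sum>i<Suc n. (b - a) / real (Suc n) * f (grid a b (Suc n) i) \<omega>) \<in> borel_measurable N" for n
    using assms grid_range[OF assms(1)] by (intro borel_measurable_sum borel_measurable_times) auto
qed

text \<open>Convexity gives the bound for the Riemann sums and Fatou's lemma for the integral.\<close>

lemma (in prob_space) time_integral_moments:
  fixes f :: "real \<Rightarrow> 'a \<Rightarrow> real"
  assumes ab: "a \<le> b" and f: "\<And>v. v \<in> {a..b} \<Longrightarrow> all_moments M (f v)"
    and cont: "\<And>\<omega>. \<omega> \<in> space M \<Longrightarrow> continuous_on {a..b} (\<lambda>v. f v \<omega>)"
    and K: "\<And>v q. v \<in> {a..b} \<Longrightarrow> q \<ge> 1 \<Longrightarrow> even_moment q (f v) \<le> K q"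
  shows "all_moments M (\<lambda>\<omega>. integral {a..b} (\<lambda>v. f v \<omega>))"
    and "q \<ge> 1 \<Longrightarrow> even_moment q (\<lambda>\<omega>. integral {a..b} (\<lambda>v. f v \<omega>)) \<le> (b - a) ^ (2 * q) * K q"
proof -
  define R where "R n \<omega> = (\<Sum>i<Suc n. (b - a) / real (Suc n) * f (grid a b (Suc n) i) \<omega>)" for n \<omega>
  have fg: "all_moments M (f (grid a b (Suc n) i))" if "i < Suc n" for n i
    using grid_range[OF ab, of i "Suc n"] that by (intro f) auto
  have R: "all_moments M (R n)" for n
    unfolding R_def[abs_def] using fg by (intro all_moments_sum all_moments_mult all_moments_const) auto
  have lim: "AE \<omega> in M. (\<lambda>n. R n \<omega>) \<longlonglongrightarrow> integral {a..b} (\<lambda>v. f v \<omega>)"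
    unfolding R_def using ab cont by (intro AE_I2 Riemann_sums_tendsto)
  have meas: "(\<lambda>\<omega>. integral {a..b} (\<lambda>v. f v \<omega>)) \<in> borel_measurable M"
    using ab cont by (intro time_integral_measurable all_moments_measurable f)
  have bound: "even_moment q (R n) \<le> (b - a) ^ (2 * q) * K q" if q: "q \<ge> 1" for n q
  proof -
    define \<delta> where "\<delta> = (b - a) / real (Suc n)"
    have "even_moment q (R n) \<le> real (card {..<Suc n}) ^ (2 * q) * (\<delta> ^ (2 * q) * K q)"
      unfolding R_def \<delta>_def[symmetric]
    proof (rule sum_even_moment_le[OF _ _ q])
      fix i assume i: "i \<in> {..<Suc n}"
      show "all_moments M (\<lambda>\<omega>. \<delta> * f (grid a b (Suc n) i) \<omega>)"
        using i fg by (intro all_moments_cmult) auto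
      have "\<delta> ^ (2 * q) * even_moment q (f (grid a b (Suc n) i)) \<le> \<delta> ^ (2 * q) * K q"
        using q i grid_range[OF ab, of i "Suc n"] by (intro mult_left_mono K zero_le_even_power) auto
      then show "even_moment q (\<lambda>\<omega>. \<delta> * f (grid a b (Suc n) i) \<omega>) \<le> \<delta> ^ (2 * q) * K q"
        by (simp add: power_mult_distrib)
    qed simp
    also have "\<dots> = (real (Suc n) * \<delta>) ^ (2 * q) * K q"
      by (simp only: card_lessThan power_mult_distrib mult.assoc)
    also have "real (Suc n) * \<delta> = b - a" by (simp add: \<delta>_def del: of_nat_Suc)
    finally show ?thesis .
  qed
  show "all_moments M (\<lambda>\<omega>. integral {a..b} (\<lambda>v. f v \<omega>))"
    by (rule Fatou_moments(1)[OF R meas lim bound])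
  show "even_moment q (\<lambda>\<omega>. integral {a..b} (\<lambda>v. f v \<omega>)) \<le> (b - a) ^ (2 * q) * K q" if "q \<ge> 1"
    by (rule Fatou_moments(2)[OF R meas lim bound that])
qed

text \<open>A mean square Cauchy sequence converges to its almost sure limit: Fatou's lemma in the second index.\<close>

lemma L2_tendsto_Cauchy:
  assumes [measurable]: "\<And>n. f n \<in> borel_measurable M" "g \<in> borel_measurable M"
    and lim: "AE \<omega> in M. (\<lambda>n. f n \<omega>) \<longlonglongrightarrow> g \<omega>"
    and e: "\<And>n m. (\<integral>\<^sup>+ \<omega>. ennreal ((f n \<omega> - f m \<omega>)\<^sup>2) \<partial>M) \<le> 2 * e n + 2 * e m" "e \<longlonglongrightarrow> 0"
  shows "L2_tendsto M f g"
proof -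
  have "(\<lambda>n. \<integral>\<^sup>+ \<omega>. ennreal ((f n \<omega> - g \<omega>)\<^sup>2) \<partial>M) \<longlonglongrightarrow> 0"
  proof (rule tendsto_0_le)
    show "(\<lambda>n. 2 * e n + 2 * 0) \<longlonglongrightarrow> 0"
      by (rule tendsto_0_two_sum[OF e(2) tendsto_const])
    fix n
    have "(\<integral>\<^sup>+ \<omega>. ennreal ((f n \<omega> - g \<omega>)\<^sup>2) \<partial>M) = (\<integral>\<^sup>+ \<omega>. liminf (\<lambda>m. ennreal ((f n \<omega> - f m \<omega>)\<^sup>2)) \<partial>M)"
    proof (rule nn_integral_cong_AE, use lim in eventually_elim)
      case (elim \<omega>)
      then have "(\<lambda>m. ennreal ((f n \<omega> - f m \<omega>)\<^sup>2)) \<longlonglongrightarrow> ennreal ((f n \<omega> - g \<omega>)\<^sup>2)"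
        by (intro tendsto_ennrealI tendsto_intros)
      from lim_imp_Liminf[OF trivial_limit_sequentially this] show ?case by simp
    qed
    also have "\<dots> \<le> liminf (\<lambda>m. \<integral>\<^sup>+ \<omega>. ennreal ((f n \<omega> - f m \<omega>)\<^sup>2) \<partial>M)"
      by (rule nn_integral_liminf) measurable
    also have "\<dots> \<le> liminf (\<lambda>m. 2 * e n + 2 * e m)"
      by (intro Liminf_mono always_eventually allI e)
    also have "\<dots> = 2 * e n + 2 * 0"
      by (intro lim_imp_Liminf tendsto_add tendsto_const ennreal_tendsto_cmult e) auto
    finally show "(\<integral>\<^sup>+ \<omega>. ennreal ((f n \<omega> - g \<omega>)\<^sup>2) \<partial>M) \<le> 2 * e n + 2 * 0" .
  qed
  then show ?thesis by (simp add: L2_tendsto_def)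
qed

context wiener
begin

definition area :: "real \<Rightarrow> real \<Rightarrow> 'w \<Rightarrow> real"
  where "area s t \<omega> = integral {s..t} (\<lambda>v. inc s v \<omega>)"

lemma inc_continuous: "0 \<le> s \<Longrightarrow> \<omega> \<in> space M \<Longrightarrow> continuous_on {s..t} (\<lambda>v. inc s v \<omega>)"
  by (intro continuous_intros continuous_on_subset[OF continuous_path]) auto

lemma area_adapted: "0 \<le> s \<Longrightarrow> s \<le> t \<Longrightarrow> area s t \<in> borel_measurable (F t)"
  unfolding area_def[abs_def]
  by (intro time_integral_measurable inc_adapted inc_continuous) (auto simp: space_F)

lemma area_moments:
  assumes "0 \<le> s" "s \<le> t"
  shows "all_moments M (area s t)"
    and "q \<ge> 1 \<Longrightarrow> even_moment q (area s t) \<le> gauss_moment q * (t - s) ^ (3 * q)"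
proof -
  have K: "even_moment q (inc s v) \<le> gauss_moment q * (t - s) ^ q" if "v \<in> {s..t}" for v q
    using that assms by (subst inc_even_moment) (auto intro!: mult_left_mono power_mono gauss_moment_nonneg)
  have a: "all_moments M (inc s v)" if "v \<in> {s..t}" for v
    using assms that by (intro inc_all_moments) auto
  show "all_moments M (area s t)" unfolding area_def[abs_def]
    by (rule time_integral_moments(1)[OF assms(2) a inc_continuous[OF assms(1)] K])
  show "even_moment q (area s t) \<le> gauss_moment q * (t - s) ^ (3 * q)" if "q \<ge> 1"
  proof -
    have "even_moment q (area s t) \<le> (t - s) ^ (2 * q) * (gauss_moment q * (t - s) ^ q)"
      unfolding area_def by (rule time_integral_moments(2)[OF assms(2) a inc_continuous[OF assms(1)] K that])
    also have "\<dots> = gauss_moment q * (t - s) ^ (2 * q + q)" by (simp only: power_add mult_ac)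
    finally show ?thesis by simp
  qed
qed

text \<open>Integration by parts gives the stochastic integral of the elapsed time in closed form; the left-point
  sums converge to it along every path, and in mean square by the isometry.\<close>

lemma has_ito_integral_time:
  assumes st: "0 \<le> s" "s \<le> t"
  shows "has_ito_integral M F W s t (\<lambda>v _. integral {s..v} (\<lambda>u. 1::real)) (\<lambda>\<omega>. (t - s) * inc s t \<omega> - area s t \<omega>)"
proof -
  let ?L = "restrict_space lborel {s..t}"
  define J where "J \<omega> = (t - s) * inc s t \<omega> - area s t \<omega>" for \<omega>
  have H: "integral {s..v} (\<lambda>u. 1::real) = max 0 (v - s)" for v by (simp add: max_def)
  have [measurable]: "J \<in> borel_measurable M" unfolding J_def[abs_def]
    using all_moments_measurable[OF area_moments(1)[OF st]] all_moments_measurable[OF inc_all_moments[OF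
        st]] by simp
  define \<tau> where "\<tau> n = grid s t (Suc n)" for n
  define \<xi> where "\<xi> n i = (\<lambda>\<omega>::'w. \<tau> n i - s)" for n i
  define \<delta> where "\<delta> n = (t - s) / real (Suc n)" for n
  have S: "simple_integrand M F s t (Suc n) (\<tau> n) (\<xi> n)" for n
    using grid_mono[OF st(2), of _ _ "Suc n"]
    by (auto simp: simple_integrand_def \<tau>_def \<xi>_def bounded_iff)
  have V: "\<bar>simple_value (Suc n) (\<tau> n) (\<xi> n) v \<omega> - max 0 (v - s)\<bar> \<le> \<delta> n" if "v \<in> {s..t}" "v \<noteq> s" for n v \<omega>
  proof -
    have "\<exists>i<Suc n. v \<in> {\<tau> n i<..\<tau> n (Suc i)}"
      using that by (intro partition_interval_exists) (auto simp: \<tau>_def)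
    then obtain i where i: "i < Suc n" "v \<in> {\<tau> n i<..\<tau> n (Suc i)}" by blast
    have "simple_value (Suc n) (\<tau> n) (\<xi> n) v \<omega> = \<tau> n i - s"
      using S[of n] i simple_value_eq[of "Suc n" "\<tau> n" i v "\<xi> n" \<omega>] by (auto simp: simple_integrand_def \<xi>_def)
    then show ?thesis using i that grid_step[of "Suc n" s t i] by (simp add: \<tau>_def \<delta>_def)
  qed
  have AE_ne: "AE v in ?L. v \<in> {s..t} \<and> v \<noteq> s"
    by (subst AE_restrict_space_iff) (use AE_lborel_singleton[of s] in auto)
  define e where "e n = ennreal ((\<delta> n)\<^sup>2 * (t - s))" for n
  have e0: "e \<longlonglongrightarrow> 0"
  proof -
    have "(\<lambda>n. (\<delta> n)\<^sup>2 * (t - s)) \<longlonglongrightarrow> 0\<^sup>2 * (t - s)"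
      unfolding \<delta>_def by (intro tendsto_intros mesh_tendsto_0)
    then show ?thesis unfolding e_def using tendsto_ennrealI by fastforce
  qed
  have const: "(\<integral>\<^sup>+ v. ennreal ((\<delta> n)\<^sup>2) \<partial>?L) = e n" for n
    using st by (simp add: emeasure_restrict_space space_restrict_space e_def ennreal_mult)
  have app: "(\<integral>\<^sup>+ \<omega>. (\<integral>\<^sup>+ v. ennreal ((simple_value (Suc n) (\<tau> n) (\<xi> n) v \<omega> - max 0 (v - s))\<^sup>2) \<partial>?L) \<partial>M) \<le> e n" for n
  proof -
    have "(\<integral>\<^sup>+ \<omega>. (\<integral>\<^sup>+ v. ennreal ((simple_value (Suc n) (\<tau> n) (\<xi> n) v \<omega> - max 0 (v - s))\<^sup>2) \<partial>?L) \<partial>M)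
      \<le> (\<integral>\<^sup>+ \<omega>. (\<integral>\<^sup>+ v. ennreal ((\<delta> n)\<^sup>2) \<partial>?L) \<partial>M)"
    proof (rule nn_integral_mono, rule nn_integral_mono_AE)
      fix \<omega>
      show "AE v in ?L. ennreal ((simple_value (Suc n) (\<tau> n) (\<xi> n) v \<omega> - max 0 (v - s))\<^sup>2) \<le> ennreal ((\<delta> n)\<^sup>2)"
        using AE_ne
      proof eventually_elim
        case (elim v)
        then have "\<bar>simple_value (Suc n) (\<tau> n) (\<xi> n) v \<omega> - max 0 (v - s)\<bar> \<le> \<bar>\<delta> n\<bar>"
          using V[of v n \<omega>] by linarith
        then show ?case by (intro ennreal_leI) (simp only: abs_le_square_iff)
      qed
    qed
    also have "\<dots> = e n" unfolding const by (simp add: emeasure_space_1)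
    finally show ?thesis .
  qed
  have "L2_tendsto M (\<lambda>n. simple_integral W (Suc n) (\<tau> n) (\<xi> n)) J"
  proof (rule L2_tendsto_Cauchy[OF _ _ _ _ e0])
    show "simple_integral W (Suc n) (\<tau> n) (\<xi> n) \<in> borel_measurable M" for n
      by (rule simple_integral_measurable[OF S st(1)])
    show "AE \<omega> in M. (\<lambda>n. simple_integral W (Suc n) (\<tau> n) (\<xi> n) \<omega>) \<longlonglongrightarrow> J \<omega>"
    proof (rule AE_I2)
      fix \<omega> assume \<omega>: "\<omega> \<in> space M"
      have parts: "(\<Sum>i<k. inc (\<tau> n i) (\<tau> n (Suc i)) \<omega> * (\<tau> n i - s)) =
          (\<tau> n k - s) * inc s (\<tau> n k) \<omega> - \<delta> n * inc s (\<tau> n k) \<omega> - (\<Sum>i<k. \<delta> n * inc s (\<tau> n i) \<omega>)" for k n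
      proof (induction k)
        case (Suc k)
        have st: "\<tau> n (Suc k) = \<tau> n k + \<delta> n" using grid_step[of "Suc n" s t k] by (simp add: \<tau>_def \<delta>_def)
        show ?case using Suc by (simp add: st algebra_simps)
      qed (simp add: \<tau>_def)
      have "simple_integral W (Suc n) (\<tau> n) (\<xi> n) \<omega> =
         (t - s) * inc s t \<omega> - \<delta> n * inc s t \<omega> - (\<Sum>i<Suc n. \<delta> n * inc s (grid s t (Suc n) i) \<omega>)" for n
      proof -
        have "(\<Sum>i<Suc n. inc (\<tau> n i) (\<tau> n (Suc i)) \<omega> * (\<tau> n i - s)) =
          (\<tau> n (Suc n) - s) * inc s (\<tau> n (Suc n)) \<omega> - \<delta> n * inc s (\<tau> n (Suc n)) \<omega> - (\<Sum>i<Suc n. \<delta> n * inc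
              s (\<tau> n i) \<omega>)"
          by (rule parts)
        then show ?thesis by (simp add: simple_integral_def \<xi>_def \<tau>_def del: sum.lessThan_Suc)
      qed
      moreover have "(\<lambda>n. (t - s) * inc s t \<omega> - \<delta> n * inc s t \<omega> - (\<Sum>i<Suc n. \<delta> n * inc s (grid s t (Suc n) i) \<omega>))
         \<longlonglongrightarrow> (t - s) * inc s t \<omega> - 0 * inc s t \<omega> - area s t \<omega>"
        unfolding area_def \<delta>_def using inc_continuous[OF st(1) \<omega>] st
        by (intro tendsto_intros mesh_tendsto_0 Riemann_sums_tendsto)
      ultimately show "(\<lambda>n. simple_integral W (Suc n) (\<tau> n) (\<xi> n) \<omega>) \<longlonglongrightarrow> J \<omega>" by (simp add: J_def)
    qed
    show "(\<integral>\<^sup>+ \<omega>. ennreal ((simple_integral W (Suc n) (\<tau> n) (\<xi> n) \<omega> - simple_integral W (Suc m) (\<tau> m) (\<xi> m) \<omega>)\<^sup>2) \<partial>M)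
       \<le> 2 * e n + 2 * e m" for n m
    proof -
      let ?v = "\<lambda>n v. simple_value (Suc n) (\<tau> n) (\<xi> n) v"
      have "(\<integral>\<^sup>+ \<omega>. ennreal ((simple_integral W (Suc n) (\<tau> n) (\<xi> n) \<omega> - simple_integral W (Suc m) (\<tau> m) (\<xi>
          m) \<omega>)\<^sup>2) \<partial>M)
        = (\<integral>\<^sup>+ \<omega>. (\<integral>\<^sup>+ v. ennreal ((?v n v \<omega> - ?v m v \<omega>)\<^sup>2) \<partial>?L) \<partial>M)"
        by (rule simple_isometry[OF S S st(1)])
      also have "\<dots> \<le> (\<integral>\<^sup>+ \<omega>. (\<integral>\<^sup>+ v. 2 * ennreal ((\<delta> n)\<^sup>2) + 2 * ennreal ((\<delta> m)\<^sup>2) \<partial>?L) \<partial>M)"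
      proof (rule nn_integral_mono, rule nn_integral_mono_AE)
        fix \<omega>
        show "AE v in ?L. ennreal ((?v n v \<omega> - ?v m v \<omega>)\<^sup>2) \<le> 2 * ennreal ((\<delta> n)\<^sup>2) + 2 * ennreal ((\<delta> m)\<^sup>2)"
          using AE_ne
        proof eventually_elim
          case (elim v)
          define a b where "a = ?v n v \<omega> - max 0 (v - s)" and "b = max 0 (v - s) - ?v m v \<omega>"
          have ab: "\<bar>a\<bar> \<le> \<bar>\<delta> n\<bar>" "\<bar>b\<bar> \<le> \<bar>\<delta> m\<bar>"
            using V[of v n \<omega>] V[of v m \<omega>] elim by (auto simp: a_def b_def abs_minus_commute)
          have "ennreal ((?v n v \<omega> - ?v m v \<omega>)\<^sup>2) = ennreal ((a + b)\<^sup>2)" by (simp add: a_def b_def)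
          also have "\<dots> \<le> 2 * ennreal (a\<^sup>2) + 2 * ennreal (b\<^sup>2)" by (rule ennreal_square_add_le)
          also have "\<dots> \<le> 2 * ennreal ((\<delta> n)\<^sup>2) + 2 * ennreal ((\<delta> m)\<^sup>2)"
            using ab by (intro add_mono mult_left_mono ennreal_leI) (auto simp: abs_le_square_iff)
          finally show ?case .
        qed
      qed
      also have "\<dots> = 2 * e n + 2 * e m"
        by (simp add: nn_integral_add nn_integral_cmult const emeasure_space_1 del: nn_integral_const)
            (simp add: emeasure_space_1)
      finally show ?thesis .
    qed
  qed measurable
  then have lim2: "(\<lambda>n. \<integral>\<^sup>+ \<omega>. ennreal ((norm (simple_integral W (Suc n) (\<tau> n) (\<xi> n) \<omega> - J \<omega>))\<^sup>2) \<partial>M) \<longlonglongrightarrow> 0"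
    by (simp add: L2_tendsto_def)
  have lim1: "(\<lambda>n. \<integral>\<^sup>+ \<omega>. (\<integral>\<^sup>+ v. ennreal ((norm (simple_value (Suc n) (\<tau> n) (\<xi> n) v \<omega> - integral {s..v}
      (\<lambda>u. 1)))\<^sup>2) \<partial>?L) \<partial>M) \<longlonglongrightarrow> 0"
    unfolding H real_norm_def power2_abs by (rule tendsto_0_le[OF e0 app])
  show ?thesis unfolding has_ito_integral_def
  proof (intro conjI st exI)
    show "(\<lambda>(v, \<omega>). integral {s..v} (\<lambda>u. 1::real)) \<in> borel_measurable (?L \<Otimes>\<^sub>M M)"
      unfolding H split_beta'
      by (intro borel_measurable_max measurable_compose[OF measurable_fst] measurable_restrict_space1
          borel_measurable_diff) auto
    show "(\<lambda>\<omega>. (t - s) * inc s t \<omega> - area s t \<omega>) \<in> borel_measurable M"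
      using \<open>J \<in> borel_measurable M\<close> by (simp add: J_def[abs_def])
    show "\<forall>n. simple_integrand M F s t (Suc n) (\<tau> n) (\<xi> n)" using S by blast
  qed (use lim1 lim2 in \<open>simp_all add: J_def\<close>)
qed

text \<open>Every version of the integral is the limit of the same left-point sums, in particular the one
  picked by the choice operator.\<close>

lemma ito_integral_time:
  assumes st: "0 \<le> s" "s \<le> t"
  shows "AE \<omega> in M. ito_integral M F W s t (\<lambda>v _. integral {s..v} (\<lambda>u. 1::real)) \<omega> =
      (t - s) * inc s t \<omega> - area s t \<omega>"
proof -
  let ?H = "\<lambda>v (_::'w). integral {s..v} (\<lambda>u. 1::real)"
  define \<rho> where "\<rho> n = grid s t (Suc n)" for n
  have H: "integral {s..v} (\<lambda>u. 1::real) = max 0 (v - s)" for v by (simp add: max_def)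
  have lim: "L2_tendsto M (\<lambda>n. simple_integral W (Suc n) (\<rho> n) (\<lambda>i. ?H (\<rho> n i))) I"
    if "has_ito_integral M F W s t ?H I" for I
  proof (rule ito_integral_Riemann[OF that, where K = "t - s" and \<delta> = "\<lambda>n. (t - s) / real (Suc n)"])
    show "\<rho> n i \<le> \<rho> n (Suc i)" for n i using grid_mono[OF st(2)] by (simp add: \<rho>_def)
    show "\<rho> n (Suc i) - \<rho> n i \<le> (t - s) / real (Suc n)" for n i by (simp add: \<rho>_def grid_step)
    show "continuous_on {s..t} (\<lambda>v. integral {s..v} (\<lambda>u. 1::real))"
      unfolding H by (intro continuous_intros)
  qed (auto simp: \<rho>_def mesh_tendsto_0 simp del: of_nat_Suc)
  note explicit = has_ito_integral_time[OF st]
  have "has_ito_integral M F W s t ?H (ito_integral M F W s t ?H)"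
    unfolding ito_integral_def by (rule someI[where P = "has_ito_integral M F W s t ?H", OF explicit])
  from L2_tendsto_unique[OF lim[OF this] lim[OF explicit]] show ?thesis .
qed

end

section \<open>Independence structure of the driving noise\<close>

locale driven = filtered_space M F for M :: "'w measure" and F :: "real \<Rightarrow> 'w measure" +
  fixes d :: nat and B B' :: "nat \<Rightarrow> real \<Rightarrow> 'w \<Rightarrow> real"
  assumes noise: "driving_noise M F d B B'"
begin

text \<open>The sigma-algebra generated by the increments of both Brownian motions after time \<open>t\<close>.\<close>

definition future :: "real \<Rightarrow> 'w measure"
  where "future t = vimage_algebra (space M)
    (\<lambda>\<omega>. (path {1..d} (incr_after t B) \<omega>, path {2..d} (incr_after t B') \<omega>))
    (path_space {1..d} \<Otimes>\<^sub>M path_space {2..d})"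

lemma path_in_space: "path J W \<omega> \<in> space (path_space J)"
  by (auto simp: path_def path_space_def space_PiM)

lemma coordinate_measurable: "j \<in> J \<Longrightarrow> 0 \<le> t \<Longrightarrow> (\<lambda>p. p (j, t)) \<in> borel_measurable (path_space J)"
  unfolding path_space_def by (rule measurable_component_singleton) simp

lemma future_coordinates:
  "(\<lambda>\<omega>. (path {1..d} (incr_after t B) \<omega>, path {2..d} (incr_after t B') \<omega>))
     \<in> measurable (future t) (path_space {1..d} \<Otimes>\<^sub>M path_space {2..d})"
  unfolding future_def
  by (rule measurable_vimage_algebra1) (auto simp: space_pair_measure path_in_space)

lemma future_B:
  assumes "j \<in> {1..d}" "0 \<le> t" "t \<le> u"
  shows "(\<lambda>\<omega>. B j u \<omega> - B j t \<omega>) \<in> borel_measurable (future t)"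
proof -
  have "(\<lambda>\<omega>. path {1..d} (incr_after t B) \<omega> (j, u - t)) \<in> borel_measurable (future t)"
    using measurable_compose[OF measurable_compose[OF future_coordinates measurable_fst]
        coordinate_measurable[OF assms(1)], of "u - t" t] assms
    by simp
  then show ?thesis using assms by (simp add: path_def incr_after_def)
qed

lemma future_B':
  assumes "j \<in> {2..d}" "0 \<le> t" "t \<le> u"
  shows "(\<lambda>\<omega>. B' j u \<omega> - B' j t \<omega>) \<in> borel_measurable (future t)"
proof -
  have "(\<lambda>\<omega>. path {2..d} (incr_after t B') \<omega> (j, u - t)) \<in> borel_measurable (future t)"
    using measurable_compose[OF measurable_compose[OF future_coordinates measurable_snd]
        coordinate_measurable[OF assms(1)], of "u - t" t] assms
    by simp
  then show ?thesis using assms by (simp add: path_def incr_after_def)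
qed

lemma indep_future:
  fixes Y Z :: "'w \<Rightarrow> real"
  assumes t: "0 \<le> t" and Y: "Y \<in> borel_measurable (F t)" and Z: "Z \<in> borel_measurable (future t)"
  shows "indep_var borel Y borel Z"
proof -
  have ind: "indep_set (sets (F t)) (sets (future t))"
    using noise t by (simp add: driving_noise_def future_def)
  then have ev: "sets (F t) \<subseteq> events" "sets (future t) \<subseteq> events"
    and prod: "\<And>a b. a \<in> sets (F t) \<Longrightarrow> b \<in> sets (future t) \<Longrightarrow> prob (a \<inter> b) = prob a * prob b"
    unfolding indep_sets2_eq by auto
  have sp: "space (future t) = space M" by (simp add: future_def)
  have gen: "sigma_sets (space M) {f -` A \<inter> space M | A. A \<in> sets borel} \<subseteq> sets N"
    if "f \<in> borel_measurable N" "space N = space M" for f :: "'w \<Rightarrow> real" and N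
  proof -
    have "{f -` A \<inter> space M | A. A \<in> sets borel} \<subseteq> sets N"
      using measurable_sets[OF that(1)] that(2) by auto
    from sets.sigma_sets_subset[OF this] show ?thesis unfolding that(2) .
  qed
  note gY = gen[OF Y space_F[OF t]] and gZ = gen[OF Z sp]
  have Zm: "Z \<in> borel_measurable M"
    by (rule measurable_from_subalg[OF _ Z]) (use ev sp in \<open>simp add: subalgebra_def\<close>)
  show ?thesis
    unfolding indep_var_eq
  proof (intro conjI F_measurable[OF t Y] Zm)
    show "indep_set (sigma_sets (space M) {Y -` A \<inter> space M |A. A \<in> sets borel})
          (sigma_sets (space M) {Z -` A \<inter> space M |A. A \<in> sets borel})"
      unfolding indep_sets2_eq using gY gZ ev prod by blast
  qed
qed

lemma future_orthogonal:
  fixes Y Z :: "'w \<Rightarrow> real"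
  assumes t: "0 \<le> t" and Y: "Y \<in> borel_measurable (F t)" "integrable M Y"
    and Z: "Z \<in> borel_measurable (future t)" "integrable M Z" "expectation Z = 0"
  shows "expectation (\<lambda>\<omega>. Y \<omega> * Z \<omega>) = 0"
  using indep_var_lebesgue_integral[OF indep_future[OF t Y(1) Z(1)] Y(2) Z(2)] Z(3) by simp

lemma future_moment:
  fixes Y Z :: "'w \<Rightarrow> real"
  assumes t: "0 \<le> t" and Y: "Y \<in> borel_measurable (F t)" "all_moments M Y"
    and Z: "Z \<in> borel_measurable (future t)" "all_moments M Z"
  shows "expectation (\<lambda>\<omega>. (Y \<omega> * Z \<omega>) ^ r) = expectation (\<lambda>\<omega>. Y \<omega> ^ r) * expectation (\<lambda>\<omega>. Z \<omega> ^ r)"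
  unfolding power_mult_distrib
  using Y Z by (intro indep_var_lebesgue_integral indep_future[OF t] power_integrable) auto

lemma wiener_B:
  assumes j: "j \<in> {1..d}"
  shows "wiener M F (B j)"
proof
  have br: "brownian M (B j)" using noise j by (auto simp: driving_noise_def brownian_vec_def)
  fix t :: real assume t: "0 \<le> t"
  show "B j t \<in> borel_measurable (F t)" using noise j t by (auto simp: driving_noise_def adapted_fam_def)
next
  fix s t :: real and Y :: "'w \<Rightarrow> real"
  assume "0 \<le> s" "s \<le> t" "Y \<in> borel_measurable (F s)"
  then show "indep_var borel Y borel (\<lambda>\<omega>. B j t \<omega> - B j s \<omega>)"
    using future_B[OF j] by (intro indep_future) auto
next
  have br: "brownian M (B j)" using noise j by (auto simp: driving_noise_def brownian_vec_def)
  fix s t :: real assume "0 \<le> s" "s < t"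
  then show "distributed M lborel (\<lambda>\<omega>. B j t \<omega> - B j s \<omega>) (normal_density 0 (sqrt (t - s)))"
    using br by (simp add: brownian_def)
next
  have br: "brownian M (B j)" using noise j by (auto simp: driving_noise_def brownian_vec_def)
  fix \<omega> assume "\<omega> \<in> space M"
  then show "continuous_on {0..} (\<lambda>t. B j t \<omega>)" using br by (simp add: brownian_def)
qed

lemma wiener_B':
  assumes j: "j \<in> {2..d}"
  shows "wiener M F (B' j)"
proof
  have br: "brownian M (B' j)" using noise j by (auto simp: driving_noise_def brownian_vec_def)
  fix t :: real assume t: "0 \<le> t"
  show "B' j t \<in> borel_measurable (F t)" using noise j t by (auto simp: driving_noise_def adapted_fam_def)
next
  fix s t :: real and Y :: "'w \<Rightarrow> real"
  assume "0 \<le> s" "s \<le> t" "Y \<in> borel_measurable (F s)"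
  then show "indep_var borel Y borel (\<lambda>\<omega>. B' j t \<omega> - B' j s \<omega>)"
    using future_B'[OF j] by (intro indep_future) auto
next
  have br: "brownian M (B' j)" using noise j by (auto simp: driving_noise_def brownian_vec_def)
  fix s t :: real assume "0 \<le> s" "s < t"
  then show "distributed M lborel (\<lambda>\<omega>. B' j t \<omega> - B' j s \<omega>) (normal_density 0 (sqrt (t - s)))"
    using br by (simp add: brownian_def)
next
  have br: "brownian M (B' j)" using noise j by (auto simp: driving_noise_def brownian_vec_def)
  fix \<omega> assume "\<omega> \<in> space M"
  then show "continuous_on {0..} (\<lambda>t. B' j t \<omega>)" using br by (simp add: brownian_def)
qed

lemma dB_eq: "j \<ge> 1 \<Longrightarrow> dB W j s t = (\<lambda>\<omega>. W j t \<omega> - W j s \<omega>)"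
  by (auto simp: dB_def)

lemma path_apply: "j \<in> J \<Longrightarrow> 0 \<le> t \<Longrightarrow> path J W \<omega> (j, t) = W j t \<omega>"
  by (simp add: path_def)

lemma B_product_mean:
  assumes j: "j1 \<in> {1..d}" "j2 \<in> {1..d}" "j1 \<noteq> j2" and st: "0 \<le> s" "s \<le> t"
  shows "expectation (\<lambda>\<omega>. dB B j1 s t \<omega> * dB B j2 s t \<omega>) = 0"
proof -
  have "indep_vars (\<lambda>j. path_space {j}) (\<lambda>j. path {j} B) {1..d}"
    using noise by (simp add: driving_noise_def brownian_vec_def)
  then have ind: "indep_vars (\<lambda>j. path_space {j}) (\<lambda>j. path {j} B) {j1, j2}"
    using j by (elim indep_vars_subset) auto
  have "indep_vars (\<lambda>_. borel) (\<lambda>j \<omega>. path {j} B \<omega> (j, t) - path {j} B \<omega> (j, s)) {j1, j2}"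
    using st by (intro indep_vars_compose2[OF ind]) (auto intro!: borel_measurable_diff coordinate_measurable)
  then have iv: "indep_vars (\<lambda>_. borel) (\<lambda>j. dB B j s t) {j1, j2}"
    using j st by (subst indep_vars_cong[OF refl _ refl]) (auto simp: dB_eq path_apply)
  have mom: "all_moments M (dB B j s t)" "expectation (dB B j s t) = 0" if "j \<in> {1..d}" for j
    using wiener.inc_all_moments[OF wiener_B[OF that] st] wiener.inc_mean[OF wiener_B[OF that] st] that
    by (auto simp: dB_eq)
  have "expectation (\<lambda>\<omega>. \<Prod>j\<in>{j1, j2}. dB B j s t \<omega>) = (\<Prod>j\<in>{j1, j2}. expectation (dB B j s t))"
    using j mom by (intro indep_vars_lebesgue_integral[OF _ iv]) (auto intro: all_moments_integrable)
  then show ?thesis using j mom by simp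
qed

lemma B_B'_product_mean:
  assumes j: "j1 \<in> {1..d}" "j2 \<in> {2..d}" and st: "0 \<le> s" "s \<le> t"
  shows "expectation (\<lambda>\<omega>. dB B j1 s t \<omega> * dB B' j2 s t \<omega>) = 0"
proof -
 have ind: "indep_var (path_space {1..d}) (path {1..d} B) (path_space {2..d}) (path {2..d} B')"
    using noise by (simp add: driving_noise_def)
  have "indep_var borel ((\<lambda>p. p (j1, t) - p (j1, s)) \<circ> path {1..d} B) borel ((\<lambda>p. p (j2, t) - p (j2, s))
      \<circ> path {2..d} B')"
    using j st by (intro indep_var_compose[OF ind]) (auto intro!: borel_measurable_diff coordinate_measurable)
  also have "(\<lambda>p. p (j1, t) - p (j1, s)) \<circ> path {1..d} B = dB B j1 s t"
    using j st by (auto simp: dB_eq path_apply)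
  also have "(\<lambda>p. p (j2, t) - p (j2, s)) \<circ> path {2..d} B' = dB B' j2 s t"
    using j st by (auto simp: dB_eq path_apply)
  finally have "indep_var borel (dB B j1 s t) borel (dB B' j2 s t)" .
  moreover have "all_moments M (dB B j1 s t)" "expectation (dB B j1 s t) = 0"
    using wiener.inc_all_moments[OF wiener_B[OF j(1)] st] wiener.inc_mean[OF wiener_B[OF j(1)] st] j
    by (auto simp: dB_eq)
  moreover have "all_moments M (dB B' j2 s t)"
    using wiener.inc_all_moments[OF wiener_B'[OF j(2)] st] j by (auto simp: dB_eq)
  ultimately show ?thesis
    using indep_var_lebesgue_integral[of "dB B j1 s t" "dB B' j2 s t"] by (simp add: all_moments_integrable)
qed

text \<open>The common properties of the random factors of the scheme. The degree \<open>p\<close> is 1 for Brownian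
  increments and 2 for centred products of two of them; the function \<open>c\<close> carries the moment constants.\<close>

definition noise_term :: "real \<Rightarrow> real \<Rightarrow> nat \<Rightarrow> (nat \<Rightarrow> real) \<Rightarrow> ('w \<Rightarrow> real) \<Rightarrow> bool"
  where "noise_term s t p c Z \<longleftrightarrow> Z \<in> borel_measurable (F t) \<and> Z \<in> borel_measurable (future s) \<and>
    all_moments M Z \<and> expectation Z = 0 \<and>
    (\<forall>q\<ge>1. even_moment q Z \<le> c q * (t - s) ^ (p * q))"

lemma noise_term_B:
  assumes j: "j \<in> {1..d}" and st: "0 \<le> s" "s \<le> t"
  shows "noise_term s t 1 gauss_moment (dB B j s t)"
proof -
  interpret wiener M F "B j" by (rule wiener_B[OF j])
  show ?thesis
    using j st future_B[OF j st] inc_adapted[OF st order_refl] inc_moments[OF st]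
    by (simp add: noise_term_def dB_eq)
qed

lemma noise_term_B':
  assumes j: "j \<in> {2..d}" and st: "0 \<le> s" "s \<le> t"
  shows "noise_term s t 1 gauss_moment (dB B' j s t)"
proof -
  interpret wiener M F "B' j" by (rule wiener_B'[OF j])
  show ?thesis
    using j st future_B'[OF j st] inc_adapted[OF st order_refl] inc_moments[OF st]
    by (simp add: noise_term_def dB_eq)
qed

definition product_moment :: "nat \<Rightarrow> real"
  where "product_moment q = 4 ^ q * (2 * gauss_moment (2 * q) + 1)"

text \<open>By \<open>|Z\<^sub>1 Z\<^sub>2|\<^sup>2\<^sup>q \<le> Z\<^sub>1\<^sup>4\<^sup>q + Z\<^sub>2\<^sup>4\<^sup>q\<close>, which reduces moments of the product to higher moments of the
  factors.\<close>

lemma centred_product_moment: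
  assumes Z1: "noise_term s t 1 gauss_moment Z1" and Z2: "noise_term s t 1 gauss_moment Z2"
    and st: "s \<le> t" and \<kappa>: "\<kappa> = 0 \<or> \<kappa> = t - s"
    and mean: "expectation (\<lambda>\<omega>. Z1 \<omega> * Z2 \<omega>) = \<kappa>"
  shows "noise_term s t 2 product_moment (\<lambda>\<omega>. Z1 \<omega> * Z2 \<omega> - \<kappa>)"
proof -
  have m: "all_moments M Z1" "all_moments M Z2" using Z1 Z2 by (auto simp: noise_term_def)
  have mom: "all_moments M (\<lambda>\<omega>. Z1 \<omega> * Z2 \<omega>)" by (intro all_moments_mult m)
  have bound: "even_moment q (\<lambda>\<omega>. Z1 \<omega> * Z2 \<omega> - \<kappa>) \<le> product_moment q * (t - s) ^ (2 * q)" if q: "q \<ge> 1" for q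
  proof -
    have i: "integrable M (\<lambda>\<omega>. Z1 \<omega> ^ (2 * (2 * q)))" "integrable M (\<lambda>\<omega>. Z2 \<omega> ^ (2 * (2 * q)))"
      using m by (auto intro: power_integrable)
    have "even_moment q (\<lambda>\<omega>. Z1 \<omega> * Z2 \<omega> - \<kappa>) \<le>
      expectation (\<lambda>\<omega>. 4 ^ q * (Z1 \<omega> ^ (2 * (2 * q)) + Z2 \<omega> ^ (2 * (2 * q)) + (t - s) ^ (2 * q)))"
    proof (rule integral_mono)
      fix \<omega>
      define a b where "a = Z1 \<omega> ^ (2 * q)" and "b = Z2 \<omega> ^ (2 * q)"
      have ab: "a \<ge> 0" "b \<ge> 0" unfolding a_def b_def by (auto intro!: zero_le_even_power)
      have "(Z1 \<omega> * Z2 \<omega> - \<kappa>) ^ (2 * q) \<le> 4 ^ q * ((Z1 \<omega> * Z2 \<omega>) ^ (2 * q) + \<kappa> ^ (2 * q))"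
        using even_power_sum_le[of "Z1 \<omega> * Z2 \<omega>" "- \<kappa>" q] by simp
      also have "\<dots> = 4 ^ q * (a * b + \<kappa> ^ (2 * q))"
        by (simp add: a_def b_def power_mult_distrib power_mult)
      also have "\<dots> \<le> 4 ^ q * (a\<^sup>2 + b\<^sup>2 + (t - s) ^ (2 * q))"
      proof (intro mult_left_mono add_mono)
        show "a * b \<le> a\<^sup>2 + b\<^sup>2"
          using sum_squares_bound[of a b] mult_nonneg_nonneg[OF ab] by linarith
        show "\<kappa> ^ (2 * q) \<le> (t - s) ^ (2 * q)" using \<kappa> q by (auto simp: power_0_left)
      qed simp
      also have "a\<^sup>2 = Z1 \<omega> ^ (2 * (2 * q))" unfolding a_def by (simp only: power_mult[symmetric] mult.commute)
      also have "b\<^sup>2 = Z2 \<omega> ^ (2 * (2 * q))" unfolding b_def by (simp only: power_mult[symmetric] mult.commute)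
      finally show "(Z1 \<omega> * Z2 \<omega> - \<kappa>) ^ (2 * q) \<le> 4 ^ q * (Z1 \<omega> ^ (2 * (2 * q)) + Z2 \<omega> ^ (2 * (2 * q)) +
          (t - s) ^ (2 * q))" .
    qed (use i power_integrable[OF all_moments_diff[OF mom all_moments_const]] in auto)
    also have "\<dots> = 4 ^ q * (expectation (\<lambda>\<omega>. Z1 \<omega> ^ (2 * (2 * q))) + expectation (\<lambda>\<omega>. Z2 \<omega> ^ (2 * (2 *
        q))) + (t - s) ^ (2 * q))"
      using i by (simp add: prob_space)
    also have "\<dots> \<le> 4 ^ q * (gauss_moment (2 * q) * (t - s) ^ (1 * (2 * q)) + gauss_moment (2 * q) * (t -
        s) ^ (1 * (2 * q)) + (t - s) ^ (2 * q))"
    proof (intro mult_left_mono add_mono order_refl)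
      show "expectation (\<lambda>\<omega>. Z1 \<omega> ^ (2 * (2 * q))) \<le> gauss_moment (2 * q) * (t - s) ^ (1 * (2 * q))"
        using Z1 q unfolding noise_term_def by (metis One_nat_def Suc_le_eq nat_0_less_mult_iff zero_less_numeral)
      show "expectation (\<lambda>\<omega>. Z2 \<omega> ^ (2 * (2 * q))) \<le> gauss_moment (2 * q) * (t - s) ^ (1 * (2 * q))"
        using Z2 q unfolding noise_term_def by (metis One_nat_def Suc_le_eq nat_0_less_mult_iff zero_less_numeral)
    qed simp
    also have "\<dots> = product_moment q * (t - s) ^ (2 * q)"
    proof -
      have "c * (g * e + g * e + e) = c * (2 * g + 1) * e" for c g e :: real by (simp add: algebra_simps)
      then show ?thesis by (simp only: product_moment_def mult_1)
    qed
    finally show ?thesis .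
  qed
  show ?thesis unfolding noise_term_def
  proof (intro conjI allI impI)
    show "expectation (\<lambda>\<omega>. Z1 \<omega> * Z2 \<omega> - \<kappa>) = 0"
      using all_moments_integrable[OF mom] mean by (simp add: prob_space)
  qed (use Z1 Z2 bound mom in \<open>auto simp: noise_term_def intro: all_moments_diff all_moments_const\<close>)
qed

lemma noise_term_BB:
  assumes j: "j1 \<in> {1..d}" "j2 \<in> {1..d}" and st: "0 \<le> s" "s \<le> t"
  shows "noise_term s t 2 product_moment (\<lambda>\<omega>. dB B j1 s t \<omega> * dB B j2 s t \<omega> - (if j1 = j2 then t - s else 0))"
proof (rule centred_product_moment[OF noise_term_B[OF j(1) st] noise_term_B[OF j(2) st] st(2)])
  show "expectation (\<lambda>\<omega>. dB B j1 s t \<omega> * dB B j2 s t \<omega>) = (if j1 = j2 then t - s else 0)"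
    using B_product_mean[OF j _ st] wiener.inc_variance[OF wiener_B[OF j(1)] st] j
    by (auto simp: dB_eq power2_eq_square)
qed auto

lemma noise_term_BB':
  assumes j: "j1 \<in> {1..d}" "j2 \<in> {2..d}" and st: "0 \<le> s" "s \<le> t"
  shows "noise_term s t 2 product_moment (\<lambda>\<omega>. dB B j1 s t \<omega> * dB B' j2 s t \<omega>)"
  using centred_product_moment[OF noise_term_B[OF j(1) st] noise_term_B'[OF j(2) st] st(2) _
      B_B'_product_mean[OF j st]]
  by simp

end

section \<open>Moment estimates for the solution\<close>

lemma sum_lessThan_double:
  fixes f :: "nat \<Rightarrow> 'a::comm_monoid_add"
  shows "(\<Sum>i<N + m. f i) = (\<Sum>i<N. f i) + (\<Sum>i<m. f (N + i))"
  by (induction m) (auto simp: ac_simps)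

text \<open>The equation supplies integrals over \<open>[0, s]\<close> and \<open>[0, t]\<close> separately. Along partitions of
  \<open>[0, t]\<close> that start with a partition of \<open>[0, s]\<close>, the difference of their left-point sums
  is a left-point sum over \<open>[s, t]\<close>.\<close>

lemma (in wiener) ito_increment_Riemann:
  fixes H :: "real \<Rightarrow> 'w \<Rightarrow> real"
  assumes I1: "has_ito_integral M F W 0 s H I1" and I2: "has_ito_integral M F W 0 t H I2"
    and st: "0 \<le> s" "s \<le> t"
    and H: "\<And>v. v \<in> {0..t} \<Longrightarrow> H v \<in> borel_measurable (F v)"
    and K: "\<And>v \<omega>. v \<in> {0..t} \<Longrightarrow> \<omega> \<in> space M \<Longrightarrow> \<bar>H v \<omega>\<bar> \<le> K"
    and cont: "\<And>\<omega>. \<omega> \<in> space M \<Longrightarrow> continuous_on {0..t} (\<lambda>v. H v \<omega>)"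
  shows "L2_tendsto M (\<lambda>n \<omega>. \<Sum>i<Suc n. inc (grid s t (Suc n) i) (grid s t (Suc n) (Suc i)) \<omega> * H (grid s
      t (Suc n) i) \<omega>)
    (\<lambda>\<omega>. I2 \<omega> - I1 \<omega>)"
proof -
  define \<rho> where "\<rho> n i = (if i \<le> Suc n then grid 0 s (Suc n) i else grid s t (Suc n) (i - Suc n))" for n i
  have \<rho>2: "\<rho> n (Suc n + i) = grid s t (Suc n) i" for n i
    by (cases i) (auto simp: \<rho>_def simp del: of_nat_Suc)
  have step: "0 \<le> \<rho> n (Suc i) - \<rho> n i \<and> \<rho> n (Suc i) - \<rho> n i \<le> t / real (Suc n)" if "i < Suc n + Suc n" for n i
  proof (cases "i < Suc n")
    case True
    then have "\<rho> n (Suc i) - \<rho> n i = s / real (Suc n)"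
      using grid_step[of "Suc n" 0 s i] by (simp add: \<rho>_def)
    then show ?thesis using st by (auto intro!: divide_right_mono simp del: of_nat_Suc)
  next
    case False
    then obtain m where i: "i = Suc n + m" by (metis le_iff_add not_less)
    have "\<rho> n (Suc i) - \<rho> n i = (t - s) / real (Suc n)"
      using \<rho>2[of n m] \<rho>2[of n "Suc m"] grid_step[of "Suc n" s t m] by (simp add: i)
    then show ?thesis using st by (auto intro!: divide_right_mono simp del: of_nat_Suc)
  qed
  have 1: "L2_tendsto M (\<lambda>n. simple_integral W (Suc n + Suc n) (\<rho> n) (\<lambda>i. H (\<rho> n i))) I2"
  proof (rule ito_integral_Riemann[OF I2 H K cont, where \<delta> = "\<lambda>n. t / real (Suc n)"])
    show "\<rho> n 0 = 0" for n by (simp add: \<rho>_def)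
    show "\<rho> n (Suc n + Suc n) = t" for n unfolding \<rho>2 by simp
    show "(\<lambda>n. t / real (Suc n)) \<longlonglongrightarrow> 0" by (rule mesh_tendsto_0)
  qed (use step in \<open>auto simp: add_increasing diff_ge_0_iff_ge simp del: of_nat_Suc\<close>)
  have 2: "L2_tendsto M (\<lambda>n. simple_integral W (Suc n) (grid 0 s (Suc n)) (\<lambda>i. H (grid 0 s (Suc n) i))) I1"
  proof (rule ito_integral_Riemann[OF I1, where \<delta> = "\<lambda>n. s / real (Suc n)" and K = K])
    show "(\<lambda>n. s / real (Suc n)) \<longlonglongrightarrow> 0" by (rule mesh_tendsto_0)
    show "continuous_on {0..s} (\<lambda>v. H v \<omega>)" if "\<omega> \<in> space M" for \<omega>
      using st by (intro continuous_on_subset[OF cont[OF that]]) auto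
    show "grid 0 s (Suc n) (Suc i) - grid 0 s (Suc n) i \<le> s / real (Suc n)" for n i
      by (simp add: grid_step)
  qed (use H K st in \<open>auto intro: grid_mono\<close>)
  have eq: "(\<lambda>n \<omega>. \<Sum>i<Suc n. inc (grid s t (Suc n) i) (grid s t (Suc n) (Suc i)) \<omega> * H (grid s t (Suc n) i) \<omega>) =
    (\<lambda>n \<omega>. simple_integral W (Suc n + Suc n) (\<rho> n) (\<lambda>i. H (\<rho> n i)) \<omega> -
       simple_integral W (Suc n) (grid 0 s (Suc n)) (\<lambda>i. H (grid 0 s (Suc n) i)) \<omega>)"
  proof (intro ext)
    fix n \<omega>
    have "(\<Sum>i<Suc n. inc (\<rho> n i) (\<rho> n (Suc i)) \<omega> * H (\<rho> n i) \<omega>) =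
        (\<Sum>i<Suc n. inc (grid 0 s (Suc n) i) (grid 0 s (Suc n) (Suc i)) \<omega> * H (grid 0 s (Suc n) i) \<omega>)"
      by (intro sum.cong refl) (auto simp: \<rho>_def)
    moreover have "(\<Sum>i<Suc n. inc (\<rho> n (Suc n + i)) (\<rho> n (Suc (Suc n + i))) \<omega> * H (\<rho> n (Suc n + i)) \<omega>) =
        (\<Sum>i<Suc n. inc (grid s t (Suc n) i) (grid s t (Suc n) (Suc i)) \<omega> * H (grid s t (Suc n) i) \<omega>)"
      unfolding add_Suc_right[symmetric] \<rho>2 ..
    ultimately show "(\<Sum>i<Suc n. inc (grid s t (Suc n) i) (grid s t (Suc n) (Suc i)) \<omega> * H (grid s t (Suc n) i) \<omega>) =
      simple_integral W (Suc n + Suc n) (\<rho> n) (\<lambda>i. H (\<rho> n i)) \<omega> -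
       simple_integral W (Suc n) (grid 0 s (Suc n)) (\<lambda>i. H (grid 0 s (Suc n) i)) \<omega>"
      unfolding simple_integral_def real_scaleR_def sum_lessThan_double[of _ "Suc n" "Suc n"] by simp
  qed
  show ?thesis unfolding eq by (rule L2_tendsto_diff[OF 1 2])
qed

lemma vec_nth_borel: "(\<lambda>v::real^'n. v $ c) \<in> borel_measurable borel"
  by (intro borel_measurable_continuous_onI continuous_intros)

lemma has_ito_integral_component:
  fixes H :: "real \<Rightarrow> 'w \<Rightarrow> real^'n"
  assumes "has_ito_integral M F W a b H I"
  shows "has_ito_integral M F W a b (\<lambda>s \<omega>. H s \<omega> $ c) (\<lambda>\<omega>. I \<omega> $ c)"
proof -
  let ?L = "restrict_space lborel {a..b}"
  obtain m \<tau> \<xi> where ab: "0 \<le> a" "a \<le> b"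
    and Hm: "(\<lambda>(s, \<omega>). H s \<omega>) \<in> borel_measurable (?L \<Otimes>\<^sub>M M)" and Im: "I \<in> borel_measurable M"
    and S: "\<And>n. simple_integrand M F a b (m n) (\<tau> n) (\<xi> n)"
    and l1: "(\<lambda>n. \<integral>\<^sup>+ \<omega>. (\<integral>\<^sup>+ s. ennreal ((norm (simple_value (m n) (\<tau> n) (\<xi> n) s \<omega> - H s \<omega>))\<^sup>2) \<partial>?L) \<partial>M) \<longlonglongrightarrow> 0"
    and l2: "(\<lambda>n. \<integral>\<^sup>+ \<omega>. ennreal ((norm (simple_integral W (m n) (\<tau> n) (\<xi> n) \<omega> - I \<omega>))\<^sup>2) \<partial>M) \<longlonglongrightarrow> 0"
    using assms unfolding has_ito_integral_def by blast
  define \<xi>' where "\<xi>' n i \<omega> = \<xi> n i \<omega> $ c" for n i \<omega>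
  have v: "simple_value (m n) (\<tau> n) (\<xi>' n) s \<omega> = simple_value (m n) (\<tau> n) (\<xi> n) s \<omega> $ c" for n s \<omega>
    by (simp add: simple_value_def \<xi>'_def)
  have i: "simple_integral W (m n) (\<tau> n) (\<xi>' n) \<omega> = simple_integral W (m n) (\<tau> n) (\<xi> n) \<omega> $ c" for n \<omega>
    by (simp add: simple_integral_def \<xi>'_def)
  have le: "ennreal ((norm (u $ c - w $ c))\<^sup>2) \<le> ennreal ((norm (u - w))\<^sup>2)" for u w :: "real^'n"
    using component_le_norm_cart[of "u - w" c] by (intro ennreal_leI power_mono) auto
  have bd: "bounded (\<xi>' n i ` space M)" if bounded_\<xi>: "bounded (\<xi> n i ` space M)" for n i
  proof -
    obtain b where b: "\<And>\<omega>. \<omega> \<in> space M \<Longrightarrow> norm (\<xi> n i \<omega>) \<le> b" using bounded_\<xi> unfolding bounded_iff by auto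
    then show ?thesis
      unfolding bounded_iff \<xi>'_def real_norm_def
      by (intro exI[of _ b]) (auto intro: order_trans[OF component_le_norm_cart])
  qed
  have S': "simple_integrand M F a b (m n) (\<tau> n) (\<xi>' n)" for n
  proof -
    have "\<xi>' n i \<in> borel_measurable N" if "\<xi> n i \<in> borel_measurable N" for i N
      unfolding \<xi>'_def[abs_def] by (rule measurable_compose[OF that vec_nth_borel])
    then show ?thesis using S[of n] bd unfolding simple_integrand_def by blast
  qed
  have "(\<lambda>n. \<integral>\<^sup>+ \<omega>. (\<integral>\<^sup>+ s. ennreal ((norm (simple_value (m n) (\<tau> n) (\<xi>' n) s \<omega> - H s \<omega> $ c))\<^sup>2) \<partial>?L) \<partial>M) \<longlonglongrightarrow> 0"
    unfolding v by (rule tendsto_0_le[OF l1]) (intro nn_integral_mono le)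
  moreover have "(\<lambda>n. \<integral>\<^sup>+ \<omega>. ennreal ((norm (simple_integral W (m n) (\<tau> n) (\<xi>' n) \<omega> - I \<omega> $ c))\<^sup>2) \<partial>M) \<longlonglongrightarrow> 0"
    unfolding i by (rule tendsto_0_le[OF l2]) (intro nn_integral_mono le)
  moreover have "(\<lambda>(s, \<omega>). H s \<omega> $ c) \<in> borel_measurable (?L \<Otimes>\<^sub>M M)"
    using measurable_compose[OF Hm vec_nth_borel[of c]] by (simp add: split_beta')
  moreover have "(\<lambda>\<omega>. I \<omega> $ c) \<in> borel_measurable M"
    by (rule measurable_compose[OF Im vec_nth_borel])
  ultimately show ?thesis unfolding has_ito_integral_def using ab S'
    by (intro conjI exI[of _ m] exI[of _ \<tau>] exI[of _ \<xi>'] allI)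
qed

context driven
begin

text \<open>Coefficients known at time \<open>s\<close> factor out of expectations by independence of the future, which gives
  both the orthogonality to the past and the moments.\<close>

lemma noise_combination:
  assumes A: "finite A" and st: "0 \<le> s" "s \<le> t"
    and \<eta>: "\<And>a. a \<in> A \<Longrightarrow> \<eta> a \<in> borel_measurable (F s)" "\<And>a. a \<in> A \<Longrightarrow> all_moments M (\<eta> a)"
    and Z: "\<And>a. a \<in> A \<Longrightarrow> noise_term s t p c (Z a)"
  shows "(\<lambda>\<omega>. \<Sum>a\<in>A. \<eta> a \<omega> * Z a \<omega>) \<in> borel_measurable (F t)"
    and "all_moments M (\<lambda>\<omega>. \<Sum>a\<in>A. \<eta> a \<omega> * Z a \<omega>)"
    and "Y \<in> borel_measurable (F s) \<Longrightarrow> integrable M (\<lambda>\<omega>. (Y \<omega>)\<^sup>2) \<Longrightarrow>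
      expectation (\<lambda>\<omega>. Y \<omega> * (\<Sum>a\<in>A. \<eta> a \<omega> * Z a \<omega>)) = 0"
    and "q \<ge> 1 \<Longrightarrow> (\<And>a. a \<in> A \<Longrightarrow> even_moment q (\<eta> a) \<le> e) \<Longrightarrow>
      even_moment q (\<lambda>\<omega>. \<Sum>a\<in>A. \<eta> a \<omega> * Z a \<omega>) \<le> real (card A) ^ (2 * q) * (e * (c q * (t - s) ^ (p * q)))"
proof -
  have Z': "Z a \<in> borel_measurable (F t)" "Z a \<in> borel_measurable (future s)" "all_moments M (Z a)"
    "expectation (Z a) = 0" "q \<ge> 1 \<Longrightarrow> even_moment q (Z a) \<le> c q * (t - s) ^ (p * q)" if "a \<in> A" for a q
    using Z[OF that] by (auto simp: noise_term_def)
  have mom: "all_moments M (\<lambda>\<omega>. \<eta> a \<omega> * Z a \<omega>)" if "a \<in> A" for a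
    using that by (intro all_moments_mult \<eta> Z')
  show "(\<lambda>\<omega>. \<Sum>a\<in>A. \<eta> a \<omega> * Z a \<omega>) \<in> borel_measurable (F t)"
    using F_mono[OF st \<eta>(1)] Z'(1) by (intro borel_measurable_sum borel_measurable_times) auto
  show "all_moments M (\<lambda>\<omega>. \<Sum>a\<in>A. \<eta> a \<omega> * Z a \<omega>)" by (intro all_moments_sum mom)
  show "expectation (\<lambda>\<omega>. Y \<omega> * (\<Sum>a\<in>A. \<eta> a \<omega> * Z a \<omega>)) = 0"
    if Y: "Y \<in> borel_measurable (F s)" "integrable M (\<lambda>\<omega>. (Y \<omega>)\<^sup>2)"
  proof -
    have Ym: "Y \<in> borel_measurable M" by (rule F_measurable[OF st(1) Y(1)])
    have int: "integrable M (\<lambda>\<omega>. Y \<omega> * (\<eta> a \<omega> * Z a \<omega>))" if "a \<in> A" for a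
      using mom[OF that] by (intro integrable_mult_square Ym Y(2) power_integrable) (auto intro:
          all_moments_measurable)
    have "expectation (\<lambda>\<omega>. Y \<omega> * (\<Sum>a\<in>A. \<eta> a \<omega> * Z a \<omega>)) = (\<Sum>a\<in>A. expectation (\<lambda>\<omega>. Y \<omega> * (\<eta> a \<omega> * Z a \<omega>)))"
      unfolding sum_distrib_left by (intro Bochner_Integration.integral_sum int)
    also have "\<dots> = 0"
    proof (rule sum.neutral, safe)
      fix a assume a: "a \<in> A"
      have "integrable M (\<lambda>\<omega>. Y \<omega> * \<eta> a \<omega>)"
        by (rule integrable_mult_square[OF Ym all_moments_measurable[OF \<eta>(2)[OF a]] Y(2)
            power_integrable[OF \<eta>(2)[OF a]]])
      from future_orthogonal[OF st(1) borel_measurable_times[OF Y(1) \<eta>(1)[OF a]] this Z'(2)[OF a]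
          all_moments_integrable[OF Z'(3)[OF a]] Z'(4)[OF a]]
      have "expectation (\<lambda>\<omega>. (Y \<omega> * \<eta> a \<omega>) * Z a \<omega>) = 0" .
      then show "expectation (\<lambda>\<omega>. Y \<omega> * (\<eta> a \<omega> * Z a \<omega>)) = 0" by (simp add: mult.assoc)
    qed
    finally show ?thesis .
  qed
  show "even_moment q (\<lambda>\<omega>. \<Sum>a\<in>A. \<eta> a \<omega> * Z a \<omega>) \<le> real (card A) ^ (2 * q) * (e * (c q * (t - s) ^ (p * q)))"
    if q: "q \<ge> 1" and e: "\<And>a. a \<in> A \<Longrightarrow> even_moment q (\<eta> a) \<le> e"
  proof (rule sum_even_moment_le[OF A mom q])
      fix a assume a: "a \<in> A"
      have "even_moment q (\<lambda>\<omega>. \<eta> a \<omega> * Z a \<omega>) = even_moment q (\<eta> a) * even_moment q (Z a)"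
        using Z'[OF a] \<eta>[OF a] by (intro future_moment[OF st(1)])
      also have "\<dots> \<le> e * (c q * (t - s) ^ (p * q))"
      proof (rule mult_mono[OF e[OF a] Z'(5)[OF a q]])
        have "0 \<le> even_moment q (\<eta> a)" by (intro Bochner_Integration.integral_nonneg) auto
        then show "0 \<le> e" using e[OF a] by linarith
      qed (auto intro!: Bochner_Integration.integral_nonneg)
      finally show "even_moment q (\<lambda>\<omega>. \<eta> a \<omega> * Z a \<omega>) \<le> e * (c q * (t - s) ^ (p * q))" .
  qed
qed

definition Riemann_const :: "nat \<Rightarrow> real"
  where "Riemann_const q = exp (4 ^ q) * 2 * 4 ^ q * (real d ^ (2 * q) * gauss_moment q)"

lemma Riemann_const_nonneg: "Riemann_const q \<ge> 0"
  by (simp add: Riemann_const_def gauss_moment_nonneg)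

text \<open>The sum is a discrete martingale along the grid, with \<open>n\<close> differences of variance proportional to
  \<open>(t - s) / n\<close>; the bound of \<open>moment_bound\<close> is therefore uniform in \<open>n\<close>.\<close>

lemma stochastic_sum_moments:
  assumes st: "0 \<le> s" "s \<le> t"
    and \<eta>: "\<And>i j. i < Suc n \<Longrightarrow> j \<in> {1..d} \<Longrightarrow> \<eta> i j \<in> borel_measurable (F (grid s t (Suc n) i))"
      "\<And>i j. i < Suc n \<Longrightarrow> j \<in> {1..d} \<Longrightarrow> all_moments M (\<eta> i j)"
  defines "Q \<equiv> \<lambda>\<omega>. \<Sum>i<Suc n. \<Sum>j=1..d. \<eta> i j \<omega> * dB B j (grid s t (Suc n) i) (grid s t (Suc n) (Suc i)) \<omega>"
  shows "all_moments M Q"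
    and "Y \<in> borel_measurable (F s) \<Longrightarrow> integrable M (\<lambda>\<omega>. (Y \<omega>)\<^sup>2) \<Longrightarrow> expectation (\<lambda>\<omega>. Y \<omega> * Q \<omega>) = 0"
    and "q \<ge> 1 \<Longrightarrow> (\<And>i j. i < Suc n \<Longrightarrow> j \<in> {1..d} \<Longrightarrow> even_moment q (\<eta> i j) \<le> e) \<Longrightarrow>
      even_moment q Q \<le> Riemann_const q * e * (t - s) ^ q"
proof -
  let ?g = "grid s t (Suc n)"
  define D where "D i \<omega> = (\<Sum>j=1..d. \<eta> i j \<omega> * dB B j (?g i) (?g (Suc i)) \<omega>)" for i \<omega>
  have g0: "0 \<le> ?g i" if "i \<le> Suc n" for i using grid_range[OF st(2) that] st by auto
  have gm: "?g i \<le> ?g j" if "i \<le> j" for i j using grid_mono[OF st(2) that] .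
  have i0: "0 \<le> ?g i" "?g i \<le> ?g (Suc i)" if "i < Suc n" for i using g0[of i] gm[of i "Suc i"] that by auto
  have \<eta>Z: "\<eta> i j \<in> borel_measurable (F (?g i))" "all_moments M (\<eta> i j)"
    "noise_term (?g i) (?g (Suc i)) 1 gauss_moment (dB B j (?g i) (?g (Suc i)))"
    if "i < Suc n" "j \<in> {1..d}" for i j
    using \<eta>[OF that] noise_term_B[OF that(2) i0[OF that(1)]] by auto
  have D_eq: "D i = (\<lambda>\<omega>. \<Sum>j=1..d. \<eta> i j \<omega> * dB B j (?g i) (?g (Suc i)) \<omega>)" for i
    by (rule ext) (simp only: D_def)
  have comb: "D i \<in> borel_measurable (F (?g (Suc i)))" "all_moments M (D i)"
    "Y \<in> borel_measurable (F (?g i)) \<Longrightarrow> integrable M (\<lambda>\<omega>. (Y \<omega>)\<^sup>2) \<Longrightarrow> expectation (\<lambda>\<omega>. Y \<omega> * D i \<omega>) = 0"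
    if i: "i < Suc n" for i Y
  proof -
    note nc = noise_combination[where A = "{1..d}" and \<eta> = "\<eta> i" and p = 1 and c = gauss_moment and
        Z = "\<lambda>j. dB B j (?g i) (?g (Suc i))", OF finite_atLeastAtMost i0[OF i] \<eta>Z[OF i], folded D_eq]
    show "D i \<in> borel_measurable (F (?g (Suc i)))" "all_moments M (D i)"
      "Y \<in> borel_measurable (F (?g i)) \<Longrightarrow> integrable M (\<lambda>\<omega>. (Y \<omega>)\<^sup>2) \<Longrightarrow> expectation (\<lambda>\<omega>. Y \<omega> * D i \<omega>) = 0"
      using nc(1,2) nc(3)[of Y] by (simp_all add: D_def D_eq)
  qed
  have comb4: "even_moment q (D i) \<le> real (card {1..d}) ^ (2 * q) * (e * (gauss_moment q * (?g (Suc i) -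
      ?g i) ^ (1 * q)))"
    if i: "i < Suc n" and "q \<ge> 1" "\<And>j. j \<in> {1..d} \<Longrightarrow> even_moment q (\<eta> i j) \<le> e" for i q e
    unfolding D_eq by (rule noise_combination(4)[where A = "{1..d}" and \<eta> = "\<eta> i" and p = 1 and c =
        gauss_moment and
        Z = "\<lambda>j. dB B j (?g i) (?g (Suc i))", OF finite_atLeastAtMost i0[OF i] \<eta>Z[OF i] that(2,3)])
  interpret MD: martingale_differences M "\<lambda>i. F (?g i)" D "Suc n"
  proof
    show "subalgebra M (F (?g i))" if "i \<le> Suc n" for i using subalgebra_F[OF g0[OF that]] .
    show "sets (F (?g i)) \<subseteq> sets (F (?g j))" if "i \<le> j" "j \<le> Suc n" for i j
      using filtered g0[of i] gm[OF that(1)] that unfolding filtered_def by auto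
  qed (use comb in auto)
  have Q: "Q = MD.S (Suc n)" by (auto simp: Q_def MD.S_def D_def)
  show "all_moments M Q" unfolding Q by (rule MD.S_moments) simp
  show "expectation (\<lambda>\<omega>. Y \<omega> * Q \<omega>) = 0" if Y: "Y \<in> borel_measurable (F s)" "integrable M (\<lambda>\<omega>. (Y \<omega>)\<^sup>2)"
  proof -
    have "Y \<in> borel_measurable M" by (rule F_measurable[OF st(1) Y(1)])
    then have int: "integrable M (\<lambda>\<omega>. Y \<omega> * D i \<omega>)" if "i \<in> {..<Suc n}" for i
      using comb(2)[of i] that by (intro integrable_mult_square Y power_integrable) (auto intro:
          all_moments_measurable)
    have "expectation (\<lambda>\<omega>. Y \<omega> * Q \<omega>) = (\<Sum>i<Suc n. expectation (\<lambda>\<omega>. Y \<omega> * D i \<omega>))"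
      unfolding Q MD.S_def sum_distrib_left by (intro Bochner_Integration.integral_sum int)
    also have "\<dots> = 0"
    proof (rule sum.neutral, safe)
      fix i assume i: "i < Suc n"
      have "Y \<in> borel_measurable (F (?g i))" using F_mono[OF st(1) _ Y(1)] gm[of 0 i] by simp
      then show "expectation (\<lambda>\<omega>. Y \<omega> * D i \<omega>) = 0" using comb(3)[OF i] Y(2) by simp
    qed
    finally show ?thesis .
  qed
  show "even_moment q Q \<le> Riemann_const q * e * (t - s) ^ q"
    if q: "q \<ge> 1" and e: "\<And>i j. i < Suc n \<Longrightarrow> j \<in> {1..d} \<Longrightarrow> even_moment q (\<eta> i j) \<le> e"
  proof -
    define b where "b = real d ^ (2 * q) * (e * (gauss_moment q * ((t - s) / real (Suc n)) ^ q))"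
    have D: "even_moment q (D i) \<le> b" if i: "i < Suc n" for i
      using comb4[OF i q e[OF i]] by (simp add: b_def grid_step)
    have "even_moment q Q \<le>
      exp (4 ^ q) * 2 * 4 ^ q * real (Suc n) ^ (q - 1) * (\<Sum>i<Suc n. even_moment q (D i))"
      unfolding Q using q by (intro MD.moment_bound) auto
    also have "\<dots> \<le> exp (4 ^ q) * 2 * 4 ^ q * real (Suc n) ^ (q - 1) * (\<Sum>i<Suc n. b)"
      by (intro mult_left_mono sum_mono D) auto
    also have "\<dots> = exp (4 ^ q) * 2 * 4 ^ q * (real (Suc n) ^ (q - 1) * real (Suc n)) * b"
      by (simp only: sum_constant card_lessThan mult.assoc)
    also have "real (Suc n) ^ (q - 1) * real (Suc n) = real (Suc n) ^ q"
      using q by (cases q) (simp_all del: of_nat_Suc)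
    also have "exp (4 ^ q) * 2 * 4 ^ q * real (Suc n) ^ q * b =
      exp (4 ^ q) * 2 * 4 ^ q * (real d ^ (2 * q) * (e * (gauss_moment q * (real (Suc n) ^ q * ((t - s) /
          real (Suc n)) ^ q))))"
      by (simp only: b_def mult_ac)
    also have "real (Suc n) ^ q * ((t - s) / real (Suc n)) ^ q = (t - s) ^ q"
      by (simp flip: power_mult_distrib del: of_nat_Suc)
    finally show ?thesis by (simp only: Riemann_const_def mult_ac)
  qed
qed

end

locale sde = driven M F d B B' for M :: "'w measure" and F :: "real \<Rightarrow> 'w measure"
    and d :: nat and B B' :: "nat \<Rightarrow> real \<Rightarrow> 'w \<Rightarrow> real" +
  fixes \<sigma> :: "nat \<Rightarrow> real^'n \<Rightarrow> real^'n" and T :: real and x :: "real^'n" and X :: "real \<Rightarrow> 'w \<Rightarrow> real^'n"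
    and K L :: real
  assumes T: "T > 0"
    and solution: "sde_solution M F d \<sigma> B T x X"
    and \<sigma>_bound: "j \<le> d \<Longrightarrow> \<bar>\<sigma> j z $ c\<bar> \<le> K"
    and \<sigma>_Lipschitz: "j \<le> d \<Longrightarrow> \<bar>\<sigma> j z $ c - \<sigma> j y $ c\<bar> \<le> L * norm (z - y)"
    and K0: "K \<ge> 0" and L0: "L \<ge> 0"
begin

lemma \<sigma>_continuous: "j \<le> d \<Longrightarrow> continuous_on UNIV (\<lambda>z. \<sigma> j z $ c)"
  unfolding continuous_on_iff
proof safe
  fix z :: "real^'n" and e :: real assume j: "j \<le> d" and e: "e > 0"
  have "dist (\<sigma> j y $ c) (\<sigma> j z $ c) < e" if "dist y z < e / (L + 1)" for y
  proof -
    have "dist (\<sigma> j y $ c) (\<sigma> j z $ c) \<le> L * dist y z"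
      using \<sigma>_Lipschitz[OF j, of y c z] by (simp add: dist_norm)
    also have "\<dots> \<le> (L + 1) * dist y z" by (intro mult_right_mono) auto
    also have "\<dots> < e" using that L0 by (simp add: field_simps)
    finally show ?thesis .
  qed
  then show "\<exists>d>0. \<forall>x'\<in>UNIV. dist x' z < d \<longrightarrow> dist (\<sigma> j x' $ c) (\<sigma> j z $ c) < e"
    using e L0 by (intro exI[of _ "e / (L + 1)"]) auto
qed

lemma X_adapted: "t \<in> {0..T} \<Longrightarrow> X t \<in> borel_measurable (F t)"
  using solution by (simp add: sde_solution_def)

lemma X_measurable: "t \<in> {0..T} \<Longrightarrow> X t \<in> borel_measurable M"
  using X_adapted measurable_from_subalg[OF subalgebra_F] by auto

lemma X_continuous: "\<omega> \<in> space M \<Longrightarrow> continuous_on {0..T} (\<lambda>t. X t \<omega>)"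
  using solution by (simp add: sde_solution_def)

lemma X_initial: "AE \<omega> in M. X 0 \<omega> = x"
  using solution by (simp add: sde_solution_def)

lemma \<sigma>X_adapted: "j \<le> d \<Longrightarrow> t \<in> {0..T} \<Longrightarrow> (\<lambda>\<omega>. \<sigma> j (X t \<omega>) $ c) \<in> borel_measurable (F t)"
  by (rule measurable_compose[OF X_adapted borel_measurable_continuous_onI[OF \<sigma>_continuous]])

lemma \<sigma>X_continuous: "j \<le> d \<Longrightarrow> 0 \<le> s \<Longrightarrow> t \<le> T \<Longrightarrow> \<omega> \<in> space M \<Longrightarrow> continuous_on {s..t} (\<lambda>v. \<sigma> j (X v \<omega>) $ c)"
  by (rule continuous_on_compose2[OF \<sigma>_continuous continuous_on_subset[OF X_continuous]]) auto

lemma \<sigma>X_moments: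
  assumes "j \<le> d" "t \<in> {0..T}"
  shows "all_moments M (\<lambda>\<omega>. \<sigma> j (X t \<omega>) $ c)"
  by (rule all_moments_bound[OF all_moments_const[of K]])
    (use F_measurable[OF _ \<sigma>X_adapted[OF assms]] assms \<sigma>_bound[OF assms(1)] K0 in auto)

definition drift :: "real \<Rightarrow> real \<Rightarrow> 'n \<Rightarrow> 'w \<Rightarrow> real"
  where "drift s t c \<omega> = integral {s..t} (\<lambda>v. \<sigma> 0 (X v \<omega>) $ c)"

text \<open>The sum of the stochastic integrals up to time \<open>t\<close>, recovered from \<open>X\<close> and its drift. In this form
  it is adapted, whereas the integrals are only measurable with respect to \<open>M\<close>.\<close>

definition mart :: "real \<Rightarrow> 'n \<Rightarrow> 'w \<Rightarrow> real"
  where "mart t c \<omega> = X t \<omega> $ c - x $ c - drift 0 t c \<omega>"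

lemma drift_adapted: "0 \<le> s \<Longrightarrow> s \<le> t \<Longrightarrow> t \<le> T \<Longrightarrow> drift s t c \<in> borel_measurable (F t)"
  unfolding drift_def[abs_def]
  by (intro time_integral_measurable F_mono[OF _ _ \<sigma>X_adapted] \<sigma>X_continuous) (auto simp: space_F)

lemma mart_adapted: "t \<in> {0..T} \<Longrightarrow> mart t c \<in> borel_measurable (F t)"
  unfolding mart_def[abs_def]
  by (intro borel_measurable_diff drift_adapted measurable_compose[OF X_adapted vec_nth_borel]) auto

lemma drift_split:
  assumes "0 \<le> s" "s \<le> t" "t \<le> T" "\<omega> \<in> space M"
  shows "drift 0 t c \<omega> = drift 0 s c \<omega> + drift s t c \<omega>"
  unfolding drift_def using assms
  by (intro Henstock_Kurzweil_Integration.integral_combine[symmetric] integrable_continuous_real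
      \<sigma>X_continuous) auto

lemma mart_increment:
  assumes "0 \<le> s" "s \<le> t" "t \<le> T" "\<omega> \<in> space M"
  shows "X t \<omega> $ c - X s \<omega> $ c = drift s t c \<omega> + (mart t c \<omega> - mart s c \<omega>)"
  using drift_split[OF assms, of c] by (simp add: mart_def)

lemma mart_ito:
  assumes "t \<in> {0..T}"
  shows "\<exists>I. (\<forall>j\<in>{1..d}. has_ito_integral M F (B j) 0 t (\<lambda>s \<omega>. \<sigma> j (X s \<omega>) $ c) (I j)) \<and>
    (AE \<omega> in M. mart t c \<omega> = (\<Sum>j=1..d. I j \<omega>))"
proof -
  obtain I where I: "\<And>j. j \<in> {1..d} \<Longrightarrow> has_ito_integral M F (B j) 0 t (\<lambda>s \<omega>. \<sigma> j (X s \<omega>)) (I j)"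
    and X: "AE \<omega> in M. X t \<omega> = x + integral {0..t} (\<lambda>s. \<sigma> 0 (X s \<omega>)) + (\<Sum>j=1..d. I j \<omega>)"
    using solution assms unfolding sde_solution_def by blast
  have "AE \<omega> in M. mart t c \<omega> = (\<Sum>j=1..d. I j \<omega> $ c)"
    using X AE_space
  proof eventually_elim
    case (elim \<omega>)
    have "continuous_on {0..t} (\<lambda>s. \<sigma> 0 (X s \<omega>))"
    proof -
      have "continuous_on {0..t} (\<lambda>s. \<chi> c. \<sigma> 0 (X s \<omega>) $ c)"
        using \<sigma>X_continuous[of 0 0 t \<omega>] assms elim(2) by (intro continuous_on_vec_lambda) auto
      then show ?thesis by simp
    qed
    then have "integral {0..t} (\<lambda>s. \<sigma> 0 (X s \<omega>)) $ c = drift 0 t c \<omega>"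
      unfolding drift_def by (intro integral_component_eq_cart[symmetric] integrable_continuous_real)
    then show ?case using elim(1) by (simp add: mart_def)
  qed
  then show ?thesis
    using has_ito_integral_component[OF I] by (intro exI[of _ "\<lambda>j \<omega>. I j \<omega> $ c"]) auto
qed

definition Riemann_mart :: "real \<Rightarrow> real \<Rightarrow> 'n \<Rightarrow> nat \<Rightarrow> 'w \<Rightarrow> real"
  where "Riemann_mart s t c n \<omega> = (\<Sum>i<Suc n. \<Sum>j=1..d. \<sigma> j (X (grid s t (Suc n) i) \<omega>) $ c *
     dB B j (grid s t (Suc n) i) (grid s t (Suc n) (Suc i)) \<omega>)"

lemma mart_Riemann:
  assumes st: "0 \<le> s" "s \<le> t" "t \<le> T"
  shows "L2_tendsto M (Riemann_mart s t c) (\<lambda>\<omega>. mart t c \<omega> - mart s c \<omega>)"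
proof -
  have sT: "s \<in> {0..T}" "t \<in> {0..T}" using st by auto
  obtain I1 where I1: "\<And>j. j \<in> {1..d} \<Longrightarrow> has_ito_integral M F (B j) 0 s (\<lambda>s \<omega>. \<sigma> j (X s \<omega>) $ c) (I1 j)"
    and E1: "AE \<omega> in M. mart s c \<omega> = (\<Sum>j=1..d. I1 j \<omega>)" using mart_ito[of s c] sT by blast
  obtain I2 where I2: "\<And>j. j \<in> {1..d} \<Longrightarrow> has_ito_integral M F (B j) 0 t (\<lambda>s \<omega>. \<sigma> j (X s \<omega>) $ c) (I2 j)"
    and E2: "AE \<omega> in M. mart t c \<omega> = (\<Sum>j=1..d. I2 j \<omega>)" using mart_ito[of t c] sT by blast
  have lim: "L2_tendsto M (\<lambda>n \<omega>. \<Sum>i<Suc n. \<sigma> j (X (grid s t (Suc n) i) \<omega>) $ c *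
     dB B j (grid s t (Suc n) i) (grid s t (Suc n) (Suc i)) \<omega>) (\<lambda>\<omega>. I2 j \<omega> - I1 j \<omega>)" if j: "j \<in> {1..d}" for j
  proof -
    have "L2_tendsto M (\<lambda>n \<omega>. \<Sum>i<Suc n. (B j (grid s t (Suc n) (Suc i)) \<omega> - B j (grid s t (Suc n) i) \<omega>) *
       \<sigma> j (X (grid s t (Suc n) i) \<omega>) $ c) (\<lambda>\<omega>. I2 j \<omega> - I1 j \<omega>)"
      by (rule wiener.ito_increment_Riemann[OF wiener_B[OF j] I1[OF j] I2[OF j] st(1,2), where K = K])
        (use j st in \<open>auto intro!: \<sigma>X_adapted \<sigma>X_continuous \<sigma>_bound\<close>)
    then show ?thesis using j by (simp add: dB_eq mult.commute del: sum.lessThan_Suc)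
  qed
  have swap: "Riemann_mart s t c = (\<lambda>n \<omega>. \<Sum>j=1..d. \<Sum>i<Suc n. \<sigma> j (X (grid s t (Suc n) i) \<omega>) $ c *
     dB B j (grid s t (Suc n) i) (grid s t (Suc n) (Suc i)) \<omega>)"
    unfolding Riemann_mart_def by (intro ext) (rule sum.swap)
  have "L2_tendsto M (Riemann_mart s t c) (\<lambda>\<omega>. \<Sum>j=1..d. I2 j \<omega> - I1 j \<omega>)"
    unfolding swap by (rule L2_tendsto_sum[OF lim])
  then show ?thesis
  proof (rule L2_tendsto_cong_AE)
    show "(\<lambda>\<omega>. mart t c \<omega> - mart s c \<omega>) \<in> borel_measurable M"
      using st by (intro borel_measurable_diff F_measurable[OF _ mart_adapted]) auto
    show "AE \<omega> in M. (\<Sum>j=1..d. I2 j \<omega> - I1 j \<omega>) = mart t c \<omega> - mart s c \<omega>"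
      using E1 E2 by eventually_elim (simp add: sum_subtractf)
  qed
qed

lemma grid_time: "0 \<le> s \<Longrightarrow> s \<le> t \<Longrightarrow> t \<le> T \<Longrightarrow> i < Suc n \<Longrightarrow> grid s t (Suc n) i \<in> {0..T}"
  using grid_range[of s t i "Suc n"] by auto

text \<open>All three properties hold for the left-point sums and pass to their mean square limit.\<close>

lemma mart_moments:
  assumes st: "0 \<le> s" "s \<le> t" "t \<le> T"
  shows mart_all_moments: "all_moments M (\<lambda>\<omega>. mart t c \<omega> - mart s c \<omega>)"
    and mart_moment_bound: "q \<ge> 1 \<Longrightarrow> even_moment q (\<lambda>\<omega>. mart t c \<omega> - mart s c \<omega>) \<le>
        Riemann_const q * K ^ (2 * q) * (t - s) ^ q"
    and mart_orthogonal: "Y \<in> borel_measurable (F s) \<Longrightarrow> integrable M (\<lambda>\<omega>. (Y \<omega>)\<^sup>2) \<Longrightarrow>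
      expectation (\<lambda>\<omega>. Y \<omega> * (mart t c \<omega> - mart s c \<omega>)) = 0"
proof -
  have mom: "all_moments M (Riemann_mart s t c n)" for n
    using st unfolding Riemann_mart_def[abs_def]
    by (intro stochastic_sum_moments(1) \<sigma>X_adapted \<sigma>X_moments grid_time) auto
  have bound: "even_moment q (Riemann_mart s t c n) \<le> Riemann_const q * K ^ (2 * q) * (t - s) ^ q" if q:
      "q \<ge> 1" for n q
    unfolding Riemann_mart_def
  proof (rule stochastic_sum_moments(3)[OF st(1,2) _ _ q])
    fix i j assume ij: "i < Suc n" "j \<in> {1..d}"
    have b: "(\<sigma> j z $ c) ^ (2 * q) \<le> K ^ (2 * q)" for z
      using power_mono[OF \<sigma>_bound[of j z c], of "2 * q"] ij by (simp add: power_even_abs)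
    have "even_moment q (\<lambda>\<omega>. \<sigma> j (X (grid s t (Suc n) i) \<omega>) $ c) \<le> even_moment q (\<lambda>\<omega>. K)"
      using ij st by (intro integral_mono[OF power_integrable integrable_const] \<sigma>X_moments grid_time b) auto
    then show "even_moment q (\<lambda>\<omega>. \<sigma> j (X (grid s t (Suc n) i) \<omega>) $ c) \<le> K ^ (2 * q)"
      by (simp add: prob_space)
  qed (use st in \<open>auto intro!: \<sigma>X_adapted \<sigma>X_moments grid_time\<close>)
  note lim = mart_Riemann[OF st, of c]
  show m: "all_moments M (\<lambda>\<omega>. mart t c \<omega> - mart s c \<omega>)"
    by (rule L2_limit_moments(1)[OF mom lim bound])
  show "even_moment q (\<lambda>\<omega>. mart t c \<omega> - mart s c \<omega>) \<le> Riemann_const q * K ^ (2 * q) * (t - s) ^ q" if "q \<ge> 1"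
    by (rule L2_limit_moments(2)[OF mom lim bound that])
  show "expectation (\<lambda>\<omega>. Y \<omega> * (mart t c \<omega> - mart s c \<omega>)) = 0"
    if Y: "Y \<in> borel_measurable (F s)" "integrable M (\<lambda>\<omega>. (Y \<omega>)\<^sup>2)"
  proof (rule L2_limit_orthogonal[OF F_measurable[OF st(1) Y(1)] Y(2) mom m lim])
    show "expectation (\<lambda>\<omega>. Y \<omega> * Riemann_mart s t c n \<omega>) = 0" for n
      unfolding Riemann_mart_def
      by (rule stochastic_sum_moments(2)[OF st(1,2) _ _ Y]) (use st in \<open>auto intro!: \<sigma>X_adapted
          \<sigma>X_moments grid_time\<close>)
  qed
qed

end

section \<open>Accumulation of one-step errors\<close>

lemma (in prob_space) even_moment_add_le:
  assumes "all_moments M f" "all_moments M g"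
    and "even_moment q f \<le> \<alpha>" "even_moment q g \<le> \<beta>"
  shows "even_moment q (\<lambda>\<omega>. f \<omega> + g \<omega>) \<le> 4 ^ q * (\<alpha> + \<beta>)"
proof -
  have int: "integrable M (\<lambda>\<omega>. f \<omega> ^ (2 * q))" "integrable M (\<lambda>\<omega>. g \<omega> ^ (2 * q))"
    using assms by (auto intro: power_integrable)
  have "even_moment q (\<lambda>\<omega>. f \<omega> + g \<omega>) \<le> expectation (\<lambda>\<omega>. 4 ^ q * (f \<omega> ^ (2 * q) + g \<omega> ^ (2 * q)))"
    using int by (intro integral_mono power_integrable all_moments_add assms even_power_sum_le) auto
  also have "\<dots> = 4 ^ q * (even_moment q f + even_moment q g)"
    using int by simp
  also have "\<dots> \<le> 4 ^ q * (\<alpha> + \<beta>)" using assms by (intro mult_left_mono add_mono) auto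
  finally show ?thesis .
qed

lemma norm_even_power_le:
  fixes v :: "real^'n"
  assumes "q \<ge> 1"
  shows "norm v ^ (2 * q) \<le> real CARD('n) ^ (2 * q - 1) * (\<Sum>c\<in>UNIV. (v $ c) ^ (2 * q))"
proof -
  have "norm v \<le> \<bar>\<Sum>c\<in>UNIV. \<bar>v $ c\<bar>\<bar>"
    using norm_le_l1_cart[of v] by linarith
  then have "norm v ^ (2 * q) \<le> \<bar>\<Sum>c\<in>UNIV. \<bar>v $ c\<bar>\<bar> ^ (2 * q)" by (intro power_mono) auto
  also have "\<dots> \<le> real (card (UNIV::'n set)) ^ (2 * q - 1) * (\<Sum>c\<in>UNIV. \<bar>\<bar>v $ c\<bar>\<bar> ^ (2 * q))"
    using assms by (intro abs_sum_power_le) auto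
  finally show ?thesis by (simp only: abs_idempotent even_power_abs)
qed

lemma (in prob_space) norm_all_moments:
  fixes V :: "'a \<Rightarrow> real^'n"
  assumes V: "V \<in> borel_measurable M" and m: "\<And>c. all_moments M (\<lambda>\<omega>. V \<omega> $ c)"
  shows "all_moments M (\<lambda>\<omega>. norm (V \<omega>))"
proof (rule all_moments_bound)
  show "all_moments M (\<lambda>\<omega>. \<Sum>c\<in>UNIV. \<bar>V \<omega> $ c\<bar>)"
    by (intro all_moments_sum all_moments_abs m)
  show "(\<lambda>\<omega>. norm (V \<omega>)) \<in> borel_measurable M" using V by measurable
  show "AE \<omega> in M. \<bar>norm (V \<omega>)\<bar> \<le> \<bar>\<Sum>c\<in>UNIV. \<bar>V \<omega> $ c\<bar>\<bar>"
    using norm_le_l1_cart by (intro AE_I2) (simp add: order_trans[OF _ abs_ge_self])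
qed

lemma (in prob_space) norm_moment_le:
  fixes V :: "'a \<Rightarrow> real^'n"
  assumes V: "V \<in> borel_measurable M" and m: "\<And>c. all_moments M (\<lambda>\<omega>. V \<omega> $ c)"
    and q: "q \<ge> 1" and b: "\<And>c. even_moment q (\<lambda>\<omega>. V \<omega> $ c) \<le> b"
  shows "even_moment q (\<lambda>\<omega>. norm (V \<omega>)) \<le> real CARD('n) ^ (2 * q) * b"
proof -
  have "even_moment q (\<lambda>\<omega>. norm (V \<omega>)) \<le> even_moment q (\<lambda>\<omega>. \<Sum>c\<in>UNIV. \<bar>V \<omega> $ c\<bar>)"
    using norm_le_l1_cart
    by (intro even_moment_mono norm_all_moments[OF V m] all_moments_sum all_moments_abs m) simp
  also have "\<dots> \<le> real (card (UNIV :: 'n set)) ^ (2 * q) * b"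
    by (rule sum_even_moment_le[OF _ all_moments_abs[OF m] q]) (use b in \<open>simp_all only: even_power_abs
        finite_class.finite_UNIV\<close>)
  finally show ?thesis .
qed

lemma discrete_Gronwall:
  fixes b :: "nat \<Rightarrow> real"
  assumes "A \<ge> 0" "\<mu> \<ge> 0" and b: "\<And>k. k \<le> n \<Longrightarrow> b k \<le> A + \<mu> * (\<Sum>i<k. b i)"
  shows "k \<le> n \<Longrightarrow> A + \<mu> * (\<Sum>i<k. b i) \<le> A * (1 + \<mu>) ^ k"
proof (induction k)
  case (Suc k)
  have "A + \<mu> * (\<Sum>i<Suc k. b i) = (A + \<mu> * (\<Sum>i<k. b i)) + \<mu> * b k" by (simp add: algebra_simps)
  also have "\<dots> \<le> (1 + \<mu>) * (A + \<mu> * (\<Sum>i<k. b i))"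
    using mult_left_mono[OF b[of k] assms(2)] Suc by (simp add: algebra_simps)
  also have "\<dots> \<le> (1 + \<mu>) * (A * (1 + \<mu>) ^ k)" using Suc assms by (intro mult_left_mono) auto
  finally show ?case by (simp add: mult_ac)
qed simp

definition martingale_const :: "nat \<Rightarrow> real"
  where "martingale_const q = exp (4 ^ q) * 2 * 4 ^ q"

text \<open>Over \<open>n = T / h\<close> steps the remainders add up to \<open>n\<close> times their size \<open>h\<^sup>3\<^sup>/\<^sup>2\<close> and the martingale
  differences to \<open>n\<^sup>1\<^sup>/\<^sup>2\<close> times their size \<open>h\<close>. Both are of order \<open>h\<^sup>1\<^sup>/\<^sup>2\<close>, and the feedback from \<open>e\<close>
  is of the form required by Gronwall's inequality.\<close>

lemma error_recursion:
  fixes e :: "nat \<Rightarrow> 'w \<Rightarrow> real^'n" and P D :: "'n \<Rightarrow> nat \<Rightarrow> 'w \<Rightarrow> real"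
  assumes MD: "\<And>c. martingale_differences M G (D c) n"
    and P: "\<And>c i. i < n \<Longrightarrow> all_moments M (P c i)"
    and e: "\<And>k c \<omega>. k \<le> n \<Longrightarrow> e k \<omega> $ c = (\<Sum>i<k. P c i \<omega>) + (\<Sum>i<k. D c i \<omega>)"
    and e_meas: "\<And>k. k \<le> n \<Longrightarrow> e k \<in> borel_measurable M"
    and q: "q \<ge> 1" "even q" and h: "h > 0" "real n * h = T" and \<kappa>: "\<kappa> \<ge> 0"
    and bP: "\<And>c i. i < n \<Longrightarrow> (\<integral>\<omega>. P c i \<omega> ^ (2 * q) \<partial>M) \<le>
        \<kappa> * h ^ (2 * q) * (h ^ q + (\<integral>\<omega>. norm (e i \<omega>) ^ (2 * q) \<partial>M))"
    and bD: "\<And>c i. i < n \<Longrightarrow> (\<integral>\<omega>. D c i \<omega> ^ (2 * q) \<partial>M) \<le> \<kappa> * h ^ q * (h ^ q + (\<integral>\<omega>. norm (e i \<omega>) ^ (2 * q) \<partial>M))"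
  defines "\<Lambda> \<equiv> real CARD('n) ^ (2 * q) * (4 ^ q * (\<kappa> * (T ^ (2 * q - 1) + 4 * martingale_const q * T ^ (q - 1))))"
  shows "\<exists>Z. integrable M Z \<and> (\<forall>k\<le>n. \<forall>\<omega>. norm (e k \<omega>) ^ (2 * q) \<le> Z \<omega>) \<and>
    (\<integral>\<omega>. Z \<omega> \<partial>M) \<le> \<Lambda> * T * exp (\<Lambda> * T) * h ^ q"
proof -
  interpret prob_space M using MD by (auto simp: martingale_differences_def)
  have T: "T \<ge> 0" using h by (metis mult_nonneg_nonneg of_nat_0_le_iff less_imp_le)
  define SS where "SS c = martingale_differences.S (D c)" for c
  have SS: "SS c k \<omega> = (\<Sum>i<k. D c i \<omega>)" for c k \<omega>
    unfolding SS_def by (rule martingale_differences.S_def[OF MD])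
  have SS_mom: "all_moments M (SS c k)" if "k \<le> n" for c k
    unfolding SS_def by (rule martingale_differences.S_moments[OF MD that])
  define PP where "PP c k \<omega> = (\<Sum>i<k. P c i \<omega>)" for c k \<omega>
  have PP_mom: "all_moments M (PP c k)" if "k \<le> n" for c k
    unfolding PP_def[abs_def] using that by (intro all_moments_sum P) auto
  have ec: "e k \<omega> $ c = PP c k \<omega> + SS c k \<omega>" if "k \<le> n" for k \<omega> c
    using e[OF that] by (simp add: PP_def SS)
  have ec_mom: "all_moments M (\<lambda>\<omega>. e k \<omega> $ c)" if "k \<le> n" for k c
    unfolding ec[OF that] by (intro all_moments_add PP_mom SS_mom that)
  define a where "a k = even_moment q (\<lambda>\<omega>. norm (e k \<omega>))" for k
  define b where "b k = h ^ q + a k" for k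
  have a0: "a k \<ge> 0" for k unfolding a_def by (intro Bochner_Integration.integral_nonneg) auto
  have b0: "b k \<ge> 0" for k using a0[of k] h by (simp add: b_def)
  define cm where "cm = martingale_const q"
  have cm0: "cm \<ge> 0" by (simp add: cm_def martingale_const_def)
  have nh: "real n ^ (2 * q - 1) * h ^ (2 * q) = T ^ (2 * q - 1) * h" "real n ^ (q - 1) * h ^ q = T ^ (q - 1) * h"
  proof -
    have "h ^ (2 * q) = h ^ (2 * q - 1) * h" "h ^ q = h ^ (q - 1) * h" using q by (simp_all flip: power_Suc2)
    then show "real n ^ (2 * q - 1) * h ^ (2 * q) = T ^ (2 * q - 1) * h" "real n ^ (q - 1) * h ^ q =
        T ^ (q - 1) * h"
      by (simp_all only: h(2)[symmetric] power_mult_distrib mult.assoc)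
  qed
  have PPb: "\<bar>PP c k \<omega>\<bar> ^ (2 * q) \<le> real n ^ (2 * q - 1) * (\<Sum>i<k. P c i \<omega> ^ (2 * q))" if "k \<le> n" for c k \<omega>
  proof -
    have "\<bar>PP c k \<omega>\<bar> ^ (2 * q) \<le> real (card {..<k}) ^ (2 * q - 1) * (\<Sum>i<k. \<bar>P c i \<omega>\<bar> ^ (2 * q))"
      unfolding PP_def using q by (intro abs_sum_power_le) auto
    also have "\<dots> \<le> real n ^ (2 * q - 1) * (\<Sum>i<k. \<bar>P c i \<omega>\<bar> ^ (2 * q))"
      using that by (intro mult_right_mono power_mono sum_nonneg) auto
    finally show ?thesis by (simp only: even_power_abs)
  qed
  have EP: "real n ^ (2 * q - 1) * (\<Sum>i<k. even_moment q (P c i)) \<le>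
      \<kappa> * T ^ (2 * q - 1) * h * (\<Sum>i<k. b i)" if "k \<le> n" for c k
  proof -
    have "real n ^ (2 * q - 1) * (\<Sum>i<k. even_moment q (P c i)) \<le>
        real n ^ (2 * q - 1) * (\<Sum>i<k. \<kappa> * h ^ (2 * q) * b i)"
      using that bP by (intro mult_left_mono sum_mono) (auto simp: b_def a_def)
    also have "\<dots> = \<kappa> * (real n ^ (2 * q - 1) * h ^ (2 * q)) * (\<Sum>i<k. b i)"
      unfolding sum_distrib_left[symmetric] by (simp only: mult_ac)
    finally show ?thesis unfolding nh by (simp add: mult_ac)
  qed
  have ED: "real n ^ (q - 1) * (\<Sum>i<k. even_moment q (D c i)) \<le> \<kappa> * T ^ (q - 1) * h * (\<Sum>i<k. b i)" if "k \<le>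
      n" for c k
  proof -
    have "real n ^ (q - 1) * (\<Sum>i<k. even_moment q (D c i)) \<le> real n ^ (q - 1) * (\<Sum>i<k. \<kappa> * h ^ q * b i)"
      using that bD by (intro mult_left_mono sum_mono) (auto simp: b_def a_def)
    also have "\<dots> = \<kappa> * (real n ^ (q - 1) * h ^ q) * (\<Sum>i<k. b i)"
      unfolding sum_distrib_left[symmetric] by (simp only: mult_ac)
    finally show ?thesis unfolding nh by (simp add: mult_ac)
  qed
  have ESS: "even_moment q (SS c k) \<le> cm * (\<kappa> * T ^ (q - 1) * h * (\<Sum>i<k. b i))" if k: "k \<le> n" for c k
  proof -
    have "even_moment q (SS c k) \<le> cm * (real n ^ (q - 1) * (\<Sum>i<k. even_moment q (D c i)))"
      using martingale_differences.moment_bound[OF MD k q(1), of c] by (simp add: SS_def cm_def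
          martingale_const_def mult_ac)
    also have "\<dots> \<le> cm * (\<kappa> * T ^ (q - 1) * h * (\<Sum>i<k. b i))" by (intro mult_left_mono ED[OF k] cm0)
    finally show ?thesis .
  qed
  have EPP: "even_moment q (PP c k) \<le> \<kappa> * T ^ (2 * q - 1) * h * (\<Sum>i<k. b i)" if k: "k \<le> n" for c k
  proof -
    have int: "integrable M (\<lambda>\<omega>. P c i \<omega> ^ (2 * q))" if "i \<in> {..<k}" for i using P that k by (auto intro:
        power_integrable)
    have "even_moment q (PP c k) \<le> expectation (\<lambda>\<omega>. real n ^ (2 * q - 1) * (\<Sum>i<k. P c i \<omega> ^ (2 * q)))"
    proof (rule integral_mono)
      show "integrable M (\<lambda>\<omega>. PP c k \<omega> ^ (2 * q))" by (intro power_integrable PP_mom k)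
      show "integrable M (\<lambda>\<omega>. real n ^ (2 * q - 1) * (\<Sum>i<k. P c i \<omega> ^ (2 * q)))"
        by (intro integrable_mult_right Bochner_Integration.integrable_sum int)
      show "PP c k \<omega> ^ (2 * q) \<le> real n ^ (2 * q - 1) * (\<Sum>i<k. P c i \<omega> ^ (2 * q))" for \<omega>
        using PPb[OF k, of c \<omega>] by (simp only: even_power_abs)
    qed
    also have "\<dots> = real n ^ (2 * q - 1) * (\<Sum>i<k. even_moment q (P c i))"
      using int by (simp add: Bochner_Integration.integral_sum)
    also have "\<dots> \<le> \<kappa> * T ^ (2 * q - 1) * h * (\<Sum>i<k. b i)" by (rule EP[OF k])
    finally show ?thesis .
  qed
  define \<mu> where "\<mu> = \<Lambda> * h"
  have \<Lambda>0: "\<Lambda> \<ge> 0" unfolding \<Lambda>_def using \<kappa> T by (simp add: martingale_const_def)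
  have \<mu>0: "\<mu> \<ge> 0" using \<Lambda>0 h by (simp add: \<mu>_def)
  have \<mu>_eq: "\<mu> = real CARD('n) ^ (2 * q) * (4 ^ q * (\<kappa> * T ^ (2 * q - 1) * h + 4 * cm * (\<kappa> * T ^ (q - 1) * h)))"
    by (simp add: \<mu>_def \<Lambda>_def cm_def algebra_simps)
  (* The feedback is closed with the moments of e at single times; the maximum is only taken
     afterwards, when the right-hand sides are known to be of order h^q. *)
  have gron: "b k \<le> h ^ q + \<mu> * (\<Sum>i<k. b i)" if k: "k \<le> n" for k
  proof -
    let ?s = "\<Sum>i<k. b i"
    have s0: "?s \<ge> 0" by (intro sum_nonneg b0)
    have "a k \<le> real CARD('n) ^ (2 * q) * (4 ^ q * (\<kappa> * T ^ (2 * q - 1) * h * ?s + cm * (\<kappa> * T ^ (q - 1)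
        * h * ?s)))"
      unfolding a_def
    proof (rule norm_moment_le[OF e_meas[OF k] ec_mom[OF k] q(1)])
      show "even_moment q (\<lambda>\<omega>. e k \<omega> $ c) \<le> 4 ^ q * (\<kappa> * T ^ (2 * q - 1) * h * ?s + cm * (\<kappa> * T ^ (q - 1)
          * h * ?s))" for c
        unfolding ec[OF k] by (rule even_moment_add_le[OF PP_mom[OF k] SS_mom[OF k] EPP[OF k] ESS[OF k]])
    qed
    also have "\<dots> \<le> real CARD('n) ^ (2 * q) * (4 ^ q * (\<kappa> * T ^ (2 * q - 1) * h * ?s + (4 * cm) * (\<kappa> * T ^
        (q - 1) * h * ?s)))"
      using cm0 \<kappa> T h s0 by (intro mult_left_mono add_left_mono mult_right_mono) auto
    also have "\<dots> = \<mu> * ?s" by (simp add: \<mu>_eq algebra_simps)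
    finally show ?thesis by (simp add: b_def)
  qed
  have hq: "h ^ q \<ge> 0" using h by simp
  have exp_bound: "(1 + \<mu>) ^ k \<le> exp (\<Lambda> * T)" if "k \<le> n" for k
  proof -
    have "(1 + \<mu>) ^ k \<le> (1 + \<mu>) ^ n" using that \<mu>0 by (intro power_increasing) auto
    also have "\<dots> \<le> exp \<mu> ^ n" using \<mu>0 by (intro power_mono exp_ge_add_one_self) auto
    also have "\<dots> = exp (\<Lambda> * T)" by (simp add: exp_of_nat_mult[symmetric] \<mu>_def h(2)[symmetric] mult_ac)
    finally show ?thesis .
  qed
  have bk: "b k \<le> h ^ q * exp (\<Lambda> * T)" if k: "k \<le> n" for k
  proof -
    have "b k \<le> h ^ q * (1 + \<mu>) ^ k"
      using gron[OF k] discrete_Gronwall[OF hq \<mu>0 gron k] by linarith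
    also have "\<dots> \<le> h ^ q * exp (\<Lambda> * T)" by (intro mult_left_mono exp_bound[OF k] hq)
    finally show ?thesis .
  qed
  have sumb: "h * (\<Sum>i<n. b i) \<le> T * (h ^ q * exp (\<Lambda> * T))"
  proof -
    have "h * (\<Sum>i<n. b i) \<le> h * (\<Sum>i<n. h ^ q * exp (\<Lambda> * T))"
      using h bk by (intro mult_left_mono sum_mono) auto
    also have "\<dots> = (real n * h) * (h ^ q * exp (\<Lambda> * T))" by (simp add: mult_ac)
    finally show ?thesis by (simp add: h)
  qed
  (* Now the maximum over k: Doob's inequality for the martingale part, and the sum of the
     absolute values for the remainders. *)
  define SM where "SM c = martingale_differences.Smax (D c) q n" for c
  have SM_mom: "all_moments M (SM c)" for c
    unfolding SM_def by (rule martingale_differences.Smax_moments[OF MD order_refl])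
  have SM_ge: "SS c k \<omega> ^ (2 * q) \<le> (SM c \<omega>)\<^sup>2" if "k \<le> n" for c k \<omega>
  proof -
    have "SS c k \<omega> ^ q \<le> SM c \<omega>" unfolding SS_def SM_def by (rule martingale_differences.Smax_ge[OF MD that])
    moreover have "0 \<le> SS c k \<omega> ^ q" using q by (intro zero_le_even_power)
    ultimately have "(SS c k \<omega> ^ q)\<^sup>2 \<le> (SM c \<omega>)\<^sup>2" by (intro power_mono)
    then show ?thesis by (simp only: power_mult[symmetric] mult.commute)
  qed
  define U where "U c \<omega> = 4 ^ q * (real n ^ (2 * q - 1) * (\<Sum>i<n. P c i \<omega> ^ (2 * q)) + (SM c \<omega>)\<^sup>2)" for c \<omega>
  have intP: "integrable M (\<lambda>\<omega>. P c i \<omega> ^ (2 * q))" if "i \<in> {..<n}" for c i using P that by (auto intro: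
      power_integrable)
  have intU: "integrable M (U c)" for c
    unfolding U_def[abs_def]
    by (intro integrable_mult_right Bochner_Integration.integrable_add Bochner_Integration.integrable_sum
        intP power_integrable SM_mom)
  have EU: "expectation (U c) \<le> 4 ^ q * (\<kappa> * T ^ (2 * q - 1) * h * (\<Sum>i<n. b i) + 4 * cm * (\<kappa> * T ^ (q -
      1) * h * (\<Sum>i<n. b i)))" for c
  proof -
    have "expectation (U c) = 4 ^ q * (real n ^ (2 * q - 1) * (\<Sum>i<n. even_moment q (P c i)) + expectation
        (\<lambda>\<omega>. (SM c \<omega>)\<^sup>2))"
    proof -
      have i1: "integrable M (\<lambda>\<omega>. real n ^ (2 * q - 1) * (\<Sum>i<n. P c i \<omega> ^ (2 * q)))"
        by (intro integrable_mult_right Bochner_Integration.integrable_sum intP)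
      have i2: "expectation (\<lambda>\<omega>. real n ^ (2 * q - 1) * (\<Sum>i<n. P c i \<omega> ^ (2 * q))) =
          real n ^ (2 * q - 1) * (\<Sum>i<n. even_moment q (P c i))"
        using intP by (simp add: Bochner_Integration.integral_sum)
      show ?thesis unfolding U_def i2[symmetric]
        by (simp only: integral_mult_right_zero Bochner_Integration.integral_add[OF i1
            power_integrable[OF SM_mom]])
    qed
    also have "\<dots> \<le> 4 ^ q * (\<kappa> * T ^ (2 * q - 1) * h * (\<Sum>i<n. b i) + 4 * (cm * (\<kappa> * T ^ (q - 1) * h *
        (\<Sum>i<n. b i))))"
    proof (intro mult_left_mono add_mono EP[OF order_refl])
      have "expectation (\<lambda>\<omega>. (SM c \<omega>)\<^sup>2) \<le> 4 * even_moment q (SS c n)"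
        unfolding SM_def SS_def by (rule martingale_differences.Doob[OF MD q(2,1)])
      also have "\<dots> \<le> 4 * (cm * (\<kappa> * T ^ (q - 1) * h * (\<Sum>i<n. b i)))" by (intro mult_left_mono ESS) auto
      finally show "expectation (\<lambda>\<omega>. (SM c \<omega>)\<^sup>2) \<le> 4 * (cm * (\<kappa> * T ^ (q - 1) * h * (\<Sum>i<n. b i)))" .
    qed simp
    finally show ?thesis by (simp add: mult.assoc)
  qed
  define Z where "Z \<omega> = real CARD('n) ^ (2 * q - 1) * (\<Sum>c\<in>UNIV. U c \<omega>)" for \<omega>
  have "integrable M Z" unfolding Z_def[abs_def]
    by (intro integrable_mult_right Bochner_Integration.integrable_sum intU)
  moreover have "norm (e k \<omega>) ^ (2 * q) \<le> Z \<omega>" if k: "k \<le> n" for k \<omega>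
  proof -
    have "norm (e k \<omega>) ^ (2 * q) \<le> real CARD('n) ^ (2 * q - 1) * (\<Sum>c\<in>UNIV. (e k \<omega> $ c) ^ (2 * q))"
      by (rule norm_even_power_le[OF q(1)])
    also have "\<dots> \<le> Z \<omega>" unfolding Z_def
    proof (intro mult_left_mono sum_mono)
      fix c
      have "(e k \<omega> $ c) ^ (2 * q) \<le> 4 ^ q * (PP c k \<omega> ^ (2 * q) + SS c k \<omega> ^ (2 * q))"
        unfolding ec[OF k] by (rule even_power_sum_le)
      also have "\<dots> \<le> U c \<omega>" unfolding U_def
      proof (intro mult_left_mono add_mono SM_ge[OF k])
        have "PP c k \<omega> ^ (2 * q) \<le> real n ^ (2 * q - 1) * (\<Sum>i<k. P c i \<omega> ^ (2 * q))"
          using PPb[OF k, of c \<omega>] by (simp only: even_power_abs)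
        also have "\<dots> \<le> real n ^ (2 * q - 1) * (\<Sum>i<n. P c i \<omega> ^ (2 * q))"
          using k by (intro mult_left_mono sum_mono2) (auto simp: zero_le_even_power)
        finally show "PP c k \<omega> ^ (2 * q) \<le> real n ^ (2 * q - 1) * (\<Sum>i<n. P c i \<omega> ^ (2 * q))" .
      qed simp
      finally show "(e k \<omega> $ c) ^ (2 * q) \<le> U c \<omega>" .
    qed simp
    finally show ?thesis .
  qed
  moreover have "expectation Z \<le> \<Lambda> * T * exp (\<Lambda> * T) * h ^ q"
  proof -
    let ?s = "\<Sum>i<n. b i"
    have "expectation Z = real CARD('n) ^ (2 * q - 1) * (\<Sum>c\<in>UNIV. expectation (U c))"
      unfolding Z_def using intU by (simp add: Bochner_Integration.integral_sum)
    also have "\<dots> \<le> real CARD('n) ^ (2 * q - 1) * (\<Sum>c\<in>(UNIV::'n set). 4 ^ q * (\<kappa> * T ^ (2 * q - 1) * h *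
        ?s + 4 * cm * (\<kappa> * T ^ (q - 1) * h * ?s)))"
      by (intro mult_left_mono sum_mono EU) auto
    also have "\<dots> = (real CARD('n) ^ (2 * q - 1) * real CARD('n)) * (4 ^ q * (\<kappa> * T ^ (2 * q - 1) * h * ?s
        + 4 * cm * (\<kappa> * T ^ (q - 1) * h * ?s)))"
      by simp
    also have "real CARD('n) ^ (2 * q - 1) * real CARD('n) = real CARD('n) ^ (2 * q)"
      using q by (simp flip: power_Suc2)
    also have "real CARD('n) ^ (2 * q) * (4 ^ q * (\<kappa> * T ^ (2 * q - 1) * h * ?s + 4 * cm * (\<kappa> * T ^ (q -
        1) * h * ?s))) = \<Lambda> * (h * ?s)"
      by (simp add: \<Lambda>_def cm_def algebra_simps)
    also have "\<dots> \<le> \<Lambda> * (T * (h ^ q * exp (\<Lambda> * T)))"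
      by (intro mult_left_mono sumb \<Lambda>0)
    finally show ?thesis by (simp add: mult_ac)
  qed
  ultimately show ?thesis by blast
qed

section \<open>One-step estimates for the solution\<close>

context sde
begin

text \<open>The constant in the bound \<open>E |X\<^sub>t - X\<^sub>s|\<^sup>2\<^sup>q \<le> c (t - s)\<^sup>q\<close>; the factors \<open>T\<^sup>q\<close> and \<open>Riemann_const q\<close>
  come from the drift and the stochastic integrals.\<close>

definition X_const :: "nat \<Rightarrow> real"
  where "X_const q = real CARD('n) ^ (2 * q) * (4 ^ q * ((T ^ q + Riemann_const q) * K ^ (2 * q)))"

lemma X_const_nonneg: "X_const q \<ge> 0"
  using T K0 by (simp add: X_const_def Riemann_const_nonneg)

lemma drift_moments:
  assumes st: "0 \<le> s" "s \<le> t" "t \<le> T"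
  shows "all_moments M (drift s t c)"
    and "even_moment q (drift s t c) \<le> K ^ (2 * q) * (t - s) ^ (2 * q)"
proof -
  have b: "\<bar>drift s t c \<omega>\<bar> \<le> K * (t - s)" if "\<omega> \<in> space M" for \<omega>
  proof -
    have "norm (integral {s..t} (\<lambda>v. \<sigma> 0 (X v \<omega>) $ c)) \<le> K * (t - s)"
      using st that by (intro integral_bound \<sigma>X_continuous) (auto intro: \<sigma>_bound)
    then show ?thesis by (simp add: drift_def)
  qed
  show m: "all_moments M (drift s t c)"
    by (rule all_moments_bound[OF all_moments_const[of "K * (t - s)"]])
      (use F_measurable[OF _ drift_adapted[OF st]] st b in \<open>auto intro!: AE_I2 order_trans[OF _ abs_ge_self]\<close>)
  have "even_moment q (drift s t c) \<le> even_moment q (\<lambda>\<omega>. K * (t - s))"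
    by (rule even_moment_mono[OF m all_moments_const b])
  then show "even_moment q (drift s t c) \<le> K ^ (2 * q) * (t - s) ^ (2 * q)"
    by (simp add: prob_space power_mult_distrib)
qed

lemma X_component_moments:
  assumes st: "0 \<le> s" "s \<le> t" "t \<le> T"
  shows "all_moments M (\<lambda>\<omega>. X t \<omega> $ c - X s \<omega> $ c)"
    and "q \<ge> 1 \<Longrightarrow> even_moment q (\<lambda>\<omega>. X t \<omega> $ c - X s \<omega> $ c) \<le>
        4 ^ q * ((T ^ q + Riemann_const q) * K ^ (2 * q)) * (t - s) ^ q"
proof -
  have eq: "X t \<omega> $ c - X s \<omega> $ c = drift s t c \<omega> + (mart t c \<omega> - mart s c \<omega>)" if "\<omega> \<in> space M" for \<omega>
    by (rule mart_increment[OF st that])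
  have meas: "(\<lambda>\<omega>. X t \<omega> $ c - X s \<omega> $ c) \<in> borel_measurable M"
    using st by (intro borel_measurable_diff measurable_compose[OF X_measurable vec_nth_borel]) auto
  show "all_moments M (\<lambda>\<omega>. X t \<omega> $ c - X s \<omega> $ c)"
    by (rule all_moments_cong_AE[OF all_moments_add[OF drift_moments(1)[OF st] mart_all_moments[OF st]]
        meas, of c c])
      (intro AE_I2 eq)
  show "even_moment q (\<lambda>\<omega>. X t \<omega> $ c - X s \<omega> $ c) \<le> 4 ^ q * ((T ^ q + Riemann_const q) * K ^ (2 * q)) *
      (t - s) ^ q"
    if q: "q \<ge> 1"
  proof -
    have "even_moment q (\<lambda>\<omega>. X t \<omega> $ c - X s \<omega> $ c) = even_moment q (\<lambda>\<omega>. drift s t c \<omega> + (mart t c \<omega> -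
        mart s c \<omega>))"
      by (intro Bochner_Integration.integral_cong refl) (simp add: eq)
    also have "\<dots> \<le> 4 ^ q * (K ^ (2 * q) * (t - s) ^ (2 * q) + Riemann_const q * K ^ (2 * q) * (t - s) ^ q)"
      by (rule even_moment_add_le[OF drift_moments(1)[OF st] mart_all_moments[OF st] drift_moments(2)[OF
          st] mart_moment_bound[OF st q]])
    also have "\<dots> \<le> 4 ^ q * (K ^ (2 * q) * (T ^ q * (t - s) ^ q) + Riemann_const q * K ^ (2 * q) * (t - s) ^ q)"
    proof (intro mult_left_mono add_right_mono)
      have "(t - s) ^ (2 * q) = (t - s) ^ q * (t - s) ^ q" by (simp flip: power_add add: mult_2)
      also have "\<dots> \<le> T ^ q * (t - s) ^ q" using st by (intro mult_right_mono power_mono) auto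
      finally show "(t - s) ^ (2 * q) \<le> T ^ q * (t - s) ^ q" .
    qed (use K0 in auto)
    also have "\<dots> = 4 ^ q * ((T ^ q + Riemann_const q) * K ^ (2 * q)) * (t - s) ^ q" by (simp only: algebra_simps)
    finally show ?thesis .
  qed
qed

lemma X_increment_moments:
  assumes st: "0 \<le> s" "s \<le> t" "t \<le> T"
  shows "all_moments M (\<lambda>\<omega>. norm (X t \<omega> - X s \<omega>))"
    and "q \<ge> 1 \<Longrightarrow> even_moment q (\<lambda>\<omega>. norm (X t \<omega> - X s \<omega>)) \<le> X_const q * (t - s) ^ q"
proof -
  have meas: "(\<lambda>\<omega>. X t \<omega> - X s \<omega>) \<in> borel_measurable M"
    using st X_measurable by (intro borel_measurable_diff) auto
  have m: "all_moments M (\<lambda>\<omega>. (X t \<omega> - X s \<omega>) $ c)" for c using X_component_moments(1)[OF st] by simp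
  show "all_moments M (\<lambda>\<omega>. norm (X t \<omega> - X s \<omega>))" by (rule norm_all_moments[OF meas m])
  show "even_moment q (\<lambda>\<omega>. norm (X t \<omega> - X s \<omega>)) \<le> X_const q * (t - s) ^ q" if q: "q \<ge> 1"
    using norm_moment_le[OF meas m q, of "4 ^ q * ((T ^ q + Riemann_const q) * K ^ (2 * q)) * (t - s) ^ q"]
      X_component_moments(2)[OF st q] by (simp add: X_const_def mult.assoc)
qed

lemma X_moments:
  assumes t: "t \<in> {0..T}"
  shows "all_moments M (\<lambda>\<omega>. X t \<omega> $ c)"
proof -
  have "all_moments M (\<lambda>\<omega>. x $ c + (X t \<omega> $ c - X 0 \<omega> $ c))"
    using t by (intro all_moments_add all_moments_const X_component_moments(1)) auto
  then show ?thesis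
    by (rule all_moments_cong_AE[OF _ measurable_compose[OF X_measurable[OF t] vec_nth_borel]])
      (use X_initial in eventually_elim, simp)
qed

lemma \<sigma>_difference_moments:
  fixes U V :: "'w \<Rightarrow> real^'n"
  assumes j: "j \<le> d" and UV: "U \<in> borel_measurable M" "V \<in> borel_measurable M" and m: "all_moments M (\<lambda>\<omega>.
      norm (U \<omega> - V \<omega>))"
  shows "all_moments M (\<lambda>\<omega>. \<sigma> j (U \<omega>) $ c - \<sigma> j (V \<omega>) $ c)"
    and "even_moment q (\<lambda>\<omega>. \<sigma> j (U \<omega>) $ c - \<sigma> j (V \<omega>) $ c) \<le> L ^ (2 * q) * even_moment q (\<lambda>\<omega>. norm (U \<omega> - V \<omega>))"
proof -
  have mL: "all_moments M (\<lambda>\<omega>. L * norm (U \<omega> - V \<omega>))" by (rule all_moments_cmult[OF m])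
  show a: "all_moments M (\<lambda>\<omega>. \<sigma> j (U \<omega>) $ c - \<sigma> j (V \<omega>) $ c)"
  proof (rule all_moments_bound[OF mL])
    show "(\<lambda>\<omega>. \<sigma> j (U \<omega>) $ c - \<sigma> j (V \<omega>) $ c) \<in> borel_measurable M"
      by (intro borel_measurable_diff measurable_compose[OF _ borel_measurable_continuous_onI[OF
          \<sigma>_continuous[OF j]]] UV)
    show "AE \<omega> in M. \<bar>\<sigma> j (U \<omega>) $ c - \<sigma> j (V \<omega>) $ c\<bar> \<le> \<bar>L * norm (U \<omega> - V \<omega>)\<bar>"
      by (intro AE_I2 order_trans[OF \<sigma>_Lipschitz[OF j] abs_ge_self])
  qed
  have "even_moment q (\<lambda>\<omega>. \<sigma> j (U \<omega>) $ c - \<sigma> j (V \<omega>) $ c) \<le> even_moment q (\<lambda>\<omega>. L * norm (U \<omega> - V \<omega>))"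
    by (rule even_moment_mono[OF a mL \<sigma>_Lipschitz[OF j]])
  then show "even_moment q (\<lambda>\<omega>. \<sigma> j (U \<omega>) $ c - \<sigma> j (V \<omega>) $ c) \<le>
      L ^ (2 * q) * even_moment q (\<lambda>\<omega>. norm (U \<omega> - V \<omega>))"
    by (simp add: power_mult_distrib)
qed

lemma \<sigma>X_increment_moments:
  assumes j: "j \<le> d" and st: "0 \<le> s" "s \<le> u" "u \<le> t" "t \<le> T"
  shows "all_moments M (\<lambda>\<omega>. \<sigma> j (X u \<omega>) $ c - \<sigma> j (X s \<omega>) $ c)"
    and "q \<ge> 1 \<Longrightarrow> even_moment q (\<lambda>\<omega>. \<sigma> j (X u \<omega>) $ c - \<sigma> j (X s \<omega>) $ c) \<le> L ^ (2 * q) * X_const q * (t - s) ^ q"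
proof -
  have X: "X u \<in> borel_measurable M" "X s \<in> borel_measurable M" using st by (auto intro!: X_measurable)
  have su: "u \<le> T" using st by simp
  note dm = \<sigma>_difference_moments[OF j X X_increment_moments(1)[OF st(1,2) su]]
  show "all_moments M (\<lambda>\<omega>. \<sigma> j (X u \<omega>) $ c - \<sigma> j (X s \<omega>) $ c)" by (rule dm(1))
  show "even_moment q (\<lambda>\<omega>. \<sigma> j (X u \<omega>) $ c - \<sigma> j (X s \<omega>) $ c) \<le>
      L ^ (2 * q) * X_const q * (t - s) ^ q" if q: "q \<ge> 1"
  proof -
    have "even_moment q (\<lambda>\<omega>. norm (X u \<omega> - X s \<omega>)) \<le> X_const q * (u - s) ^ q"
      by (rule X_increment_moments(2)[OF st(1,2) su q])
    also have "\<dots> \<le> X_const q * (t - s) ^ q" using st by (intro mult_left_mono power_mono X_const_nonneg) auto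
    finally have "L ^ (2 * q) * even_moment q (\<lambda>\<omega>. norm (X u \<omega> - X s \<omega>)) \<le> L ^ (2 * q) * (X_const q * (t - s) ^ q)"
      using L0 by (intro mult_left_mono) auto
    then show ?thesis using dm(2)[of c q] by simp
  qed
qed

definition drift_rest :: "real \<Rightarrow> real \<Rightarrow> 'n \<Rightarrow> 'w \<Rightarrow> real"
  where "drift_rest s t c \<omega> = integral {s..t} (\<lambda>v. \<sigma> 0 (X v \<omega>) $ c - \<sigma> 0 (X s \<omega>) $ c)"

lemma drift_rest_eq:
  assumes "0 \<le> s" "s \<le> t" "t \<le> T" "\<omega> \<in> space M"
  shows "drift s t c \<omega> = (t - s) * (\<sigma> 0 (X s \<omega>) $ c) + drift_rest s t c \<omega>"
  unfolding drift_def drift_rest_def using assms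
  by (subst Henstock_Kurzweil_Integration.integral_diff) (auto intro!: integrable_continuous_real \<sigma>X_continuous)

lemma drift_rest_moments:
  assumes st: "0 \<le> s" "s \<le> t" "t \<le> T"
  shows "all_moments M (drift_rest s t c)"
    and "q \<ge> 1 \<Longrightarrow> even_moment q (drift_rest s t c) \<le> (t - s) ^ (2 * q) * (L ^ (2 * q) * X_const q * (t - s) ^ q)"
proof -
  have m: "all_moments M (\<lambda>\<omega>. \<sigma> 0 (X v \<omega>) $ c - \<sigma> 0 (X s \<omega>) $ c)" if "v \<in> {s..t}" for v
    using st that by (intro \<sigma>X_increment_moments(1)[OF _ st(1) _ _ st(3)]) auto
  have k: "continuous_on {s..t} (\<lambda>v. \<sigma> 0 (X v \<omega>) $ c - \<sigma> 0 (X s \<omega>) $ c)" if "\<omega> \<in> space M" for \<omega>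
    using st that by (intro continuous_intros \<sigma>X_continuous) auto
  have b: "even_moment q (\<lambda>\<omega>. \<sigma> 0 (X v \<omega>) $ c - \<sigma> 0 (X s \<omega>) $ c) \<le> L ^ (2 * q) * X_const q * (t - s) ^ q"
    if "v \<in> {s..t}" "q \<ge> 1" for v q
    using st that by (intro \<sigma>X_increment_moments(2)) auto
  show "all_moments M (drift_rest s t c)" unfolding drift_rest_def[abs_def]
    by (rule time_integral_moments(1)[OF st(2) m k b])
  show "even_moment q (drift_rest s t c) \<le> (t - s) ^ (2 * q) * (L ^ (2 * q) * X_const q * (t - s) ^ q)" if "q \<ge> 1"
    unfolding drift_rest_def by (rule time_integral_moments(2)[OF st(2) m k b that])
qed

definition mart_rest :: "real \<Rightarrow> real \<Rightarrow> 'n \<Rightarrow> 'w \<Rightarrow> real"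
  where "mart_rest s t c \<omega> = mart t c \<omega> - mart s c \<omega> - (\<Sum>j=1..d. \<sigma> j (X s \<omega>) $ c * dB B j s t \<omega>)"

text \<open>The rest is the limit of left-point sums of \<open>\<sigma>\<^sub>j(X\<^sub>v) - \<sigma>\<^sub>j(X\<^sub>s)\<close>; the path increment contributes a
  further factor \<open>(t - s)\<^sup>1\<^sup>/\<^sup>2\<close>.\<close>

lemma mart_rest_moments:
  assumes st: "0 \<le> s" "s \<le> t" "t \<le> T"
  shows "all_moments M (mart_rest s t c)"
    and "q \<ge> 1 \<Longrightarrow> even_moment q (mart_rest s t c) \<le> Riemann_const q * (L ^ (2 * q) * X_const q * (t - s) ^
        q) * (t - s) ^ q"
    and "mart_rest s t c \<in> borel_measurable (F t)"
    and "Y \<in> borel_measurable (F s) \<Longrightarrow> integrable M (\<lambda>\<omega>. (Y \<omega>)\<^sup>2) \<Longrightarrow> expectation (\<lambda>\<omega>. Y \<omega> * mart_rest s t c \<omega>) = 0"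
proof -
  let ?A = "\<lambda>\<omega>. \<Sum>j=1..d. \<sigma> j (X s \<omega>) $ c * dB B j s t \<omega>"
  let ?\<eta> = "\<lambda>n i j \<omega>. \<sigma> j (X (grid s t (Suc n) i) \<omega>) $ c - \<sigma> j (X s \<omega>) $ c"
  define Q where "Q n \<omega> = (\<Sum>i<Suc n. \<Sum>j=1..d. ?\<eta> n i j \<omega> * dB B j (grid s t (Suc n) i) (grid s t (Suc n)
      (Suc i)) \<omega>)" for n \<omega>
  have sT: "s \<in> {0..T}" using st by auto
  have A: "?A \<in> borel_measurable (F t)" "all_moments M ?A"
    "Y \<in> borel_measurable (F s) \<Longrightarrow> integrable M (\<lambda>\<omega>. (Y \<omega>)\<^sup>2) \<Longrightarrow> expectation (\<lambda>\<omega>. Y \<omega> * ?A \<omega>) = 0" for Y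
  proof -
    have terms: "(\<lambda>\<omega>. \<sigma> j (X s \<omega>) $ c) \<in> borel_measurable (F s)" "all_moments M (\<lambda>\<omega>. \<sigma> j (X s \<omega>) $ c)"
      "noise_term s t 1 gauss_moment (dB B j s t)" if "j \<in> {1..d}" for j
      by (use that sT in \<open>auto intro!: \<sigma>X_adapted \<sigma>X_moments\<close>)[2] (rule noise_term_B[OF that st(1,2)])
    note nc = noise_combination[where A = "{1..d}" and \<eta> = "\<lambda>j \<omega>. \<sigma> j (X s \<omega>) $ c" and p = 1 and c = gauss_moment
        and Z = "\<lambda>j. dB B j s t", OF finite_atLeastAtMost st(1,2) terms]
    show "?A \<in> borel_measurable (F t)" "all_moments M ?A" by (rule nc(1) nc(2); assumption)+
    show "Y \<in> borel_measurable (F s) \<Longrightarrow> integrable M (\<lambda>\<omega>. (Y \<omega>)\<^sup>2) \<Longrightarrow> expectation (\<lambda>\<omega>. Y \<omega> * ?A \<omega>) = 0"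
      by (rule nc(3))
  qed
  have Q_eq: "Q n = (\<lambda>\<omega>. Riemann_mart s t c n \<omega> - ?A \<omega>)" for n
  proof
    fix \<omega>
    let ?g = "grid s t (Suc n)"
    have "(\<Sum>i<Suc n. \<Sum>j=1..d. \<sigma> j (X s \<omega>) $ c * dB B j (?g i) (?g (Suc i)) \<omega>) = ?A \<omega>"
    proof (subst sum.swap, intro sum.cong refl)
      fix j assume j: "j \<in> {1..d}"
      have "(\<Sum>i<Suc n. dB B j (?g i) (?g (Suc i)) \<omega>) = dB B j s t \<omega>"
        using j sum_lessThan_telescope[of "\<lambda>i. B j (?g i) \<omega>" "Suc n"] by (simp add: dB_eq del: sum.lessThan_Suc)
      then show "(\<Sum>i<Suc n. \<sigma> j (X s \<omega>) $ c * dB B j (?g i) (?g (Suc i)) \<omega>) = \<sigma> j (X s \<omega>) $ c * dB B j s t \<omega>"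
        by (simp only: sum_distrib_left[symmetric])
    qed
    then show "Q n \<omega> = Riemann_mart s t c n \<omega> - ?A \<omega>"
      unfolding Q_def Riemann_mart_def left_diff_distrib sum_subtractf by simp
  qed
  have lim: "L2_tendsto M Q (mart_rest s t c)"
    unfolding Q_eq[abs_def] mart_rest_def[abs_def]
    by (rule L2_tendsto_diff[OF mart_Riemann[OF st] L2_tendsto_const[OF all_moments_measurable[OF A(2)]]])
  have gT: "0 \<le> s" "s \<le> grid s t (Suc n) i" "grid s t (Suc n) i \<le> t" if "i < Suc n" for n i
    using grid_range[OF st(2), of i "Suc n"] that st by auto
  have \<eta>: "?\<eta> n i j \<in> borel_measurable (F (grid s t (Suc n) i))" "all_moments M (?\<eta> n i j)"
    "q \<ge> 1 \<Longrightarrow> even_moment q (?\<eta> n i j) \<le> L ^ (2 * q) * X_const q * (t - s) ^ q"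
    if i: "i < Suc n" and j: "j \<in> {1..d}" for n i j q
  proof -
    have jd: "j \<le> d" using j by simp
    show "?\<eta> n i j \<in> borel_measurable (F (grid s t (Suc n) i))"
      using jd grid_time[OF st i] by (intro borel_measurable_diff \<sigma>X_adapted F_mono[OF gT(1,2)[OF i]
          \<sigma>X_adapted[OF jd sT]])
    show "all_moments M (?\<eta> n i j)" by (rule \<sigma>X_increment_moments(1)[OF jd gT[OF i] st(3)])
    show "q \<ge> 1 \<Longrightarrow> even_moment q (?\<eta> n i j) \<le> L ^ (2 * q) * X_const q * (t - s) ^ q"
      by (rule \<sigma>X_increment_moments(2)[OF jd gT[OF i] st(3)])
  qed
  have mom: "all_moments M (Q n)" for n
    unfolding Q_def[abs_def] by (rule stochastic_sum_moments(1)[OF st(1,2) \<eta>(1,2)])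
  have bound: "even_moment q (Q n) \<le> Riemann_const q * (L ^ (2 * q) * X_const q * (t - s) ^ q) * (t - s)
      ^ q" if q: "q \<ge> 1" for n q
    unfolding Q_def by (rule stochastic_sum_moments(3)[OF st(1,2) \<eta>(1,2) q \<eta>(3)[OF _ _ q]])
  show m: "all_moments M (mart_rest s t c)" by (rule L2_limit_moments(1)[OF mom lim bound])
  show "even_moment q (mart_rest s t c) \<le> Riemann_const q * (L ^ (2 * q) * X_const q * (t - s) ^ q) * (t
      - s) ^ q" if "q \<ge> 1"
    by (rule L2_limit_moments(2)[OF mom lim bound that])
  show "mart_rest s t c \<in> borel_measurable (F t)"
    unfolding mart_rest_def[abs_def] using st
    by (intro borel_measurable_diff A(1) mart_adapted F_mono[OF st(1,2) mart_adapted[OF sT]]) auto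
  show "expectation (\<lambda>\<omega>. Y \<omega> * mart_rest s t c \<omega>) = 0" if Y: "Y \<in> borel_measurable (F s)" "integrable M
      (\<lambda>\<omega>. (Y \<omega>)\<^sup>2)"
  proof (rule L2_limit_orthogonal[OF F_measurable[OF st(1) Y(1)] Y(2) mom m lim])
    show "expectation (\<lambda>\<omega>. Y \<omega> * Q n \<omega>) = 0" for n
      unfolding Q_def by (rule stochastic_sum_moments(2)[OF st(1,2) \<eta>(1,2) Y])
  qed
qed

end

section \<open>One-step estimates for the scheme\<close>

lemma borel_measurable_vecI:
  fixes V :: "'a \<Rightarrow> real^'n"
  assumes "\<And>c. (\<lambda>\<omega>. V \<omega> $ c) \<in> borel_measurable N"
  shows "V \<in> borel_measurable N"
  unfolding borel_measurable_euclidean_space[of V]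
  using assms by (auto simp: Basis_vec_def inner_axis)

locale weak_scheme = sde M F d B B' \<sigma> T x X K L for M :: "'w measure" and F :: "real \<Rightarrow> 'w measure"
    and d :: nat and B B' :: "nat \<Rightarrow> real \<Rightarrow> 'w \<Rightarrow> real"
    and \<sigma> :: "nat \<Rightarrow> real^'n \<Rightarrow> real^'n" and T :: real and x :: "real^'n" and X :: "real \<Rightarrow> 'w \<Rightarrow> real^'n"
    and K L :: real +
  fixes S :: "'n set"
  assumes Lop_bound: "i \<le> d \<Longrightarrow> j \<le> d \<Longrightarrow> \<bar>Lop d \<sigma> i (\<sigma> j) z $ c\<bar> \<le> K"
    and Lop_measurable: "i \<le> d \<Longrightarrow> j \<le> d \<Longrightarrow> (\<lambda>z. Lop d \<sigma> i (\<sigma> j) z $ c) \<in> borel_measurable borel"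
begin

definition area_term :: "nat \<Rightarrow> real \<Rightarrow> real \<Rightarrow> 'w \<Rightarrow> real"
  where "area_term j s t \<omega> = integral {s..t} (\<lambda>v. dB B j s v \<omega>)"

lemma area_term_eq: "j \<in> {1..d} \<Longrightarrow> area_term j s t = wiener.area (B j) s t"
  using wiener.area_def[OF wiener_B] by (auto simp: area_term_def dB_eq)

text \<open>A pathwise version of the coefficients \<open>\<Delta>\<eta>\<close>, in which the stochastic integral of time is replaced
  by its closed form; it is adapted everywhere and not only up to null sets.\<close>

definition eta :: "nat \<Rightarrow> nat \<Rightarrow> real \<Rightarrow> real \<Rightarrow> 'w \<Rightarrow> real"
  where "eta j1 j2 s t \<omega> =
    (if S = {} \<or> (1 \<le> j1 \<and> 1 \<le> j2) \<or> (j1 = 0 \<and> j2 = 0) then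
       (1/2) * (dB B j1 s t \<omega> * dB B j2 s t \<omega> - (if j1 = j2 \<and> j1 \<noteq> 0 then t - s else 0))
     else if j1 = 0 then (t - s) * dB B j2 s t \<omega> - area_term j2 s t \<omega>
     else area_term j1 s t \<omega>)"

lemma deta_eta:
  assumes "j1 \<le> d" "j2 \<le> d" "0 \<le> s" "s \<le> t"
  shows "AE \<omega> in M. deta M F S B j1 j2 s t \<omega> = eta j1 j2 s t \<omega>"
proof (cases "S \<noteq> {} \<and> j1 = 0 \<and> j2 \<noteq> 0")
  case True
  then have j: "j2 \<in> {1..d}" using assms by auto
  show ?thesis
    using wiener.ito_integral_time[OF wiener_B[OF j] assms(3,4)]
    by eventually_elim (use True j in \<open>simp add: deta_def eta_def area_term_eq dB_eq\<close>)
next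
  case False
  then show ?thesis by (auto simp: deta_def eta_def area_term_def)
qed

definition rest_const :: "nat \<Rightarrow> real"
  where "rest_const q = 4 ^ q * (2 * gauss_moment q) + T ^ q"

lemma rest_const_nonneg: "rest_const q \<ge> 0"
  using T by (simp add: rest_const_def gauss_moment_nonneg)

text \<open>A time index replaces a Brownian factor of size \<open>h\<^sup>1\<^sup>/\<^sup>2\<close> by one of size \<open>h\<close>, so these coefficients
  have size \<open>h\<^sup>3\<^sup>/\<^sup>2\<close>; for two time indices the size is \<open>h\<^sup>2\<close>, and \<open>T\<close> enters the constant.\<close>

lemma eta_rest:
  assumes j: "j1 \<le> d" "j2 \<le> d" "j1 = 0 \<or> j2 = 0" and st: "0 \<le> s" "s \<le> t" "t \<le> T"
  shows "eta j1 j2 s t \<in> borel_measurable (F t) \<and> all_moments M (eta j1 j2 s t) \<and>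
    (\<forall>q\<ge>1. even_moment q (eta j1 j2 s t) \<le> rest_const q * (t - s) ^ (3 * q))"
proof -
  define h where "h = t - s"
  have h: "0 \<le> h" "h \<le> T" using st by (auto simp: h_def)
  have gm: "gauss_moment q * h ^ (3 * q) \<le> rest_const q * h ^ (3 * q)"
    "4 ^ q * (2 * gauss_moment q) * h ^ (3 * q) \<le> rest_const q * h ^ (3 * q)"
    "T ^ q * h ^ (3 * q) \<le> rest_const q * h ^ (3 * q)" for q
  proof -
    have "1 * gauss_moment q \<le> 4 ^ q * (2 * gauss_moment q)"
      using gauss_moment_nonneg[of q] by (intro mult_mono) auto
    moreover have "0 \<le> 4 ^ q * (2 * gauss_moment q)" "0 \<le> T ^ q" using gauss_moment_nonneg[of q] T by auto
    ultimately have "gauss_moment q \<le> rest_const q" "4 ^ q * (2 * gauss_moment q) \<le>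
        rest_const q" "T ^ q \<le> rest_const q"
      unfolding rest_const_def by linarith+
    then show "gauss_moment q * h ^ (3 * q) \<le> rest_const q * h ^ (3 * q)"
      "4 ^ q * (2 * gauss_moment q) * h ^ (3 * q) \<le> rest_const q * h ^ (3 * q)"
      "T ^ q * h ^ (3 * q) \<le> rest_const q * h ^ (3 * q)"
      using h by (intro mult_right_mono zero_le_power; simp)+
  qed
  have lin: "(\<lambda>\<omega>. \<theta> * (h * dB B j s t \<omega>)) \<in> borel_measurable (F t)"
    "all_moments M (\<lambda>\<omega>. \<theta> * (h * dB B j s t \<omega>))"
    "q \<ge> 1 \<Longrightarrow> even_moment q (\<lambda>\<omega>. \<theta> * (h * dB B j s t \<omega>)) \<le> gauss_moment q * h ^ (3 * q)"
    if j: "j \<in> {1..d}" and \<theta>: "0 \<le> \<theta>" "\<theta> \<le> 1" for j q \<theta>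
  proof -
    have nb: "noise_term s t 1 gauss_moment (dB B j s t)" by (rule noise_term_B[OF j st(1,2)])
    show "(\<lambda>\<omega>. \<theta> * (h * dB B j s t \<omega>)) \<in> borel_measurable (F t)"
      using nb by (auto simp: noise_term_def)
    show "all_moments M (\<lambda>\<omega>. \<theta> * (h * dB B j s t \<omega>))"
      using nb by (auto simp: noise_term_def intro!: all_moments_cmult)
    assume q: "q \<ge> 1"
    have "even_moment q (\<lambda>\<omega>. \<theta> * (h * dB B j s t \<omega>)) = \<theta> ^ (2 * q) * (h ^ (2 * q) * even_moment q (dB B j s t))"
      by (simp add: power_mult_distrib)
    also have "\<dots> \<le> 1 * (h ^ (2 * q) * (gauss_moment q * h ^ (1 * q)))"
      using nb q h \<theta> unfolding noise_term_def h_def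
      by (intro mult_mono mult_left_mono power_le_one) (auto intro!: mult_nonneg_nonneg
          Bochner_Integration.integral_nonneg gauss_moment_nonneg)
    also have "\<dots> = gauss_moment q * h ^ (2 * q + q)" by (simp only: power_add mult_1 mult_ac)
    finally show "even_moment q (\<lambda>\<omega>. \<theta> * (h * dB B j s t \<omega>)) \<le> gauss_moment q * h ^ (3 * q)" by simp
  qed
  have area: "area_term j s t \<in> borel_measurable (F t)" "all_moments M (area_term j s t)"
    "q \<ge> 1 \<Longrightarrow> even_moment q (area_term j s t) \<le> gauss_moment q * h ^ (3 * q)"
    if "j \<in> {1..d}" for j q
    using wiener.area_adapted[OF wiener_B[OF that] st(1,2)] wiener.area_moments[OF wiener_B[OF that] st(1,2)]
    by (auto simp: area_term_eq[OF that] h_def)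
  consider (zero) "j1 = 0" "j2 = 0" | (elliptic1) "S = {}" "j1 = 0" "j2 \<noteq> 0" | (elliptic2) "S =
      {}" "j1 \<noteq> 0" "j2 = 0"
    | (time) "S \<noteq> {}" "j1 = 0" "j2 \<noteq> 0" | (inner) "S \<noteq> {}" "j1 \<noteq> 0" "j2 = 0" using j by blast
  then show ?thesis
  proof cases
    case zero
    have eq: "eta j1 j2 s t = (\<lambda>\<omega>. (1/2) * (h * h))" using zero by (auto simp: eta_def dB_def h_def)
    have "((1/2) * (h * h)) ^ (2 * q) \<le> rest_const q * h ^ (3 * q)" for q
    proof -
      have "((1/2) * (h * h)) ^ (2 * q) = (1/2) ^ (2 * q) * (h ^ q * h ^ (3 * q))"
      proof -
        have "2 * q + 2 * q = q + 3 * q" by simp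
        then have "h ^ (2 * q) * h ^ (2 * q) = h ^ q * h ^ (3 * q)" by (simp only: power_add[symmetric])
        then show ?thesis by (simp only: power_mult_distrib)
      qed
      also have "\<dots> \<le> 1 * (T ^ q * h ^ (3 * q))"
        using h by (intro mult_mono power_le_one power_mono) auto
      finally show ?thesis using gm(3)[of q] by simp
    qed
    then show ?thesis unfolding eq by (simp add: all_moments_const prob_space h_def)
  next
    case elliptic1
    have eq: "eta j1 j2 s t = (\<lambda>\<omega>. (1/2) * (h * dB B j2 s t \<omega>))" unfolding eta_def[abs_def] h_def using
        elliptic1 by (auto simp: dB_def)
    have j: "j2 \<in> {1..d}" using j elliptic1 by auto
    show ?thesis unfolding eq h_def[symmetric]
      using lin[OF j, of "1/2"] gm(1) by (auto intro: order_trans)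
  next
    case elliptic2
    have eq: "eta j1 j2 s t = (\<lambda>\<omega>. (1/2) * (h * dB B j1 s t \<omega>))" unfolding eta_def[abs_def] h_def using
        elliptic2 by (auto simp: dB_def)
    have j: "j1 \<in> {1..d}" using j elliptic2 by auto
    show ?thesis unfolding eq h_def[symmetric]
      using lin[OF j, of "1/2"] gm(1) by (auto intro: order_trans)
  next
    case time
    have j: "j2 \<in> {1..d}" using j time by auto
    have eq: "eta j1 j2 s t = (\<lambda>\<omega>. 1 * (h * dB B j2 s t \<omega>) + - area_term j2 s t \<omega>)" using time by (auto
        simp: eta_def h_def)
    have l: "(\<lambda>\<omega>. 1 * (h * dB B j2 s t \<omega>)) \<in> borel_measurable (F t)" "all_moments M (\<lambda>\<omega>. 1 * (h * dB B j2 s t \<omega>))"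
      "\<And>q. q \<ge> 1 \<Longrightarrow> even_moment q (\<lambda>\<omega>. 1 * (h * dB B j2 s t \<omega>)) \<le> gauss_moment q * h ^ (3 * q)"
      by (rule lin[OF j]; simp)+
    have am: "all_moments M (\<lambda>\<omega>. - area_term j2 s t \<omega>)" by (rule all_moments_uminus[OF area(2)[OF j]])
    have "even_moment q (\<lambda>\<omega>. 1 * (h * dB B j2 s t \<omega>) + - area_term j2 s t \<omega>) \<le>
        rest_const q * h ^ (3 * q)" if q: "q \<ge> 1" for q
    proof -
      have "even_moment q (\<lambda>\<omega>. 1 * (h * dB B j2 s t \<omega>) + - area_term j2 s t \<omega>) \<le>
        4 ^ q * (gauss_moment q * h ^ (3 * q) + gauss_moment q * h ^ (3 * q))"
        by (rule even_moment_add_le[OF l(2) am l(3)[OF q]]) (use area(3)[OF j q] in simp)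
      also have "\<dots> = 4 ^ q * (2 * gauss_moment q) * h ^ (3 * q)" by (simp add: algebra_simps)
      also have "\<dots> \<le> rest_const q * h ^ (3 * q)" by (rule gm)
      finally show ?thesis .
    qed
    moreover have "(\<lambda>\<omega>. 1 * (h * dB B j2 s t \<omega>) + - area_term j2 s t \<omega>) \<in> borel_measurable (F t)"
      by (intro borel_measurable_add borel_measurable_uminus l(1) area(1)[OF j])
    ultimately show ?thesis unfolding eq h_def[symmetric] using all_moments_add[OF l(2) am] by blast
  next
    case inner
    have j: "j1 \<in> {1..d}" using j inner by auto
    have eq: "eta j1 j2 s t = area_term j1 s t" unfolding eta_def[abs_def] using inner by auto
    show ?thesis unfolding eq h_def[symmetric]
      using area[OF j] gm(1) by (auto intro: order_trans)
  qed
qed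

definition step :: "real \<Rightarrow> real \<Rightarrow> 'w \<Rightarrow> real^'n \<Rightarrow> real^'n"
  where "step s t \<omega> z =
    z + (\<Sum>j=0..d. dB B j s t \<omega> *\<^sub>R \<sigma> j z)
      + (\<Sum>j1=0..d. \<Sum>j2=0..d. eta j1 j2 s t \<omega> *\<^sub>R Lop d \<sigma> j1 (\<sigma> j2) z)
      + (1/2) *\<^sub>R (\<Sum>j1=1..d. \<Sum>j2=Suc j1..d. dA B B' j1 j2 s t \<omega> *\<^sub>R bracket d \<sigma> j1 j2 z)"

definition rest_pairs :: "(nat \<times> nat) set"
  where "rest_pairs = {p \<in> {0..d} \<times> {0..d}. fst p = 0 \<or> snd p = 0}"

definition area_pairs :: "(nat \<times> nat) set"
  where "area_pairs = (SIGMA j1:{1..d}. {Suc j1..d})"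

lemma finite_pairs: "finite rest_pairs" "finite area_pairs"
  by (auto simp: rest_pairs_def area_pairs_def)

definition step_rest :: "real \<Rightarrow> real \<Rightarrow> 'n \<Rightarrow> ('w \<Rightarrow> real^'n) \<Rightarrow> 'w \<Rightarrow> real"
  where "step_rest s t c V \<omega> = (\<Sum>p\<in>rest_pairs. eta (fst p) (snd p) s t \<omega> * (Lop d \<sigma> (fst p) (\<sigma> (snd p))
      (V \<omega>) $ c))"

definition step_quadratic :: "real \<Rightarrow> real \<Rightarrow> 'n \<Rightarrow> ('w \<Rightarrow> real^'n) \<Rightarrow> 'w \<Rightarrow> real"
  where "step_quadratic s t c V \<omega> = (\<Sum>p\<in>{1..d} \<times> {1..d}. (1/2) * (Lop d \<sigma> (fst p) (\<sigma> (snd p)) (V \<omega>) $ c) *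
    (dB B (fst p) s t \<omega> * dB B (snd p) s t \<omega> - (if fst p = snd p then t - s else 0)))"

definition step_area :: "real \<Rightarrow> real \<Rightarrow> 'n \<Rightarrow> ('w \<Rightarrow> real^'n) \<Rightarrow> 'w \<Rightarrow> real"
  where "step_area s t c V \<omega> = (\<Sum>p\<in>area_pairs. (1/2) * (bracket d \<sigma> (fst p) (snd p) (V \<omega>) $ c) *
    (dB B (fst p) s t \<omega> * dB B' (snd p) s t \<omega>))"

text \<open>The terms are sorted by their role in the error: Euler terms, remainders, and centred noise of
  degree two.\<close>

lemma step_component:
  "step s t \<omega> (V \<omega>) $ c = V \<omega> $ c + (t - s) * (\<sigma> 0 (V \<omega>) $ c) + (\<Sum>j=1..d. \<sigma> j (V \<omega>) $ c * dB B j s t \<omega>)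
     + step_rest s t c V \<omega> + step_quadratic s t c V \<omega> + step_area s t c V \<omega>"
proof -
  let ?f = "\<lambda>p. eta (fst p) (snd p) s t \<omega> * (Lop d \<sigma> (fst p) (\<sigma> (snd p)) (V \<omega>) $ c)"
  have lin: "(\<Sum>j=0..d. dB B j s t \<omega> * (\<sigma> j (V \<omega>) $ c)) =
      (t - s) * (\<sigma> 0 (V \<omega>) $ c) + (\<Sum>j=1..d. \<sigma> j (V \<omega>) $ c * dB B j s t \<omega>)"
    by (simp add: sum.atLeast_Suc_atMost dB_def[of _ 0] mult.commute)
  have "(\<Sum>j1=0..d. \<Sum>j2=0..d. eta j1 j2 s t \<omega> * (Lop d \<sigma> j1 (\<sigma> j2) (V \<omega>) $ c)) = (\<Sum>p\<in>{0..d} \<times> {0..d}. ?f p)"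
    by (simp add: sum.cartesian_product split_beta')
  also have "{0..d} \<times> {0..d} = rest_pairs \<union> {1..d} \<times> {1..d}" by (auto simp: rest_pairs_def)
  also have "sum ?f (rest_pairs \<union> {1..d} \<times> {1..d}) = sum ?f rest_pairs + sum ?f ({1..d} \<times> {1..d})"
    by (rule sum.union_disjoint) (auto simp: rest_pairs_def)
  also have "sum ?f ({1..d} \<times> {1..d}) = step_quadratic s t c V \<omega>"
    unfolding step_quadratic_def by (intro sum.cong refl) (auto simp: eta_def)
  finally have quad: "(\<Sum>j1=0..d. \<Sum>j2=0..d. eta j1 j2 s t \<omega> * (Lop d \<sigma> j1 (\<sigma> j2) (V \<omega>) $ c)) =
    step_rest s t c V \<omega> + step_quadratic s t c V \<omega>" by (simp add: step_rest_def)
  have area: "(1/2) * (\<Sum>j1=1..d. \<Sum>j2=Suc j1..d. dA B B' j1 j2 s t \<omega> * (bracket d \<sigma> j1 j2 (V \<omega>) $ c)) =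
      step_area s t c V \<omega>"
    unfolding step_area_def area_pairs_def
    by (subst sum.Sigma) (auto simp: sum_distrib_left dA_def mult_ac intro!: sum.cong)
  show ?thesis unfolding step_def using lin quad area by simp
qed

definition error_rest :: "real \<Rightarrow> real \<Rightarrow> 'n \<Rightarrow> ('w \<Rightarrow> real^'n) \<Rightarrow> 'w \<Rightarrow> real"
  where "error_rest s t c V \<omega> = drift_rest s t c \<omega> + (t - s) * (\<sigma> 0 (X s \<omega>) $ c - \<sigma> 0 (V \<omega>) $ c) + -
      step_rest s t c V \<omega>"

definition error_noise :: "real \<Rightarrow> real \<Rightarrow> 'n \<Rightarrow> ('w \<Rightarrow> real^'n) \<Rightarrow> 'w \<Rightarrow> real"
  where "error_noise s t c V \<omega> = mart_rest s t c \<omega> + (\<Sum>j=1..d. (\<sigma> j (X s \<omega>) $ c - \<sigma> j (V \<omega>) $ c) * dB B j s t \<omega>)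
    + - step_quadratic s t c V \<omega> + - step_area s t c V \<omega>"

text \<open>The Euler terms of the scheme are subtracted from those of the solution with frozen coefficients,
  which leaves differences controlled by the Lipschitz constant.\<close>

lemma one_step_error:
  assumes "0 \<le> s" "s \<le> t" "t \<le> T" "\<omega> \<in> space M"
  shows "X t \<omega> $ c - step s t \<omega> (V \<omega>) $ c = (X s \<omega> $ c - V \<omega> $ c) + error_rest s t c V \<omega> + error_noise s t c V \<omega>"
  using mart_increment[OF assms, of c] drift_rest_eq[OF assms, of c]
  by (simp add: step_component[of s t \<omega> V] error_rest_def error_noise_def mart_rest_def algebra_simps
      sum_subtractf)

text \<open>The first summand collects the constants of \<open>error_rest\<close>, the second those of \<open>error_noise\<close>.
  Adding three terms with \<open>even_moment_add_le\<close> costs a factor \<open>16\<^sup>q\<close>, adding four costs \<open>64\<^sup>q\<close>.\<close>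

definition \<kappa> :: "nat \<Rightarrow> real"
  where "\<kappa> q = 16 ^ q * (L ^ (2 * q) * X_const q + L ^ (2 * q) + real (card rest_pairs) ^ (2 * q) * (K ^
      (2 * q) * rest_const q))
    + 64 ^ q * (Riemann_const q * L ^ (2 * q) * X_const q + real d ^ (2 * q) * L ^ (2 * q) * gauss_moment q
       + real (card ({1..d} \<times> {1..d})) ^ (2 * q) * (K ^ (2 * q) * product_moment q)
       + real (card area_pairs) ^ (2 * q) * (K ^ (2 * q) * product_moment q))"

lemma product_moment_nonneg: "product_moment q \<ge> 0"
  by (simp add: product_moment_def gauss_moment_nonneg)

lemma \<kappa>_parts:
  "16 ^ q * (L ^ (2 * q) * X_const q + L ^ (2 * q) + real (card rest_pairs) ^ (2 * q) * (K ^ (2 * q) *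
      rest_const q)) \<le> \<kappa> q"
  "64 ^ q * (Riemann_const q * L ^ (2 * q) * X_const q + real d ^ (2 * q) * L ^ (2 * q) * gauss_moment q
       + real (card ({1..d} \<times> {1..d})) ^ (2 * q) * (K ^ (2 * q) * product_moment q)
       + real (card area_pairs) ^ (2 * q) * (K ^ (2 * q) * product_moment q)) \<le> \<kappa> q"
  "0 \<le> \<kappa> q"
proof -
  have "0 \<le> 16 ^ q * (L ^ (2 * q) * X_const q + L ^ (2 * q) + real (card rest_pairs) ^ (2 * q) * (K ^ (2
      * q) * rest_const q))"
    using L0 K0 by (intro mult_nonneg_nonneg add_nonneg_nonneg X_const_nonneg rest_const_nonneg zero_le_power) auto
  moreover have "0 \<le> 64 ^ q * (Riemann_const q * L ^ (2 * q) * X_const q + real d ^ (2 * q) * L ^ (2 * q)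
      * gauss_moment q
       + real (card ({1..d} \<times> {1..d})) ^ (2 * q) * (K ^ (2 * q) * product_moment q)
       + real (card area_pairs) ^ (2 * q) * (K ^ (2 * q) * product_moment q))"
    using L0 K0 by (intro mult_nonneg_nonneg add_nonneg_nonneg X_const_nonneg Riemann_const_nonneg
        gauss_moment_nonneg
        product_moment_nonneg zero_le_power) auto
  ultimately show
    "16 ^ q * (L ^ (2 * q) * X_const q + L ^ (2 * q) + real (card rest_pairs) ^ (2 * q) * (K ^ (2 * q) *
        rest_const q)) \<le> \<kappa> q"
    "64 ^ q * (Riemann_const q * L ^ (2 * q) * X_const q + real d ^ (2 * q) * L ^ (2 * q) * gauss_moment q
       + real (card ({1..d} \<times> {1..d})) ^ (2 * q) * (K ^ (2 * q) * product_moment q)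
       + real (card area_pairs) ^ (2 * q) * (K ^ (2 * q) * product_moment q)) \<le> \<kappa> q"
    "0 \<le> \<kappa> q"
    unfolding \<kappa>_def by linarith+
qed

context
  fixes s t :: real and V :: "'w \<Rightarrow> real^'n"
  assumes st: "0 \<le> s" "s \<le> t" "t \<le> T"
    and V: "V \<in> borel_measurable (F s)" "\<And>c. all_moments M (\<lambda>\<omega>. V \<omega> $ c)"
begin

lemma V_M: "V \<in> borel_measurable M"
  by (rule measurable_from_subalg[OF subalgebra_F[OF st(1)] V(1)])

lemma s_time: "s \<in> {0..T}"
  using st by auto

lemma distance_moments: "all_moments M (\<lambda>\<omega>. norm (X s \<omega> - V \<omega>))"
proof (rule norm_all_moments)
  show "(\<lambda>\<omega>. X s \<omega> - V \<omega>) \<in> borel_measurable M" by (intro borel_measurable_diff X_measurable s_time V_M)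
  show "all_moments M (\<lambda>\<omega>. (X s \<omega> - V \<omega>) $ c)" for c
    using all_moments_diff[OF X_moments[OF s_time] V(2)] by simp
qed

lemma bounded_coefficient:
  fixes f :: "real^'n \<Rightarrow> real"
  assumes f: "f \<in> borel_measurable borel" "\<And>z. \<bar>f z\<bar> \<le> K"
  shows "(\<lambda>\<omega>. f (V \<omega>)) \<in> borel_measurable (F s)" "all_moments M (\<lambda>\<omega>. f (V \<omega>))"
    "even_moment q (\<lambda>\<omega>. f (V \<omega>)) \<le> K ^ (2 * q)"
proof -
  show "(\<lambda>\<omega>. f (V \<omega>)) \<in> borel_measurable (F s)" by (rule measurable_compose[OF V(1) f(1)])
  show m: "all_moments M (\<lambda>\<omega>. f (V \<omega>))"
    by (rule all_moments_bound[OF all_moments_const[of K] measurable_compose[OF V_M f(1)]])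
      (use f(2) K0 in auto)
  have "even_moment q (\<lambda>\<omega>. f (V \<omega>)) \<le> even_moment q (\<lambda>\<omega>. K)"
    by (rule even_moment_mono[OF m all_moments_const f(2)])
  then show "even_moment q (\<lambda>\<omega>. f (V \<omega>)) \<le> K ^ (2 * q)" by (simp add: prob_space)
qed

lemma \<sigma>_borel: "j \<le> d \<Longrightarrow> (\<lambda>z. \<sigma> j z $ c) \<in> borel_measurable borel"
  by (rule borel_measurable_continuous_onI[OF \<sigma>_continuous])

lemma half_Lop: 
  assumes "i \<le> d" "j \<le> d"
  shows "(\<lambda>z. (1/2) * (Lop d \<sigma> i (\<sigma> j) z $ c)) \<in> borel_measurable borel" "\<bar>(1/2) * (Lop d \<sigma> i (\<sigma> j) z $ c)\<bar> \<le> K"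
  using Lop_measurable[OF assms, of c] Lop_bound[OF assms, of z c] by auto

lemma half_bracket:
  assumes "i \<le> d" "j \<le> d"
  shows "(\<lambda>z. (1/2) * (bracket d \<sigma> i j z $ c)) \<in> borel_measurable borel" "\<bar>(1/2) * (bracket d \<sigma> i j z $ c)\<bar> \<le> K"
proof -
  have eq: "(1/2) * (bracket d \<sigma> i j z $ c) = (1/2) * (Lop d \<sigma> i (\<sigma> j) z $ c - Lop d \<sigma> j (\<sigma> i) z $ c)" for z
    by (simp add: bracket_def)
  show "(\<lambda>z. (1/2) * (bracket d \<sigma> i j z $ c)) \<in> borel_measurable borel"
    unfolding eq by (intro borel_measurable_times borel_measurable_diff Lop_measurable assms) auto
  show "\<bar>(1/2) * (bracket d \<sigma> i j z $ c)\<bar> \<le> K"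
  proof -
    have "\<bar>Lop d \<sigma> i (\<sigma> j) z $ c - Lop d \<sigma> j (\<sigma> i) z $ c\<bar> \<le> 2 * K"
      using Lop_bound[OF assms, of z c] Lop_bound[OF assms(2,1), of z c] by linarith
    then show ?thesis unfolding eq abs_mult by simp
  qed
qed

lemma step_rest_estimates:
  shows "step_rest s t c V \<in> borel_measurable (F t)" "all_moments M (step_rest s t c V)"
    "q \<ge> 1 \<Longrightarrow> even_moment q (step_rest s t c V) \<le>
      real (card rest_pairs) ^ (2 * q) * (K ^ (2 * q) * rest_const q * (t - s) ^ (3 * q))"
proof -
  let ?f = "\<lambda>p \<omega>. eta (fst p) (snd p) s t \<omega> * (Lop d \<sigma> (fst p) (\<sigma> (snd p)) (V \<omega>) $ c)"
  have pairs: "fst p \<le> d" "snd p \<le> d" "fst p = 0 \<or> snd p = 0" if "p \<in> rest_pairs" for p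
    using that by (auto simp: rest_pairs_def)
  have eta: "eta (fst p) (snd p) s t \<in> borel_measurable (F t)" "all_moments M (eta (fst p) (snd p) s t)"
    "q \<ge> 1 \<Longrightarrow> even_moment q (eta (fst p) (snd p) s t) \<le> rest_const q * (t - s) ^ (3 * q)"
    if "p \<in> rest_pairs" for p q
    using eta_rest[OF pairs[OF that] st] by auto
  have coef: "(\<lambda>\<omega>. Lop d \<sigma> (fst p) (\<sigma> (snd p)) (V \<omega>) $ c) \<in> borel_measurable (F s)"
    "all_moments M (\<lambda>\<omega>. Lop d \<sigma> (fst p) (\<sigma> (snd p)) (V \<omega>) $ c)" if "p \<in> rest_pairs" for p
    by (rule bounded_coefficient[OF Lop_measurable[OF pairs(1,2)[OF that]] Lop_bound[OF pairs(1,2)[OF that]]])+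
  have m: "all_moments M (?f p)" if "p \<in> rest_pairs" for p
    by (rule all_moments_mult[OF eta(2)[OF that] coef(2)[OF that]])
  show "step_rest s t c V \<in> borel_measurable (F t)"
    unfolding step_rest_def[abs_def]
    by (intro borel_measurable_sum borel_measurable_times eta(1) F_mono[OF st(1,2) coef(1)])
  show "all_moments M (step_rest s t c V)"
    unfolding step_rest_def[abs_def] by (intro all_moments_sum m)
  show "even_moment q (step_rest s t c V) \<le>
      real (card rest_pairs) ^ (2 * q) * (K ^ (2 * q) * rest_const q * (t - s) ^ (3 * q))" if q: "q \<ge> 1"
    unfolding step_rest_def
  proof (rule sum_even_moment_le[OF finite_pairs(1) m q])
    fix p assume p: "p \<in> rest_pairs"
    have "even_moment q (?f p) \<le> even_moment q (\<lambda>\<omega>. K * \<bar>eta (fst p) (snd p) s t \<omega>\<bar>)"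
    proof (rule even_moment_mono[OF m[OF p]])
      show "all_moments M (\<lambda>\<omega>. K * \<bar>eta (fst p) (snd p) s t \<omega>\<bar>)"
        by (intro all_moments_cmult all_moments_abs eta p)
      show "\<bar>?f p \<omega>\<bar> \<le> K * \<bar>eta (fst p) (snd p) s t \<omega>\<bar>" for \<omega>
        using mult_left_mono[OF Lop_bound[OF pairs(1,2)[OF p], of "V \<omega>" c], of "\<bar>eta (fst p) (snd p) s t \<omega>\<bar>"]
        by (simp add: abs_mult mult.commute)
    qed
    also have "\<dots> = K ^ (2 * q) * even_moment q (eta (fst p) (snd p) s t)"
      by (simp only: power_mult_distrib even_power_abs integral_mult_right_zero)
    also have "\<dots> \<le> K ^ (2 * q) * (rest_const q * (t - s) ^ (3 * q))"
      using K0 by (intro mult_left_mono eta p q) auto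
    finally show "even_moment q (?f p) \<le> K ^ (2 * q) * rest_const q * (t - s) ^ (3 * q)" by simp
  qed
qed

lemma step_quadratic_estimates:
  shows "step_quadratic s t c V \<in> borel_measurable (F t)" "all_moments M (step_quadratic s t c V)"
    "Y \<in> borel_measurable (F s) \<Longrightarrow> integrable M (\<lambda>\<omega>. (Y \<omega>)\<^sup>2) \<Longrightarrow> expectation (\<lambda>\<omega>. Y \<omega> * step_quadratic s t c V \<omega>) = 0"
    "q \<ge> 1 \<Longrightarrow> even_moment q (step_quadratic s t c V) \<le>
      real (card ({1..d} \<times> {1..d})) ^ (2 * q) * (K ^ (2 * q) * (product_moment q * (t - s) ^ (2 * q)))"
proof -
  let ?\<eta> = "\<lambda>p \<omega>. (1/2) * (Lop d \<sigma> (fst p) (\<sigma> (snd p)) (V \<omega>) $ c)"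
  let ?Z = "\<lambda>p \<omega>. dB B (fst p) s t \<omega> * dB B (snd p) s t \<omega> - (if fst p = snd p then t - s else 0)"
  have pairs: "fst p \<in> {1..d}" "snd p \<in> {1..d}" "fst p \<le> d" "snd p \<le>
      d" if "p \<in> {1..d} \<times> {1..d}" for p using that by auto
  have fin: "finite ({1..d} \<times> {1..d})" by simp
  have terms: "?\<eta> p \<in> borel_measurable (F s)" "all_moments M (?\<eta> p)" "noise_term s t 2 product_moment (?Z p)"
    and bd: "even_moment q (?\<eta> p) \<le> K ^ (2 * q)" if p: "p \<in> {1..d} \<times> {1..d}" for p q
    by (rule bounded_coefficient[OF half_Lop[OF pairs(3,4)[OF p]]] noise_term_BB[OF pairs(1,2)[OF p] st(1,2)])+
  note nc = noise_combination[where A = "{1..d} \<times> {1..d}" and \<eta> = ?\<eta> and Z = ?Z and p = 2 and c = product_moment,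
      OF fin st(1,2) terms, folded step_quadratic_def]
  show "step_quadratic s t c V \<in> borel_measurable (F t)" by (rule nc(1))
  show "all_moments M (step_quadratic s t c V)" by (rule nc(2))
  show "Y \<in> borel_measurable (F s) \<Longrightarrow> integrable M (\<lambda>\<omega>. (Y \<omega>)\<^sup>2) \<Longrightarrow>
      expectation (\<lambda>\<omega>. Y \<omega> * step_quadratic s t c V \<omega>) = 0"
    by (rule nc(3))
  show "q \<ge> 1 \<Longrightarrow> even_moment q (step_quadratic s t c V) \<le>
      real (card ({1..d} \<times> {1..d})) ^ (2 * q) * (K ^ (2 * q) * (product_moment q * (t - s) ^ (2 * q)))"
    by (rule nc(4)[OF _ _ _ _ bd])
qed

lemma step_area_estimates:
  shows "step_area s t c V \<in> borel_measurable (F t)" "all_moments M (step_area s t c V)"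
    "Y \<in> borel_measurable (F s) \<Longrightarrow> integrable M (\<lambda>\<omega>. (Y \<omega>)\<^sup>2) \<Longrightarrow> expectation (\<lambda>\<omega>. Y \<omega> * step_area s t c V \<omega>) = 0"
    "q \<ge> 1 \<Longrightarrow> even_moment q (step_area s t c V) \<le>
      real (card area_pairs) ^ (2 * q) * (K ^ (2 * q) * (product_moment q * (t - s) ^ (2 * q)))"
proof -
  let ?\<eta> = "\<lambda>p \<omega>. (1/2) * (bracket d \<sigma> (fst p) (snd p) (V \<omega>) $ c)"
  let ?Z = "\<lambda>p \<omega>. dB B (fst p) s t \<omega> * dB B' (snd p) s t \<omega>"
  have pairs: "fst p \<in> {1..d}" "snd p \<in> {2..d}" "fst p \<le> d" "snd p \<le> d" if "p \<in> area_pairs" for p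
    using that by (auto simp: area_pairs_def)
  have terms: "?\<eta> p \<in> borel_measurable (F s)" "all_moments M (?\<eta> p)" "noise_term s t 2 product_moment (?Z p)"
    and bd: "even_moment q (?\<eta> p) \<le> K ^ (2 * q)" if p: "p \<in> area_pairs" for p q
    by (rule bounded_coefficient[OF half_bracket[OF pairs(3,4)[OF p]]] noise_term_BB'[OF pairs(1,2)[OF p]
        st(1,2)])+
  note nc = noise_combination[where A = area_pairs and \<eta> = ?\<eta> and Z = ?Z and p = 2 and c = product_moment,
      OF finite_pairs(2) st(1,2) terms, folded step_area_def]
  show "step_area s t c V \<in> borel_measurable (F t)" by (rule nc(1))
  show "all_moments M (step_area s t c V)" by (rule nc(2))
  show "Y \<in> borel_measurable (F s) \<Longrightarrow> integrable M (\<lambda>\<omega>. (Y \<omega>)\<^sup>2) \<Longrightarrow> expectation (\<lambda>\<omega>. Y \<omega> * step_area s t c V \<omega>) = 0"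
    by (rule nc(3))
  show "q \<ge> 1 \<Longrightarrow> even_moment q (step_area s t c V) \<le>
      real (card area_pairs) ^ (2 * q) * (K ^ (2 * q) * (product_moment q * (t - s) ^ (2 * q)))"
    by (rule nc(4)[OF _ _ _ _ bd])
qed

lemma step_linear_estimates:
  defines "A \<equiv> \<lambda>c \<omega>. \<Sum>j=1..d. (\<sigma> j (X s \<omega>) $ c - \<sigma> j (V \<omega>) $ c) * dB B j s t \<omega>"
  shows "A c \<in> borel_measurable (F t)" "all_moments M (A c)"
    "Y \<in> borel_measurable (F s) \<Longrightarrow> integrable M (\<lambda>\<omega>. (Y \<omega>)\<^sup>2) \<Longrightarrow> expectation (\<lambda>\<omega>. Y \<omega> * A c \<omega>) = 0"
    "q \<ge> 1 \<Longrightarrow> even_moment q (A c) \<le>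
      real (card {1..d}) ^ (2 * q) * (L ^ (2 * q) * even_moment q (\<lambda>\<omega>. norm (X s \<omega> - V \<omega>)) *
          (gauss_moment q * (t - s) ^ (1 * q)))"
proof -
  let ?\<eta> = "\<lambda>j \<omega>. \<sigma> j (X s \<omega>) $ c - \<sigma> j (V \<omega>) $ c"
  have terms: "?\<eta> j \<in> borel_measurable (F s)" "all_moments M (?\<eta> j)" "noise_term s t 1 gauss_moment (dB B j s t)"
    and bd: "even_moment q (?\<eta> j) \<le> L ^ (2 * q) * even_moment q (\<lambda>\<omega>. norm (X s \<omega> - V \<omega>))"
    if j: "j \<in> {1..d}" for j q
  proof -
    have jd: "j \<le> d" using j by simp
    show "?\<eta> j \<in> borel_measurable (F s)"
      by (intro borel_measurable_diff \<sigma>X_adapted jd s_time measurable_compose[OF V(1) \<sigma>_borel])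
    show "all_moments M (?\<eta> j)" "even_moment q (?\<eta> j) \<le> L ^ (2 * q) * even_moment q (\<lambda>\<omega>. norm (X s \<omega> - V \<omega>))"
      by (rule \<sigma>_difference_moments[OF jd X_measurable[OF s_time] V_M distance_moments])+
    show "noise_term s t 1 gauss_moment (dB B j s t)" by (rule noise_term_B[OF j st(1,2)])
  qed
  note nc = noise_combination[where A = "{1..d}" and \<eta> = ?\<eta> and Z = "\<lambda>j. dB B j s t" and p = 1 and c =
      gauss_moment,
      OF finite_atLeastAtMost st(1,2) terms]
  show "A c \<in> borel_measurable (F t)" unfolding A_def by (rule nc(1))
  show "all_moments M (A c)" unfolding A_def by (rule nc(2))
  show "Y \<in> borel_measurable (F s) \<Longrightarrow> integrable M (\<lambda>\<omega>. (Y \<omega>)\<^sup>2) \<Longrightarrow> expectation (\<lambda>\<omega>. Y \<omega> * A c \<omega>) = 0"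
    unfolding A_def by (rule nc(3))
  show "q \<ge> 1 \<Longrightarrow> even_moment q (A c) \<le>
      real (card {1..d}) ^ (2 * q) * (L ^ (2 * q) * even_moment q (\<lambda>\<omega>. norm (X s \<omega> - V \<omega>)) *
          (gauss_moment q * (t - s) ^ (1 * q)))"
    unfolding A_def by (rule nc(4)[OF _ _ _ _ bd])
qed

lemma error_rest_moments: "all_moments M (error_rest s t c V)"
  unfolding error_rest_def[abs_def]
  by (intro all_moments_add all_moments_cmult all_moments_uminus drift_rest_moments st step_rest_estimates
      \<sigma>_difference_moments(1) X_measurable s_time V_M distance_moments) auto

lemma error_rest_bound:
  assumes q: "q \<ge> 1"
  shows "even_moment q (error_rest s t c V) \<le>
    \<kappa> q * (t - s) ^ (2 * q) * ((t - s) ^ q + even_moment q (\<lambda>\<omega>. norm (X s \<omega> - V \<omega>)))"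
proof -
  define h a where "h = t - s" and "a = even_moment q (\<lambda>\<omega>. norm (X s \<omega> - V \<omega>))"
  have h0: "h \<ge> 0" and a0: "a \<ge> 0" using st by (auto simp: h_def a_def intro!: Bochner_Integration.integral_nonneg)
  have m0: "all_moments M (\<lambda>\<omega>. \<sigma> 0 (X s \<omega>) $ c - \<sigma> 0 (V \<omega>) $ c)"
    and b0: "even_moment q (\<lambda>\<omega>. \<sigma> 0 (X s \<omega>) $ c - \<sigma> 0 (V \<omega>) $ c) \<le> L ^ (2 * q) * a"
    unfolding a_def by (rule \<sigma>_difference_moments[OF _ X_measurable[OF s_time] V_M distance_moments]; simp)+
  have m1: "all_moments M (\<lambda>\<omega>. h * (\<sigma> 0 (X s \<omega>) $ c - \<sigma> 0 (V \<omega>) $ c))" by (rule all_moments_cmult[OF m0])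
  have b1: "even_moment q (\<lambda>\<omega>. h * (\<sigma> 0 (X s \<omega>) $ c - \<sigma> 0 (V \<omega>) $ c)) \<le> h ^ (2 * q) * (L ^ (2 * q) * a)"
    using mult_left_mono[OF b0, of "h ^ (2 * q)"] h0 by (simp add: power_mult_distrib)
  have b2: "even_moment q (\<lambda>\<omega>. - step_rest s t c V \<omega>) \<le>
      real (card rest_pairs) ^ (2 * q) * (K ^ (2 * q) * rest_const q * h ^ (3 * q))"
    using step_rest_estimates(3)[OF q, of c] by (simp add: h_def)
  have b3: "even_moment q (drift_rest s t c) \<le> h ^ (2 * q) * (L ^ (2 * q) * X_const q * h ^ q)"
    using drift_rest_moments(2)[OF st q] by (simp add: h_def)
  have h3: "h ^ (3 * q) = h ^ (2 * q) * h ^ q" by (simp flip: power_add)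
  have "even_moment q (error_rest s t c V) \<le>
    4 ^ q * (4 ^ q * (h ^ (2 * q) * (L ^ (2 * q) * X_const q * h ^ q) + h ^ (2 * q) * (L ^ (2 * q) * a))
      + real (card rest_pairs) ^ (2 * q) * (K ^ (2 * q) * rest_const q * h ^ (3 * q)))"
    unfolding error_rest_def h_def[symmetric]
    by (rule even_moment_add_le[OF all_moments_add[OF drift_rest_moments(1)[OF st] m1]
        all_moments_uminus[OF step_rest_estimates(2)]
       even_moment_add_le[OF drift_rest_moments(1)[OF st] m1 b3 b1] b2])
  also have "\<dots> \<le> 4 ^ q * (4 ^ q * (h ^ (2 * q) * (L ^ (2 * q) * X_const q * h ^ q) + h ^ (2 * q) * (L ^
      (2 * q) * a))
      + 4 ^ q * (real (card rest_pairs) ^ (2 * q) * (K ^ (2 * q) * rest_const q * h ^ (3 * q))))"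
  proof (intro mult_left_mono add_left_mono)
    have nn: "0 \<le> real (card rest_pairs) ^ (2 * q) * (K ^ (2 * q) * rest_const q * h ^ (3 * q))"
      using h0 K0 by (intro mult_nonneg_nonneg rest_const_nonneg) auto
    have four: "1 \<le> (4::real) ^ q" by simp
    show "real (card rest_pairs) ^ (2 * q) * (K ^ (2 * q) * rest_const q * h ^ (3 * q))
       \<le> 4 ^ q * (real (card rest_pairs) ^ (2 * q) * (K ^ (2 * q) * rest_const q * h ^ (3 * q)))"
      using mult_right_mono[OF four nn] by (simp only: mult_1)
  qed simp
  also have "\<dots> = 16 ^ q * h ^ (2 * q) * (L ^ (2 * q) * X_const q * h ^ q + L ^ (2 * q) * a
      + real (card rest_pairs) ^ (2 * q) * (K ^ (2 * q) * rest_const q) * h ^ q)"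
  proof -
    have "(16::real) ^ q = 4 ^ q * 4 ^ q" by (simp flip: power_mult_distrib)
    then show ?thesis unfolding h3 by (simp only: algebra_simps)
  qed
  also have "\<dots> \<le> 16 ^ q * h ^ (2 * q) * ((L ^ (2 * q) * X_const q + L ^ (2 * q) + real (card rest_pairs)
      ^ (2 * q) * (K ^ (2 * q) * rest_const q)) * (h ^ q + a))"
  proof (intro mult_left_mono)
    define \<alpha> \<beta> \<gamma> where "\<alpha> = L ^ (2 * q) * X_const q" and "\<beta> = L ^ (2 * q)" and "\<gamma> =
        real (card rest_pairs) ^ (2 * q) * (K ^ (2 * q) * rest_const q)"
    have "\<alpha> \<ge> 0" "\<beta> \<ge> 0" "\<gamma> \<ge> 0" "h ^ q \<ge> 0"
      unfolding \<alpha>_def \<beta>_def \<gamma>_def using L0 K0 h0 by (auto intro!: mult_nonneg_nonneg X_const_nonneg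
          rest_const_nonneg)
    then have "0 \<le> \<alpha> * a" "0 \<le> \<beta> * h ^ q" "0 \<le> \<gamma> * a" using a0 by auto
    then have "\<alpha> * h ^ q + \<beta> * a + \<gamma> * h ^ q \<le> (\<alpha> + \<beta> + \<gamma>) * (h ^ q + a)" by (simp add: algebra_simps)
    then show "L ^ (2 * q) * X_const q * h ^ q + L ^ (2 * q) * a + real (card rest_pairs) ^ (2 * q) * (K
        ^ (2 * q) * rest_const q) * h ^ q
      \<le> (L ^ (2 * q) * X_const q + L ^ (2 * q) + real (card rest_pairs) ^ (2 * q) * (K ^ (2 * q) *
          rest_const q)) * (h ^ q + a)"
      by (simp only: \<alpha>_def \<beta>_def \<gamma>_def)
  qed (use h0 in auto)
  also have "\<dots> = (16 ^ q * (L ^ (2 * q) * X_const q + L ^ (2 * q) + real (card rest_pairs) ^ (2 * q) * (K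
      ^ (2 * q) * rest_const q))) * h ^ (2 * q) * (h ^ q + a)"
    by (simp only: mult_ac)
  also have "\<dots> \<le> \<kappa> q * h ^ (2 * q) * (h ^ q + a)"
    using h0 a0 by (intro mult_right_mono \<kappa>_parts) auto
  finally show ?thesis by (simp add: h_def a_def)
qed

lemma error_noise_adapted: "error_noise s t c V \<in> borel_measurable (F t)"
  unfolding error_noise_def[abs_def]
  by (intro borel_measurable_add borel_measurable_uminus mart_rest_moments(3) st step_linear_estimates(1)
      step_quadratic_estimates(1) step_area_estimates(1))

lemma error_noise_moments: "all_moments M (error_noise s t c V)"
  unfolding error_noise_def[abs_def]
  by (intro all_moments_add all_moments_uminus mart_rest_moments(1) st step_linear_estimates(2)
      step_quadratic_estimates(2) step_area_estimates(2))

lemma error_noise_orthogonal: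
  assumes Y: "Y \<in> borel_measurable (F s)" "integrable M (\<lambda>\<omega>. (Y \<omega>)\<^sup>2)"
  shows "expectation (\<lambda>\<omega>. Y \<omega> * error_noise s t c V \<omega>) = 0"
proof -
  let ?A = "\<lambda>\<omega>. \<Sum>j=1..d. (\<sigma> j (X s \<omega>) $ c - \<sigma> j (V \<omega>) $ c) * dB B j s t \<omega>"
  have Ym: "Y \<in> borel_measurable M" by (rule F_measurable[OF st(1) Y(1)])
  have int: "integrable M (\<lambda>\<omega>. Y \<omega> * f \<omega>)" if "all_moments M f" for f
    by (rule integrable_mult_square[OF Ym all_moments_measurable[OF that] Y(2) power_integrable[OF that]])
  have i: "integrable M (\<lambda>\<omega>. Y \<omega> * mart_rest s t c \<omega>)" "integrable M (\<lambda>\<omega>. Y \<omega> * ?A \<omega>)"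
    "integrable M (\<lambda>\<omega>. Y \<omega> * step_quadratic s t c V \<omega>)" "integrable M (\<lambda>\<omega>. Y \<omega> * step_area s t c V \<omega>)"
    by (intro int mart_rest_moments(1) st step_linear_estimates(2) step_quadratic_estimates(2)
        step_area_estimates(2))+
  have "expectation (\<lambda>\<omega>. Y \<omega> * error_noise s t c V \<omega>) =
    expectation (\<lambda>\<omega>. Y \<omega> * mart_rest s t c \<omega> + Y \<omega> * ?A \<omega> - Y \<omega> * step_quadratic s t c V \<omega> - Y \<omega> *
        step_area s t c V \<omega>)"
    unfolding error_noise_def by (simp only: distrib_left right_diff_distrib mult_minus_right add_uminus_conv_diff)
  also have "\<dots> = expectation (\<lambda>\<omega>. Y \<omega> * mart_rest s t c \<omega>) + expectation (\<lambda>\<omega>. Y \<omega> * ?A \<omega>)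
     - expectation (\<lambda>\<omega>. Y \<omega> * step_quadratic s t c V \<omega>) - expectation (\<lambda>\<omega>. Y \<omega> * step_area s t c V \<omega>)"
    using i by simp
  also have "\<dots> = 0"
    using mart_rest_moments(4)[OF st Y] step_linear_estimates(3)[OF Y] step_quadratic_estimates(3)[OF Y]
        step_area_estimates(3)[OF Y]
    by simp
  finally show ?thesis .
qed

lemma error_noise_bound:
  assumes q: "q \<ge> 1"
  shows "even_moment q (error_noise s t c V) \<le>
    \<kappa> q * (t - s) ^ q * ((t - s) ^ q + even_moment q (\<lambda>\<omega>. norm (X s \<omega> - V \<omega>)))"
proof -
  define h a where "h = t - s" and "a = even_moment q (\<lambda>\<omega>. norm (X s \<omega> - V \<omega>))"
  have h0: "h \<ge> 0" and a0: "a \<ge> 0" using st by (auto simp: h_def a_def intro!: Bochner_Integration.integral_nonneg)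
  define \<alpha> \<beta> \<gamma> \<delta> where "\<alpha> = Riemann_const q * L ^ (2 * q) * X_const q" and "\<beta> =
      real d ^ (2 * q) * L ^ (2 * q) * gauss_moment q"
    and "\<gamma> = real (card ({1..d} \<times> {1..d})) ^ (2 * q) * (K ^ (2 * q) * product_moment q)"
    and "\<delta> = real (card area_pairs) ^ (2 * q) * (K ^ (2 * q) * product_moment q)"
  have nn: "\<alpha> \<ge> 0" "\<beta> \<ge> 0" "\<gamma> \<ge> 0" "\<delta> \<ge> 0"
    unfolding \<alpha>_def \<beta>_def \<gamma>_def \<delta>_def using L0 K0
    by (intro mult_nonneg_nonneg X_const_nonneg Riemann_const_nonneg gauss_moment_nonneg
        product_moment_nonneg zero_le_power; simp)+
  have hq: "h ^ q \<ge> 0" using h0 by simp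
  have h2: "h ^ (2 * q) = h ^ q * h ^ q" by (simp add: mult_2 power_add)
  have b1: "even_moment q (mart_rest s t c) \<le> \<alpha> * (h ^ q * h ^ q)"
    using mart_rest_moments(2)[OF st q, of c] by (simp add: h_def \<alpha>_def mult_ac)
  have b2: "even_moment q (\<lambda>\<omega>. \<Sum>j=1..d. (\<sigma> j (X s \<omega>) $ c - \<sigma> j (V \<omega>) $ c) * dB B j s t \<omega>) \<le> \<beta> * (h ^ q * a)"
    using step_linear_estimates(4)[OF q, of c] by (simp add: h_def a_def \<beta>_def mult_ac)
  have b3: "even_moment q (\<lambda>\<omega>. - step_quadratic s t c V \<omega>) \<le> \<gamma> * (h ^ q * h ^ q)"
    using step_quadratic_estimates(4)[OF q, of c] unfolding h_def[symmetric] h2 \<gamma>_def by (simp add: mult_ac)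
  have b4: "even_moment q (\<lambda>\<omega>. - step_area s t c V \<omega>) \<le> \<delta> * (h ^ q * h ^ q)"
    using step_area_estimates(4)[OF q, of c] unfolding h_def[symmetric] h2 \<delta>_def by (simp add: mult_ac)
  note m1 = mart_rest_moments(1)[OF st, of c] and m2 = step_linear_estimates(2)[of c]
    and m3 = all_moments_uminus[OF step_quadratic_estimates(2)[of c]] and m4 =
        all_moments_uminus[OF step_area_estimates(2)[of c]]
  have "even_moment q (error_noise s t c V) \<le>
    4 ^ q * (4 ^ q * (4 ^ q * (\<alpha> * (h ^ q * h ^ q) + \<beta> * (h ^ q * a)) + \<gamma> * (h ^ q * h ^ q)) + \<delta> * (h ^ q
        * h ^ q))"
    unfolding error_noise_def
    by (rule even_moment_add_le[OF all_moments_add[OF all_moments_add[OF m1 m2] m3] m4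
        even_moment_add_le[OF all_moments_add[OF m1 m2] m3 even_moment_add_le[OF m1 m2 b1 b2] b3] b4])
  also have "\<dots> \<le> 64 ^ q * (\<alpha> * (h ^ q * h ^ q) + \<beta> * (h ^ q * a) + \<gamma> * (h ^ q * h ^ q) + \<delta> * (h ^ q * h ^ q))"
  proof -
    have four: "1 \<le> (4::real) ^ q" by simp
    have grow: "4 ^ q * (u + v) \<le> 4 ^ q * (u + 4 ^ q * v)" "v \<le> 4 ^ q * v" if "v \<ge> 0" for u v :: real
      using mult_right_mono[OF four that] by auto
    define w1 w3 w4 where "w1 = \<alpha> * (h ^ q * h ^ q) + \<beta> * (h ^ q * a)" and "w3 =
        \<gamma> * (h ^ q * h ^ q)" and "w4 = \<delta> * (h ^ q * h ^ q)"
    have w: "w3 \<ge> 0" "w4 \<ge> 0" unfolding w3_def w4_def using nn hq by auto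
    have "4 ^ q * (4 ^ q * (4 ^ q * w1 + w3) + w4) \<le> 4 ^ q * (4 ^ q * (4 ^ q * w1 + 4 ^ q * w3) + 4 ^ q *
        (4 ^ q * w4))"
      using grow[OF w(1)] grow[OF w(2)] grow[of "4 ^ q * w4"] w
      by (intro mult_left_mono add_mono) (auto intro: order_trans)
    also have "\<dots> = 64 ^ q * (w1 + w3 + w4)"
    proof -
      have "(64::real) ^ q = 4 ^ q * 4 ^ q * 4 ^ q" by (simp flip: power_mult_distrib)
      then show ?thesis by (simp only: algebra_simps)
    qed
    finally show ?thesis by (simp only: w1_def w3_def w4_def)
  qed
  also have "\<dots> \<le> 64 ^ q * ((\<alpha> + \<beta> + \<gamma> + \<delta>) * (h ^ q * (h ^ q + a)))"
  proof (intro mult_left_mono)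
    have "0 \<le> \<alpha> * (h ^ q * a)" "0 \<le> \<beta> * (h ^ q * h ^ q)" "0 \<le> \<gamma> * (h ^ q * a)" "0 \<le> \<delta> * (h ^ q * a)"
      using nn hq a0 by auto
    then show "\<alpha> * (h ^ q * h ^ q) + \<beta> * (h ^ q * a) + \<gamma> * (h ^ q * h ^ q) + \<delta> * (h ^ q * h ^ q) \<le>
        (\<alpha> + \<beta> + \<gamma> + \<delta>) * (h ^ q * (h ^ q + a))"
      by (simp add: algebra_simps)
  qed simp
  also have "\<dots> = (64 ^ q * (\<alpha> + \<beta> + \<gamma> + \<delta>)) * h ^ q * (h ^ q + a)" by (simp only: mult_ac)
  also have "\<dots> \<le> \<kappa> q * h ^ q * (h ^ q + a)"
    using hq a0 \<kappa>_parts(2)[of q] by (intro mult_right_mono) (auto simp: \<alpha>_def \<beta>_def \<gamma>_def \<delta>_def)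
  finally show ?thesis by (simp add: h_def a_def)
qed

lemma step_estimates:
  shows "(\<lambda>\<omega>. step s t \<omega> (V \<omega>)) \<in> borel_measurable (F t)" "all_moments M (\<lambda>\<omega>. step s t \<omega> (V \<omega>) $ c)"
proof -
  have terms: "(\<lambda>\<omega>. \<sigma> j (V \<omega>) $ c) \<in> borel_measurable (F s)" "all_moments M (\<lambda>\<omega>. \<sigma> j (V \<omega>) $ c)"
    "noise_term s t 1 gauss_moment (dB B j s t)" if j: "j \<in> {1..d}" for j c
  proof -
    have jd: "j \<le> d" using j by simp
    show "(\<lambda>\<omega>. \<sigma> j (V \<omega>) $ c) \<in> borel_measurable (F s)" "all_moments M (\<lambda>\<omega>. \<sigma> j (V \<omega>) $ c)"
      by (rule bounded_coefficient[OF \<sigma>_borel[OF jd] \<sigma>_bound[OF jd]])+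
    show "noise_term s t 1 gauss_moment (dB B j s t)" by (rule noise_term_B[OF j st(1,2)])
  qed
  have nc: "(\<lambda>\<omega>. \<Sum>j=1..d. \<sigma> j (V \<omega>) $ c * dB B j s t \<omega>) \<in> borel_measurable (F t)"
    "all_moments M (\<lambda>\<omega>. \<Sum>j=1..d. \<sigma> j (V \<omega>) $ c * dB B j s t \<omega>)" for c
    by (rule noise_combination[where A = "{1..d}" and \<eta> = "\<lambda>j \<omega>. \<sigma> j (V \<omega>) $ c" and Z =
        "\<lambda>j. dB B j s t" and p = 1 and c = gauss_moment,
      OF finite_atLeastAtMost st(1,2) terms]; assumption)+
  have V0: "(\<lambda>\<omega>. \<sigma> 0 (V \<omega>) $ c) \<in> borel_measurable (F s)" "all_moments M (\<lambda>\<omega>. \<sigma> 0 (V \<omega>) $ c)" for c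
    by (rule bounded_coefficient[OF \<sigma>_borel \<sigma>_bound]; simp)+
  have Vc: "(\<lambda>\<omega>. V \<omega> $ c) \<in> borel_measurable (F s)" for c
    by (rule measurable_compose[OF V(1) vec_nth_borel])
  show "(\<lambda>\<omega>. step s t \<omega> (V \<omega>)) \<in> borel_measurable (F t)"
  proof (rule borel_measurable_vecI)
    show "(\<lambda>\<omega>. step s t \<omega> (V \<omega>) $ c) \<in> borel_measurable (F t)" for c
      unfolding step_component
      by (intro borel_measurable_add borel_measurable_times borel_measurable_const nc F_mono[OF st(1,2)
          Vc] F_mono[OF st(1,2) V0(1)]
          step_rest_estimates(1) step_quadratic_estimates(1) step_area_estimates(1))
  qed
  show "all_moments M (\<lambda>\<omega>. step s t \<omega> (V \<omega>) $ c)"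
    unfolding step_component
    by (intro all_moments_add all_moments_cmult nc V V0 step_rest_estimates(2)
        step_quadratic_estimates(2) step_area_estimates(2))
qed

end

end

section \<open>Strong error of the scheme\<close>

context weak_scheme
begin

text \<open>The scheme with the pathwise coefficients \<open>eta\<close>; it is adapted, and agrees with the scheme almost
  surely.\<close>

primrec approx :: "real \<Rightarrow> nat \<Rightarrow> 'w \<Rightarrow> real^'n"
  where
    "approx h 0 \<omega> = x"
  | "approx h (Suc k) \<omega> = step (real k * h) (real (Suc k) * h) \<omega> (approx h k \<omega>)"

lemma approx_adapted:
  assumes h: "h \<ge> 0"
  shows "real k * h \<le> T \<Longrightarrow> approx h k \<in> borel_measurable (F (real k * h)) \<and>
      (\<forall>c. all_moments M (\<lambda>\<omega>. approx h k \<omega> $ c))"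
proof (induction k)
  case 0
  have "approx h 0 = (\<lambda>_. x)" by auto
  then show ?case by (simp add: all_moments_const)
next
  case (Suc k)
  have le: "real k * h \<le> real (Suc k) * h" using h by (intro mult_right_mono) auto
  then have IH: "approx h k \<in> borel_measurable (F (real k * h))" "\<And>c. all_moments M (\<lambda>\<omega>. approx h k \<omega> $ c)"
    using Suc by auto
  have "0 \<le> real k * h" using h by simp
  note step_estimates[OF this le Suc.prems IH]
  then show ?case by (simp add: approx.simps(2)[abs_def])
qed

lemma scheme_approx:
  assumes h: "h \<ge> 0"
  shows "AE \<omega> in M. \<forall>k. scheme M F d S \<sigma> B B' h x k \<omega> = approx h k \<omega>"
proof -
  have "AE \<omega> in M. j1 \<le> d \<longrightarrow> j2 \<le> d \<longrightarrow> deta M F S B j1 j2 (real k * h) (real (Suc k) * h) \<omega> =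
      eta j1 j2 (real k * h) (real (Suc k) * h) \<omega>"
    for k j1 j2
  proof (cases "j1 \<le> d \<and> j2 \<le> d")
    case True
    then have "AE \<omega> in M. deta M F S B j1 j2 (real k * h) (real (Suc k) * h) \<omega> =
        eta j1 j2 (real k * h) (real (Suc k) * h) \<omega>"
      using h by (intro deta_eta mult_right_mono) auto
    then show ?thesis by eventually_elim simp
  qed auto
  then have "AE \<omega> in M. \<forall>k j1 j2. j1 \<le> d \<longrightarrow> j2 \<le> d \<longrightarrow>
      deta M F S B j1 j2 (real k * h) (real (Suc k) * h) \<omega> = eta j1 j2 (real k * h) (real (Suc k) * h) \<omega>"
    unfolding AE_all_countable by blast
  then show ?thesis
  proof eventually_elim
    case (elim \<omega>)
    have eq: "scheme_step M F d S \<sigma> B B' (real k * h) (real (Suc k) * h) \<omega> z =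
        step (real k * h) (real (Suc k) * h) \<omega> z" for k z
    proof -
      have "(\<Sum>j1=0..d. \<Sum>j2=0..d. deta M F S B j1 j2 (real k * h) (real (Suc k) * h) \<omega> *\<^sub>R Lop d \<sigma> j1 (\<sigma> j2) z)
        = (\<Sum>j1=0..d. \<Sum>j2=0..d. eta j1 j2 (real k * h) (real (Suc k) * h) \<omega> *\<^sub>R Lop d \<sigma> j1 (\<sigma> j2) z)"
        using elim by (intro sum.cong refl) simp
      then show ?thesis by (simp only: scheme_step_def step_def)
    qed
    show ?case
    proof
      fix k
      show "scheme M F d S \<sigma> B B' h x k \<omega> = approx h k \<omega>"
        by (induction k) (simp_all add: eq del: of_nat_Suc)
    qed
  qed
qed

lemma deta_measurable:
  assumes j: "j1 \<le> d" "j2 \<le> d" and st: "0 \<le> s" "s \<le> t" "t \<le> T"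
  shows "deta M F S B j1 j2 s t \<in> borel_measurable M"
proof (cases "S \<noteq> {} \<and> j1 = 0 \<and> j2 \<noteq> 0")
  case True
  then have j: "j2 \<in> {1..d}" using j by auto
  have "has_ito_integral M F (B j2) s t (\<lambda>v _. integral {s..v} (\<lambda>u. 1)) (ito_integral M F (B j2) s t (\<lambda>v
      _. integral {s..v} (\<lambda>u. 1::real)))"
    unfolding ito_integral_def
    by (rule someI[where P = "has_ito_integral M F (B j2) s t (\<lambda>v _. integral {s..v} (\<lambda>u. 1))", OF
        wiener.has_ito_integral_time[OF wiener_B[OF j] st(1,2)]])
  then have "ito_integral M F (B j2) s t (\<lambda>v _. integral {s..v} (\<lambda>u. 1::real)) \<in> borel_measurable M"
    by (simp add: has_ito_integral_def)
  moreover have "deta M F S B j1 j2 s t = ito_integral M F (B j2) s t (\<lambda>v _. integral {s..v} (\<lambda>u. 1::real))"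
    using True by (intro ext) (simp add: deta_def)
  ultimately show ?thesis by simp
next
  case False
  then have eq: "deta M F S B j1 j2 s t = eta j1 j2 s t"
    by (intro ext) (auto simp: deta_def eta_def area_term_def)
  have t: "0 \<le> t" using st by simp
  show ?thesis
  proof (cases "j1 = 0 \<or> j2 = 0")
    case True
    then show ?thesis unfolding eq using eta_rest[OF j True st] F_measurable[OF t] by blast
  next
    case False
    then have "j1 \<in> {1..d}" "j2 \<in> {1..d}" using j by auto
    then have [measurable]: "dB B j1 s t \<in> borel_measurable M" "dB B j2 s t \<in> borel_measurable M"
      using noise_term_B[OF _ st(1,2)] all_moments_measurable unfolding noise_term_def by blast+
    have "eta j1 j2 s t = (\<lambda>\<omega>. (1/2) * (dB B j1 s t \<omega> * dB B j2 s t \<omega> - (if j1 = j2 then t - s else 0)))"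
      using False by (intro ext) (simp add: eta_def)
    then show ?thesis unfolding eq by simp
  qed
qed

text \<open>Agreement with \<open>approx\<close> outside a null set does not imply measurability, since \<open>M\<close> may be incomplete.
  Each version of the stochastic integral of time is measurable by definition.\<close>

lemma scheme_measurable:
  assumes h: "h \<ge> 0"
  shows "real k * h \<le> T \<Longrightarrow> scheme M F d S \<sigma> B B' h x k \<in> borel_measurable M"
proof (induction k)
  case 0
  have "scheme M F d S \<sigma> B B' h x 0 = (\<lambda>_. x)" by auto
  then show ?case by simp
next
  case (Suc k)
  define s t where "s = real k * h" and "t = real (Suc k) * h"
  have st: "0 \<le> s" "s \<le> t" "t \<le> T" using h Suc.prems by (auto simp: s_def t_def intro!: mult_right_mono)
  define V where "V = scheme M F d S \<sigma> B B' h x k"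
  have V: "V \<in> borel_measurable M" unfolding V_def using Suc.IH st by (simp add: s_def)
  have Vc: "(\<lambda>\<omega>. V \<omega> $ c) \<in> borel_measurable M" for c by (rule measurable_compose[OF V vec_nth_borel])
  have dBm: "dB B j s t \<in> borel_measurable M" if "j \<le> d" for j
  proof (cases "j = 0")
    case True
    then have "dB B j s t = (\<lambda>_. t - s)" by (intro ext) (simp add: dB_def)
    then show ?thesis by simp
  next
    case False
    then have "j \<in> {1..d}" using that by auto
    then show ?thesis using noise_term_B[OF _ st(1,2)] all_moments_measurable unfolding noise_term_def by blast
  qed
  have dAm: "dA B B' j1 j2 s t \<in> borel_measurable M" if "j1 \<in> {1..d}" "j2 \<in> {Suc j1..d}" for j1 j2
  proof -
    have "j2 \<in> {2..d}" using that by auto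
    then have "dB B' j2 s t \<in> borel_measurable M"
      using noise_term_B'[OF _ st(1,2)] all_moments_measurable unfolding noise_term_def by blast
    then show ?thesis unfolding dA_def[abs_def] using dBm[of j1] that by (intro borel_measurable_times) auto
  qed
  have coef: "(\<lambda>\<omega>. f (V \<omega>)) \<in> borel_measurable M" if "f \<in> borel_measurable borel" for f :: "real^'n \<Rightarrow> real"
    by (rule measurable_compose[OF V that])
  have br: "(\<lambda>\<omega>. bracket d \<sigma> i j (V \<omega>) $ c) \<in> borel_measurable M" if "i \<le> d" "j \<le> d" for i j c
    unfolding bracket_def vector_minus_component
    by (intro borel_measurable_diff coef Lop_measurable that)
  have eq: "scheme M F d S \<sigma> B B' h x (Suc k) = (\<lambda>\<omega>. scheme_step M F d S \<sigma> B B' s t \<omega> (V \<omega>))"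
    by (intro ext) (simp add: V_def s_def t_def)
  show ?case unfolding eq
  proof (rule borel_measurable_vecI)
    fix c
    have comp: "scheme_step M F d S \<sigma> B B' s t \<omega> (V \<omega>) $ c = V \<omega> $ c + (\<Sum>j=0..d. dB B j s t \<omega> * (\<sigma> j (V \<omega>) $ c))
      + (\<Sum>j1=0..d. \<Sum>j2=0..d. deta M F S B j1 j2 s t \<omega> * (Lop d \<sigma> j1 (\<sigma> j2) (V \<omega>) $ c))
      + (1/2) * (\<Sum>j1=1..d. \<Sum>j2=Suc j1..d. dA B B' j1 j2 s t \<omega> * (bracket d \<sigma> j1 j2 (V \<omega>) $ c))" for \<omega>
      by (simp add: scheme_step_def)
    have m1: "(\<lambda>\<omega>. dB B j s t \<omega> * (\<sigma> j (V \<omega>) $ c)) \<in> borel_measurable M" if "j \<in> {0..d}" for j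
      using that by (intro borel_measurable_times dBm coef borel_measurable_continuous_onI[OF \<sigma>_continuous]) auto
    have m2: "(\<lambda>\<omega>. deta M F S B j1 j2 s t \<omega> * (Lop d \<sigma> j1 (\<sigma> j2) (V \<omega>) $ c)) \<in> borel_measurable M"
      if "j1 \<in> {0..d}" "j2 \<in> {0..d}" for j1 j2
      using that by (intro borel_measurable_times deta_measurable st coef Lop_measurable) auto
    have m3: "(\<lambda>\<omega>. dA B B' j1 j2 s t \<omega> * (bracket d \<sigma> j1 j2 (V \<omega>) $ c)) \<in> borel_measurable M"
      if "j1 \<in> {1..d}" "j2 \<in> {Suc j1..d}" for j1 j2
      using that by (intro borel_measurable_times dAm br) auto
    show "(\<lambda>\<omega>. scheme_step M F d S \<sigma> B B' s t \<omega> (V \<omega>) $ c) \<in> borel_measurable M"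
      unfolding comp by (intro borel_measurable_add borel_measurable_sum m1 m2 m3
          borel_measurable_times[OF borel_measurable_const] Vc)
  qed
qed

lemma strong_error:
  assumes q: "q \<ge> 1" "even q"
  shows "\<exists>C\<ge>0. \<forall>n h. h > 0 \<longrightarrow> real n * h = T \<longrightarrow>
    (\<exists>Z. integrable M Z \<and> expectation Z \<le> C * h ^ q \<and>
      (AE \<omega> in M. \<forall>k\<le>n. norm (X (real k * h) \<omega> - scheme M F d S \<sigma> B B' h x k \<omega>) ^ (2 * q) \<le> Z \<omega>))"
proof -
  define \<Lambda> where "\<Lambda> = real CARD('n) ^ (2 * q) * (4 ^ q * (\<kappa> q * (T ^ (2 * q - 1) + 4 * martingale_const q
      * T ^ (q - 1))))"
  have \<Lambda>0: "\<Lambda> \<ge> 0" unfolding \<Lambda>_def using \<kappa>_parts(3) T by (simp add: martingale_const_def)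
  have "\<exists>Z. integrable M Z \<and> expectation Z \<le> \<Lambda> * T * exp (\<Lambda> * T) * h ^ q \<and>
      (AE \<omega> in M. \<forall>k\<le>n. norm (X (real k * h) \<omega> - scheme M F d S \<sigma> B B' h x k \<omega>) ^ (2 * q) \<le> Z \<omega>)"
    if h: "h > 0" "real n * h = T" for n h
  proof -
    define t where "t k = real k * h" for k
    have t_diff: "t (Suc k) - t k = h" for k by (simp add: t_def algebra_simps)
    have t0: "0 \<le> t k" and t_mono: "i \<le> j \<Longrightarrow> t i \<le> t j" for i j k
      using h by (auto simp: t_def intro!: mult_right_mono)
    have tT: "t k \<le> T" if "k \<le> n" for k using t_mono[OF that] h(2) by (simp add: t_def)
    have st: "0 \<le> t k" "t k \<le> t (Suc k)" "t (Suc k) \<le> T" if "k < n" for k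
      using t0 t_mono[of k "Suc k"] tT[of "Suc k"] that by auto
    have Y: "approx h k \<in> borel_measurable (F (t k))" "all_moments M (\<lambda>\<omega>. approx h k \<omega> $ c)" if "k \<le> n" for k c
      using approx_adapted[of h k] tT[OF that] h by (auto simp: t_def)
    have YM: "approx h k \<in> borel_measurable M" if "k \<le> n" for k
      by (rule measurable_from_subalg[OF subalgebra_F[OF t0] Y(1)[OF that]])
    define P where "P c k = error_rest (t k) (t (Suc k)) c (approx h k)" for c k
    define D where "D c k = error_noise (t k) (t (Suc k)) c (approx h k)" for c k
    (* The accumulated one-step errors differ from X - approx by X 0 - x, which vanishes only
       almost surely. *)
    define e where "e k \<omega> = (\<chi> c. (\<Sum>i<k. P c i \<omega>) + (\<Sum>i<k. D c i \<omega>))" for k \<omega>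
    have MD: "martingale_differences M (\<lambda>i. F (t i)) (D c) n" for c
    proof
      show "subalgebra M (F (t i))" for i by (rule subalgebra_F[OF t0])
      show "sets (F (t i)) \<subseteq> sets (F (t j))" if "i \<le> j" for i j
        using filtered t0 t_mono[OF that] by (auto simp: filtered_def)
      fix i assume i: "i < n"
      have Yi: "approx h i \<in> borel_measurable (F (t i))" "\<And>c. all_moments M (\<lambda>\<omega>. approx h i \<omega> $ c)" using
          Y[of i] i by auto
      show "D c i \<in> borel_measurable (F (t (Suc i)))" unfolding D_def by (rule error_noise_adapted[OF st[OF i] Yi])
      show "all_moments M (D c i)" unfolding D_def by (rule error_noise_moments[OF st[OF i] Yi])
      show "expectation (\<lambda>\<omega>. Y \<omega> * D c i \<omega>) = 0"
        if "Y \<in> borel_measurable (F (t i))" "integrable M (\<lambda>\<omega>. (Y \<omega>)\<^sup>2)" for Y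
        unfolding D_def by (rule error_noise_orthogonal[OF st[OF i] Yi that])
    qed
    have Pm: "all_moments M (P c i)" if "i < n" for c i
      unfolding P_def using Y[of i] that by (intro error_rest_moments[OF st[OF that]]) auto
    have Dm: "all_moments M (D c i)" if "i < n" for c i
      by (rule martingale_differences.moments_D[OF MD that])
    have sum: "(X (t k) \<omega> - approx h k \<omega>) $ c = (X 0 \<omega> - x) $ c + e k \<omega> $ c" if "\<omega> \<in> space M" "k \<le> n" for \<omega> k c
      using that(2)
    proof (induction k)
      case 0
      then show ?case by (simp add: e_def t_def)
    next
      case (Suc k)
      have "X (t (Suc k)) \<omega> $ c - step (t k) (t (Suc k)) \<omega> (approx h k \<omega>) $ c =
         (X (t k) \<omega> $ c - approx h k \<omega> $ c) + P c k \<omega> + D c k \<omega>"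
        unfolding P_def D_def using Suc.prems by (intro one_step_error st that(1)) auto
      moreover have "step (t k) (t (Suc k)) \<omega> (approx h k \<omega>) = approx h (Suc k) \<omega>" by (simp add: t_def)
      ultimately show ?case using Suc by (simp add: e_def)
    qed
    have diff: "AE \<omega> in M. \<forall>k\<le>n. X (t k) \<omega> - approx h k \<omega> = e k \<omega>"
      using X_initial AE_space
    proof eventually_elim
      case (elim \<omega>)
      show ?case
      proof (intro allI impI)
        fix k assume k: "k \<le> n"
        show "X (t k) \<omega> - approx h k \<omega> = e k \<omega>"
          unfolding vec_eq_iff using sum[OF elim(2) k] elim(1) by simp
      qed
    qed
    have em: "e k \<in> borel_measurable M" if k: "k \<le> n" for k
    proof (rule borel_measurable_vecI)
      fix c
      have "all_moments M (\<lambda>\<omega>. (\<Sum>i<k. P c i \<omega>) + (\<Sum>i<k. D c i \<omega>))"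
        using k by (intro all_moments_add all_moments_sum Pm Dm) auto
      then show "(\<lambda>\<omega>. e k \<omega> $ c) \<in> borel_measurable M" by (simp add: e_def all_moments_measurable)
    qed
    have En: "even_moment q (\<lambda>\<omega>. norm (X (t k) \<omega> - approx h k \<omega>)) =
        even_moment q (\<lambda>\<omega>. norm (e k \<omega>))" if k: "k \<le> n" for k
    proof (rule integral_cong_AE)
      have [measurable]: "X (t k) \<in> borel_measurable M" "approx h k \<in> borel_measurable M" "e k \<in>
          borel_measurable M"
        using X_measurable[of "t k"] t0 tT[OF k] YM[OF k] em[OF k] by auto
      show "(\<lambda>\<omega>. norm (X (t k) \<omega> - approx h k \<omega>) ^ (2 * q)) \<in> borel_measurable M"
        "(\<lambda>\<omega>. norm (e k \<omega>) ^ (2 * q)) \<in> borel_measurable M" by measurable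
      show "AE \<omega> in M. norm (X (t k) \<omega> - approx h k \<omega>) ^ (2 * q) = norm (e k \<omega>) ^ (2 * q)"
        using diff by eventually_elim (use k in simp)
    qed
    have "\<exists>Z. integrable M Z \<and> (\<forall>k\<le>n. \<forall>\<omega>. norm (e k \<omega>) ^ (2 * q) \<le> Z \<omega>) \<and>
      expectation Z \<le> \<Lambda> * T * exp (\<Lambda> * T) * h ^ q"
      unfolding \<Lambda>_def
    proof (rule error_recursion[OF MD Pm _ em q h \<kappa>_parts(3)])
      show "e k \<omega> $ c = (\<Sum>i<k. P c i \<omega>) + (\<Sum>i<k. D c i \<omega>)" for k \<omega> c by (simp add: e_def)
      fix c i assume i: "i < n"
      have Yi: "approx h i \<in> borel_measurable (F (t i))" "\<And>c. all_moments M (\<lambda>\<omega>. approx h i \<omega> $ c)" using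
          Y[of i] i by auto
      have En': "even_moment q (\<lambda>\<omega>. norm (X (t i) \<omega> - approx h i \<omega>)) = even_moment q (\<lambda>\<omega>. norm (e i \<omega>))"
        using i by (intro En) simp
      show "even_moment q (P c i) \<le> \<kappa> q * h ^ (2 * q) * (h ^ q + even_moment q (\<lambda>\<omega>. norm (e i \<omega>)))"
        using error_rest_bound[OF st[OF i] Yi q(1), of c] unfolding P_def t_diff En' .
      show "even_moment q (D c i) \<le> \<kappa> q * h ^ q * (h ^ q + even_moment q (\<lambda>\<omega>. norm (e i \<omega>)))"
        using error_noise_bound[OF st[OF i] Yi q(1), of c] unfolding D_def t_diff En' .
    qed
    then obtain Z where Z: "integrable M Z" "\<And>k \<omega>. k \<le> n \<Longrightarrow> norm (e k \<omega>) ^ (2 * q) \<le> Z \<omega>"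
      "expectation Z \<le> \<Lambda> * T * exp (\<Lambda> * T) * h ^ q" by blast
    have "AE \<omega> in M. \<forall>k\<le>n. norm (X (real k * h) \<omega> - scheme M F d S \<sigma> B B' h x k \<omega>) ^ (2 * q) \<le> Z \<omega>"
      using diff scheme_approx[OF less_imp_le[OF h(1)]]
      by eventually_elim (use Z(2) in \<open>simp add: t_def\<close>)
    then show ?thesis using Z by blast
  qed
  moreover have "0 \<le> \<Lambda> * T * exp (\<Lambda> * T)" using \<Lambda>0 T by simp
  ultimately show ?thesis by blast
qed

text \<open>Integer exponents suffice: \<open>y\<^sup>2\<^sup>p \<le> h\<^sup>p (1 + y\<^sup>2\<^sup>q / h\<^sup>q)\<close> whenever \<open>p \<le> q\<close>.\<close>

lemma powr_interpolation:
  fixes y h p :: real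
  assumes y: "y \<ge> 0" and h: "h > 0" and p: "0 < p" "p \<le> real q"
  shows "y powr (2 * p) \<le> h powr p * (1 + y ^ (2 * q) / h ^ q)"
proof -
  define z where "z = y\<^sup>2 / h"
  have z: "z \<ge> 0" using h by (simp add: z_def)
  have "y powr (2 * p) = (y\<^sup>2) powr p"
  proof -
    have "y\<^sup>2 = y powr 2" using y by simp
    then show ?thesis by (simp only: powr_powr)
  qed
  also have "\<dots> = (h * z) powr p" using h by (simp add: z_def)
  also have "\<dots> = h powr p * z powr p" using h z by (simp add: powr_mult)
  also have "\<dots> \<le> h powr p * (1 + z ^ q)"
  proof (rule mult_left_mono)
    show "z powr p \<le> 1 + z ^ q"
    proof (cases "z \<le> 1")
      case True
      then have "z powr p \<le> 1" using z p by (intro powr_le1) auto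
      then show ?thesis using zero_le_power[OF z, of q] by linarith
    next
      case False
      then have "z powr p \<le> z powr real q" using p by (intro powr_mono) auto
      also have "\<dots> = z ^ q" using False by (intro powr_realpow) auto
      finally show ?thesis by simp
    qed
  qed simp
  also have "z ^ q = y ^ (2 * q) / h ^ q" by (simp add: z_def power_divide power_mult)
  finally show ?thesis .
qed

theorem strong_rate:
  assumes p: "p \<ge> 1"
  shows "\<exists>C>0. \<forall>l::nat.
    (let h = T / 2 ^ l;
         err = (\<lambda>\<omega>. MAX k\<in>{0..2 ^ l}.
                  norm (X (real k * h) \<omega> - scheme M F d S \<sigma> B B' h x k \<omega>) powr (2 * p))
     in integrable M err \<and> expectation err \<le> C * h powr p)"
proof -
  obtain q0 :: nat where q0: "p \<le> real q0" using real_arch_simple by blast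
  (* Doob's inequality is available for even q. *)
  define q where "q = 2 * (q0 + 1)"
  have q: "q \<ge> 1" "even q" "p \<le> real q" using q0 by (auto simp: q_def)
  obtain C where C: "C \<ge> 0" and Z: "\<And>n h. h > 0 \<Longrightarrow> real n * h = T \<Longrightarrow>
    \<exists>Z. integrable M Z \<and> expectation Z \<le> C * h ^ q \<and>
      (AE \<omega> in M. \<forall>k\<le>n. norm (X (real k * h) \<omega> - scheme M F d S \<sigma> B B' h x k \<omega>) ^ (2 * q) \<le> Z \<omega>)"
    using strong_error[OF q(1,2)] by blast
  show ?thesis
  proof (intro exI[of _ "1 + C"] conjI allI)
    show "1 + C > 0" using C by simp
    fix l :: nat
    define h n where "h = T / 2 ^ l" and "n = (2::nat) ^ l"
    have h: "h > 0" "real n * h = T" using T by (auto simp: h_def n_def)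
    define err where "err \<omega> = (MAX k\<in>{0..n}. norm (X (real k * h) \<omega> - scheme M F d S \<sigma> B B' h x k \<omega>) powr
        (2 * p))" for \<omega>
    obtain Z where Z: "integrable M Z" "expectation Z \<le> C * h ^ q"
      "AE \<omega> in M. \<forall>k\<le>n. norm (X (real k * h) \<omega> - scheme M F d S \<sigma> B B' h x k \<omega>) ^ (2 * q) \<le> Z \<omega>"
      using Z[OF h] by blast
    have kT: "real k * h \<le> T" if "k \<in> {0..n}" for k
      using that h by (auto simp flip: h(2) intro!: mult_right_mono)
    have meas: "err \<in> borel_measurable M"
      unfolding err_def[abs_def]
    proof (rule borel_measurable_Max)
      fix k assume k: "k \<in> {0..n}"
      have [measurable]: "X (real k * h) \<in> borel_measurable M" "scheme M F d S \<sigma> B B' h x k \<in> borel_measurable M"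
        using h kT[OF k] by (auto intro!: X_measurable scheme_measurable)
      show "(\<lambda>\<omega>. norm (X (real k * h) \<omega> - scheme M F d S \<sigma> B B' h x k \<omega>) powr (2 * p)) \<in> borel_measurable M"
        by measurable
    qed simp
    define U where "U \<omega> = h powr p * (1 + Z \<omega> / h ^ q)" for \<omega>
    have U: "integrable M U" unfolding U_def using Z(1) by simp
    have le: "AE \<omega> in M. err \<omega> \<le> U \<omega>"
      using Z(3)
    proof eventually_elim
      case (elim \<omega>)
      show ?case unfolding err_def
      proof (rule Max.boundedI)
        fix a assume "a \<in> (\<lambda>k. norm (X (real k * h) \<omega> - scheme M F d S \<sigma> B B' h x k \<omega>) powr (2 * p)) ` {0..n}"
        then obtain k where k: "k \<le> n" "a = norm (X (real k * h) \<omega> - scheme M F d S \<sigma> B B' h x k \<omega>) powr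
            (2 * p)" by auto
        let ?y = "norm (X (real k * h) \<omega> - scheme M F d S \<sigma> B B' h x k \<omega>)"
        have "a \<le> h powr p * (1 + ?y ^ (2 * q) / h ^ q)"
          unfolding k(2) using p q h by (intro powr_interpolation) auto
        also have "\<dots> \<le> U \<omega>" unfolding U_def
          using elim k(1) h by (intro mult_left_mono add_left_mono divide_right_mono) auto
        finally show "a \<le> U \<omega>" .
      qed auto
    qed
    have err0: "0 \<le> err \<omega>" for \<omega>
      unfolding err_def
      by (rule order_trans[OF powr_ge_zero Max_ge[OF finite_imageI[OF finite_atLeastAtMost] imageI[of 0
          "{0..n}"]]]) simp
    have int: "integrable M err"
      by (rule Bochner_Integration.integrable_bound[OF U meas])
        (use le err0 in \<open>auto elim!: eventually_mono intro: order_trans\<close>)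
    have "expectation err \<le> expectation U" by (rule integral_mono_AE[OF int U le])
    also have "\<dots> = h powr p * (1 + expectation Z / h ^ q)"
      unfolding U_def using Z(1) by (simp add: prob_space)
    also have "\<dots> \<le> h powr p * (1 + C)"
      using Z(2) h by (intro mult_left_mono add_left_mono) (auto simp: field_simps)
    finally have "expectation err \<le> (1 + C) * h powr p" by (simp add: mult.commute)
    with int show "let h = T / 2 ^ l;
         err = (\<lambda>\<omega>. MAX k\<in>{0..2 ^ l}. norm (X (real k * h) \<omega> - scheme M F d S \<sigma> B B' h x k \<omega>) powr (2 * p))
     in integrable M err \<and> expectation err \<le> (1 + C) * h powr p"
      by (simp add: Let_def err_def[abs_def] h_def n_def)
  qed
qed

end

section \<open>Coefficients with bounded derivatives\<close>

lemma Cb_infinity_iter_partial: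
  assumes "f \<in> Cb_infinity"
  shows "iter_partial ks f differentiable (at z)" and "bounded (range (iter_partial ks f))"
proof -
  have "f \<in> Cb (Suc (length ks))" using assms by (auto simp: Cb_infinity_def)
  then show "iter_partial ks f differentiable (at z)" "bounded (range (iter_partial ks f))"
    by (auto simp: Cb_def)
qed

lemma iter_partial_simps:
  "iter_partial [] f = f" "iter_partial [k] f = partial_deriv k f"
  "iter_partial [k1, k2] f = partial_deriv k1 (partial_deriv k2 f)"
  by (simp_all add: iter_partial_def)

lemma Cb_infinity_continuous:
  assumes "f \<in> Cb_infinity"
  shows "continuous_on UNIV (iter_partial ks f)"
  using Cb_infinity_iter_partial(1)[OF assms, of ks]
  by (intro continuous_at_imp_continuous_on) (auto intro: differentiable_imp_continuous_within)

lemma partial_deriv_eq: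
  assumes "(f has_derivative f') (at z)"
  shows "partial_deriv k f z = f' (axis k 1)"
proof -
  have "((\<lambda>h. z + h *\<^sub>R axis k 1) has_derivative (\<lambda>h. h *\<^sub>R axis k 1)) (at 0)"
    by (auto intro!: derivative_eq_intros)
  moreover have "(f has_derivative f') (at (z + 0 *\<^sub>R axis k 1))" using assms by simp
  ultimately have "((\<lambda>h. f (z + h *\<^sub>R axis k 1)) has_derivative (\<lambda>h. f' (h *\<^sub>R axis k 1))) (at 0)"
    by (rule has_derivative_compose)
  moreover have "(\<lambda>h. f' (h *\<^sub>R axis k 1)) = (\<lambda>h. h *\<^sub>R f' (axis k 1))"
    using has_derivative_linear[OF assms] by (intro ext) (simp add: linear_cmul)
  ultimately show ?thesis
    unfolding partial_deriv_def by (intro vector_derivative_at) (simp add: has_vector_derivative_def)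
qed

text \<open>The derivative in direction \<open>v\<close> combines the partial derivatives with the coordinates of \<open>v\<close>; the
  sum of their bounds is a Lipschitz constant.\<close>

lemma Cb_infinity_Lipschitz:
  fixes f :: "real^'n \<Rightarrow> 'b::real_normed_vector"
  assumes f: "f \<in> Cb_infinity"
  shows "\<exists>L\<ge>0. \<forall>y z. norm (f y - f z) \<le> L * norm (y - z)"
proof -
  have "\<exists>b. \<forall>z. norm (partial_deriv k f z) \<le> b" for k
    using Cb_infinity_iter_partial(2)[OF f, of "[k]"] unfolding iter_partial_simps bounded_iff by auto
  then obtain b where b: "\<And>k z. norm (partial_deriv k f z) \<le> b k" by metis
  define L where "L = (\<Sum>k\<in>UNIV. b k)"
  have b0: "b k \<ge> 0" for k using order_trans[OF norm_ge_zero b] .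
  have L0: "L \<ge> 0" unfolding L_def by (intro sum_nonneg b0)
  have "\<exists>f'. (f has_derivative f') (at z)" for z
    using Cb_infinity_iter_partial(1)[OF f, of "[]" z] by (simp add: iter_partial_simps differentiable_def)
  then obtain f' where f': "\<And>z. (f has_derivative f' z) (at z)" by metis
  have on: "onorm (f' z) \<le> L" for z
  proof (rule onorm_bound[OF L0])
    fix v :: "real^'n"
    have lin: "linear (f' z)" by (rule has_derivative_linear[OF f'])
    have "v = (\<Sum>k\<in>UNIV. (v $ k) *\<^sub>R axis k 1)"
      by (simp add: vec_eq_iff axis_def if_distrib cong: if_cong)
    then have "f' z v = f' z (\<Sum>k\<in>UNIV. (v $ k) *\<^sub>R axis k 1)" by (rule arg_cong)
    also have "\<dots> = (\<Sum>k\<in>UNIV. (v $ k) *\<^sub>R f' z (axis k 1))"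
      by (simp add: linear_sum[OF lin] linear_cmul[OF lin])
    also have "norm \<dots> \<le> (\<Sum>k\<in>UNIV. norm v * b k)"
    proof (rule sum_norm_le)
      fix k
      have "norm (f' z (axis k 1)) \<le> b k" using b[of k z] partial_deriv_eq[OF f', of k z] by simp
      then show "norm ((v $ k) *\<^sub>R f' z (axis k 1)) \<le> norm v * b k"
        using component_le_norm_cart[of v k] by (auto intro!: mult_mono)
    qed
    also have "\<dots> = L * norm v" by (simp only: L_def sum_distrib_left[symmetric] mult.commute)
    finally show "norm (f' z v) \<le> L * norm v" .
  qed
  have "norm (f y - f z) \<le> L * norm (y - z)" for y z
    by (rule differentiable_bound[of UNIV f f']) (use f' on in auto)
  then show ?thesis using L0 by blast
qed

lemma bounded_continuous_Lop:
  fixes \<sigma> :: "nat \<Rightarrow> real^'n \<Rightarrow> real^'n"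
  assumes \<sigma>: "\<And>j. j \<le> d \<Longrightarrow> \<sigma> j \<in> Cb_infinity" and ij: "i \<le> d" "j \<le> d"
  shows "\<exists>K. \<forall>z. norm (Lop d \<sigma> i (\<sigma> j) z) \<le> K" and "continuous_on UNIV (Lop d \<sigma> i (\<sigma> j))"
proof -
  have "\<exists>b. \<forall>z. norm (iter_partial ks (\<sigma> j) z) \<le> b" if "j \<le> d" for ks j
    using Cb_infinity_iter_partial(2)[OF \<sigma>[OF that], of ks] unfolding bounded_iff by auto
  note ex = this
  define b where "b ks j = (SOME b. \<forall>z. norm (iter_partial ks (\<sigma> j) z) \<le> b)" for ks j
  have b: "norm (iter_partial ks (\<sigma> j) z) \<le> b ks j" if "j \<le> d" for ks j z
    using someI_ex[OF ex[OF that, of ks]] unfolding b_def by blast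
  have b0: "b ks j \<ge> 0" if "j \<le> d" for ks j using order_trans[OF norm_ge_zero b[OF that]] .
  have c: "\<bar>\<sigma> j z $ k\<bar> \<le> b [] j" if "j \<le> d" for j z k
    using order_trans[OF component_le_norm_cart b[OF that, of "[]" z]] by (simp add: iter_partial_simps)
  have p1: "norm (partial_deriv k (\<sigma> j) z) \<le> b [k] j" if "j \<le> d" for j z k
    using b[OF that, of "[k]" z] by (simp add: iter_partial_simps)
  have p2: "norm (partial_deriv k1 (partial_deriv k2 (\<sigma> j)) z) \<le> b [k1, k2] j" if "j \<le> d" for j z k1 k2
    using b[OF that, of "[k1, k2]" z] by (simp add: iter_partial_simps)
  have cont: "continuous_on UNIV (iter_partial ks (\<sigma> j))" if "j \<le> d" for ks j
    by (rule Cb_infinity_continuous[OF \<sigma>[OF that]])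
  have cc: "continuous_on UNIV (\<lambda>z. \<sigma> j z $ k)" "continuous_on UNIV (partial_deriv k (\<sigma> j))"
    "continuous_on UNIV (partial_deriv k1 (partial_deriv k2 (\<sigma> j)))" if "j \<le> d" for j k k1 k2
    using cont[OF that, of "[]"] cont[OF that, of "[k]"] cont[OF that, of "[k1, k2]"]
    unfolding iter_partial_simps by (auto intro: continuous_on_component)
  define N where "N = (\<Sum>k\<in>(UNIV::'n set). b [] i * b [k] j) + (1/2) * (\<Sum>m=1..d. \<Sum>k1\<in>(UNIV::'n set).
      \<Sum>k2\<in>(UNIV::'n set). (b [] m * b [] m) * b [k1, k2] j)"
  have first: "norm (\<Sum>k\<in>UNIV. (\<sigma> i z $ k) *\<^sub>R partial_deriv k (\<sigma> j) z) \<le>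
      (\<Sum>k\<in>(UNIV::'n set). b [] i * b [k] j)" for z
    by (intro sum_norm_le) (auto intro!: mult_mono c p1 ij b0)
  have second: "norm (\<Sum>m=1..d. \<Sum>k1\<in>UNIV. \<Sum>k2\<in>UNIV. (\<sigma> m z $ k1 * \<sigma> m z $ k2) *\<^sub>R partial_deriv k1
      (partial_deriv k2 (\<sigma> j)) z)
     \<le> (\<Sum>m=1..d. \<Sum>k1\<in>(UNIV::'n set). \<Sum>k2\<in>(UNIV::'n set). (b [] m * b [] m) * b [k1, k2] j)" for z
    by (intro sum_norm_le) (auto simp: abs_mult intro!: mult_mono c p2 ij b0 mult_nonneg_nonneg)
  have second0: "0 \<le> (\<Sum>m=1..d. \<Sum>k1\<in>(UNIV::'n set). \<Sum>k2\<in>(UNIV::'n set). (b [] m * b [] m) * b [k1, k2] j)"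
    using order_trans[OF norm_ge_zero second] .
  have "norm (Lop d \<sigma> i (\<sigma> j) z) \<le> N" for z
  proof (cases "i = 0")
    case True
    have "norm (Lop d \<sigma> i (\<sigma> j) z) \<le> norm (\<Sum>k\<in>UNIV. (\<sigma> i z $ k) *\<^sub>R partial_deriv k (\<sigma> j) z)
      + norm ((1/2) *\<^sub>R (\<Sum>m=1..d. \<Sum>k1\<in>UNIV. \<Sum>k2\<in>UNIV. (\<sigma> m z $ k1 * \<sigma> m z $ k2) *\<^sub>R partial_deriv k1
          (partial_deriv k2 (\<sigma> j)) z))"
      using True by (simp only: Lop_def if_True norm_triangle_ineq refl simp_thms)
    also have "\<dots> \<le> N" unfolding N_def norm_scaleR by (intro add_mono first mult_mono second) auto
    finally show ?thesis .
  next
    case False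
    have "norm (Lop d \<sigma> i (\<sigma> j) z) \<le> (\<Sum>k\<in>(UNIV::'n set). b [] i * b [k] j)"
      unfolding Lop_def if_not_P[OF False] by (rule first)
    then show ?thesis using second0 unfolding N_def by linarith
  qed
  then show "\<exists>K. \<forall>z. norm (Lop d \<sigma> i (\<sigma> j) z) \<le> K" by blast
  show "continuous_on UNIV (Lop d \<sigma> i (\<sigma> j))"
    unfolding Lop_def[abs_def] using ij
    by (cases "i = 0") (auto intro!: continuous_on_add continuous_on_scaleR continuous_on_sum
        continuous_on_mult continuous_on_const cc)
qed

theorem proposition2p1:
  fixes M :: "'w measure" and F :: "real \<Rightarrow> 'w measure"
    and B B' :: "nat \<Rightarrow> real \<Rightarrow> 'w \<Rightarrow> real"
    and d :: nat and S :: "'n::finite set" and T p :: real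
    and \<sigma> :: "nat \<Rightarrow> real^'n \<Rightarrow> real^'n" and x :: "real^'n"
    and X :: "real \<Rightarrow> 'w \<Rightarrow> real^'n"
  assumes "prob_space M" and "filtered M F"
    and "T > 0" and "d \<ge> 1" and "S \<noteq> UNIV"
    and "driving_noise M F d B B'"
    and "degenerate_noise d S \<sigma>"
    and "\<forall>j\<in>{0..d}. \<sigma> j \<in> Cb_infinity"
    and "span_condition d S \<sigma>"
    and "sde_solution M F d \<sigma> B T x X"
    and "p \<ge> 1"
  shows "\<exists>C>0. \<forall>l::nat.
    (let h = T / 2 ^ l;
         err = (\<lambda>\<omega>. MAX k\<in>{0..2 ^ l}.
                  norm (X (real k * h) \<omega> - scheme M F d S \<sigma> B B' h x k \<omega>) powr (2 * p))
     in integrable M err \<and> prob_space.expectation M err \<le> C * h powr p)"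
proof -
  have \<sigma>: "\<sigma> j \<in> Cb_infinity" if "j \<le> d" for j using assms(8) that by simp
  have "\<exists>b. \<forall>z. norm (\<sigma> j z) \<le> b" if "j \<le> d" for j
    using Cb_infinity_iter_partial(2)[OF \<sigma>[OF that], of "[]"] unfolding iter_partial_simps bounded_iff by auto
  then obtain b where b: "\<And>j z. j \<le> d \<Longrightarrow> norm (\<sigma> j z) \<le> b j" by metis
  have "\<exists>L\<ge>0. \<forall>y z. norm (\<sigma> j y - \<sigma> j z) \<le> L * norm (y - z)" if "j \<le> d" for j
    by (rule Cb_infinity_Lipschitz[OF \<sigma>[OF that]])
  then obtain L where L: "\<And>j. j \<le> d \<Longrightarrow> L j \<ge> 0" "\<And>j y z. j \<le> d \<Longrightarrow> norm (\<sigma> j y - \<sigma> j z) \<le> L j * norm (y - z)" by metis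
  have "\<exists>K. \<forall>z. norm (Lop d \<sigma> i (\<sigma> j) z) \<le> K" if "i \<le> d" "j \<le> d" for i j
    by (rule bounded_continuous_Lop(1)[OF \<sigma> that])
  then obtain K where K: "\<And>i j z. i \<le> d \<Longrightarrow> j \<le> d \<Longrightarrow> norm (Lop d \<sigma> i (\<sigma> j) z) \<le> K i j" by metis
  have b0: "b j \<ge> 0" if "j \<le> d" for j using order_trans[OF norm_ge_zero b[OF that]] .
  have K0: "K i j \<ge> 0" if "i \<le> d" "j \<le> d" for i j using order_trans[OF norm_ge_zero K[OF that]] .
  (* One pair of constants for all coefficients: sums of the finitely many individual bounds. *)
  define K' where "K' = (\<Sum>j\<in>{0..d}. b j) + (\<Sum>i\<in>{0..d}. \<Sum>j\<in>{0..d}. K i j)"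
  define L' where "L' = (\<Sum>j\<in>{0..d}. L j)"
  have nn: "0 \<le> (\<Sum>j\<in>{0..d}. b j)" "0 \<le> (\<Sum>i\<in>{0..d}. \<Sum>j\<in>{0..d}. K i j)"
    by (intro sum_nonneg b0 K0; simp)+
  have bK: "b j \<le> K'" if "j \<le> d" for j
    using member_le_sum[of j "{0..d}" b] b0 that nn by (auto simp: K'_def)
  have KK: "K i j \<le> K'" if "i \<le> d" "j \<le> d" for i j
  proof -
    have "K i j \<le> (\<Sum>j\<in>{0..d}. K i j)" using K0 that by (intro member_le_sum) auto
    also have "\<dots> \<le> (\<Sum>i\<in>{0..d}. \<Sum>j\<in>{0..d}. K i j)" using K0 that by (intro member_le_sum sum_nonneg) auto
    finally show ?thesis using nn by (simp add: K'_def)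
  qed
  have LL: "L j \<le> L'" if "j \<le> d" for j
    unfolding L'_def using L(1) that by (intro member_le_sum) auto
  interpret prob_space M by fact
  interpret weak_scheme M F d B B' \<sigma> T x X K' L' S
  proof
    show "\<bar>\<sigma> j z $ c\<bar> \<le> K'" if "j \<le> d" for j z c
      using component_le_norm_cart[of "\<sigma> j z" c] b[OF that, of z] bK[OF that] by linarith
    show "\<bar>\<sigma> j z $ c - \<sigma> j y $ c\<bar> \<le> L' * norm (z - y)" if "j \<le> d" for j z c y
    proof -
      have "\<bar>\<sigma> j z $ c - \<sigma> j y $ c\<bar> \<le> norm (\<sigma> j z - \<sigma> j y)"
        using component_le_norm_cart[of "\<sigma> j z - \<sigma> j y" c] by simp
      also have "\<dots> \<le> L j * norm (z - y)" by (rule L(2)[OF that])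
      also have "\<dots> \<le> L' * norm (z - y)" by (intro mult_right_mono LL that) auto
      finally show ?thesis .
    qed
    show "K' \<ge> 0" using nn by (simp add: K'_def)
    show "L' \<ge> 0" unfolding L'_def by (intro sum_nonneg L(1)) simp
    show "\<bar>Lop d \<sigma> i (\<sigma> j) z $ c\<bar> \<le> K'" if "i \<le> d" "j \<le> d" for i j z c
      using component_le_norm_cart[of "Lop d \<sigma> i (\<sigma> j) z" c] K[OF that, of z] KK[OF that] by linarith
    show "(\<lambda>z. Lop d \<sigma> i (\<sigma> j) z $ c) \<in> borel_measurable borel" if "i \<le> d" "j \<le> d" for i j c
      by (rule measurable_compose[OF borel_measurable_continuous_onI[OF bounded_continuous_Lop(2)[OF \<sigma>
          that]] vec_nth_borel])
  qed (use assms in auto)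
  show ?thesis by (rule strong_rate[OF assms(11)])
qed

end
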